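(* Let $a$ and $b$ be integers with $a,b\ge 2$ and let $\mathrm{b}(a,b)$ denote the base size of the symmetric group $\mathrm{Sym}(ab)$ in its action on the set of partitions of $\{1,\ldots,ab\}$ into $b$ parts each of cardinality $a$. Then: (1) when $a=2$: $\mathrm{b}(2,2)$ is undefined, $\mathrm{b}(2,3)=4$, and $\mathrm{b}(2,b)=3$ for every $b\ge 4$; (2) when $b=2$: $\mathrm{b}(4,2)=5$ and $\mathrm{b}(a,2)=\lceil\log_2(a+3)\rceil+1$ for every $a\notin\{2,4\}$; (3) when $a\ge 3$ and $b\ge 3$: $\mathrm{b}(a,b)=\lceil\log_b(a+2)\rceil+1$, unless $(a,b)\in\{(3,6),(3,7),(4,7),(7,3)\}$ or $b=a+2$; (4) $\mathrm{b}(3,6)=\mathrm{b}(3,7)=\mathrm{b}(4,7)=3$, $\mathrm{b}(7,3)=4$, and for every $a\ge 3$, $\mathrm{b}(a,a+2)=3$.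
   Context: For a permutation group $G$ on a set $X$, a base is a subset of $X$ whose pointwise stabilizer in $G$ is the identity; the base size is the smallest cardinality of a base (it is undefined if no base exists, i.e. if the action is not faithful). An $(a,b)$-regular partition of a set of size $ab$ is a partition into $b$ parts each of cardinality $a$. $\mathrm{Sym}(ab)$ acts naturally on the set of $(a,b)$-regular partitions of $\{1,\ldots,ab\}$. *)

theory Defs
  imports Complex_Main "HOL-Algebra.Group_Action" "HOL-Algebra.Sym_Groups"
    "HOL-Library.Disjoint_Sets"
begin

definition pointwise_stabilizer ::
    "('g, 'm) monoid_scheme \<Rightarrow> ('g \<Rightarrow> 'x \<Rightarrow> 'x) \<Rightarrow> 'x set \<Rightarrow> 'g set" where
  "pointwise_stabilizer G \<phi> B = carrier G \<inter> (\<Inter>x\<in>B. stabilizer G \<phi> x)"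

definition is_base ::
    "('g, 'm) monoid_scheme \<Rightarrow> 'x set \<Rightarrow> ('g \<Rightarrow> 'x \<Rightarrow> 'x) \<Rightarrow> 'x set \<Rightarrow> bool" where
  "is_base G X \<phi> B \<longleftrightarrow> B \<subseteq> X \<and> pointwise_stabilizer G \<phi> B = {\<one>\<^bsub>G\<^esub>}"

text \<open>The value \<open>None\<close> means that the base size is undefined. The conditions
  \<open>finite B\<close> hold automatically when \<open>X\<close> is finite; they are there because \<open>card\<close>
  of an infinite set is \<open>0\<close>.\<close>

definition base_size ::
    "('g, 'm) monoid_scheme \<Rightarrow> 'x set \<Rightarrow> ('g \<Rightarrow> 'x \<Rightarrow> 'x) \<Rightarrow> nat option" where
  "base_size G X \<phi> =
    (if \<exists>B. finite B \<and> is_base G X \<phi> B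
     then Some (LEAST n. \<exists>B. finite B \<and> is_base G X \<phi> B \<and> card B = n)
     else None)"

definition regular_partitions :: "nat \<Rightarrow> nat \<Rightarrow> nat set set set" where
  "regular_partitions a b =
    {P. partition_on {1..a * b} P \<and> card P = b \<and> (\<forall>p\<in>P. card p = a)}"

text \<open>The restriction to \<open>regular_partitions a b\<close> is what \<open>group_action\<close> (via
  \<open>BijGroup\<close>) demands of an action.\<close>

definition partition_action :: "nat \<Rightarrow> nat \<Rightarrow> (nat \<Rightarrow> nat) \<Rightarrow> nat set set \<Rightarrow> nat set set" where
  "partition_action a b g = (\<lambda>P\<in>regular_partitions a b. (\<lambda>p. g ` p) ` P)"

definition b_size :: "nat \<Rightarrow> nat \<Rightarrow> nat option" where
  "b_size a b = base_size (sym_group (a * b)) (regular_partitions a b) (partition_action a b)"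

lemma finite_regular_partitions: "finite (regular_partitions a b)"
proof (rule finite_subset)
  show "regular_partitions a b \<subseteq> Pow (Pow {1..a * b})"
    by (auto simp: regular_partitions_def partition_on_def)
qed simp

lemma image_regular_partition:
  assumes g: "g permutes {1..a * b}" and P: "P \<in> regular_partitions a b"
  shows "(`) g ` P \<in> regular_partitions a b"
proof -
  have inj: "inj g" using g by (rule permutes_inj)
  have P': "partition_on {1..a * b} P" "card P = b" "\<forall>p\<in>P. card p = a"
    using P by (auto simp: regular_partitions_def)
  have "partition_on (g ` {1..a * b}) ((`) g ` P)"
  proof (rule partition_onI)
    show "\<Union> ((`) g ` P) = g ` {1..a * b}"
      using partition_onD1[OF P'(1)] by auto
    show "{} \<notin> (`) g ` P"
      using partition_onD3[OF P'(1)] by auto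
    fix p q assume "p \<in> (`) g ` P" "q \<in> (`) g ` P" "p \<noteq> q"
    then obtain p' q' where pq: "p' \<in> P" "q' \<in> P" "p = g ` p'" "q = g ` q'" "p' \<noteq> q'"
      by auto
    then have "disjnt p' q'"
      using partition_onD2[OF P'(1)] by (auto simp: pairwise_def)
    then show "disjnt p q"
      using pq inj by (auto simp: disjnt_def inj_def)
  qed
  moreover have "g ` {1..a * b} = {1..a * b}" using g by (rule permutes_image)
  moreover have "card ((`) g ` P) = b"
  proof -
    have "inj_on ((`) g) P"
      by (meson inj inj_image_eq_iff inj_onI)
    then show ?thesis using P'(2) by (simp add: card_image)
  qed
  moreover have "\<forall>p\<in>(`) g ` P. card p = a"
    using P'(3) inj by (auto simp: card_image inj_on_subset)
  ultimately show ?thesis by (simp add: regular_partitions_def)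
qed

lemma partition_action_group_action:
  "group_action (sym_group (a * b)) (regular_partitions a b) (partition_action a b)"
proof -
  let ?G = "sym_group (a * b)" and ?X = "regular_partitions a b"
    and ?f = "partition_action a b"
  have comp: "?f (g \<circ> h) P = ?f g (?f h P)"
    if "h permutes {1..a * b}" "P \<in> ?X" for g h P
    using that image_regular_partition[of h a b P]
    by (simp add: partition_action_def image_comp comp_def)
  have cl: "?f g P \<in> ?X" if "g permutes {1..a * b}" "P \<in> ?X" for g P
    using that image_regular_partition[of g a b P] by (simp add: partition_action_def)
  have bij: "?f g \<in> Bij ?X" if g: "g permutes {1..a * b}" for g
  proof -
    have g': "inv_into UNIV g permutes {1..a * b}" using g by (rule permutes_inv)
    have id: "?f id P = P" if "P \<in> ?X" for P using that by (simp add: partition_action_def)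
    have "bij_betw (?f g) ?X ?X"
    proof (rule bij_betw_byWitness[where f' = "?f (inv_into UNIV g)"])
      show "\<forall>P\<in>?X. ?f (inv_into UNIV g) (?f g P) = P"
        using comp[OF g, of _ "inv_into UNIV g"] id permutes_inv_o(2)[OF g] by simp
      show "\<forall>P\<in>?X. ?f g (?f (inv_into UNIV g) P) = P"
        using comp[OF g', of _ g] id permutes_inv_o(1)[OF g] by simp
    qed (use cl g g' in auto)
    then show ?thesis by (simp add: Bij_def partition_action_def)
  qed
  have "?f \<in> hom ?G (BijGroup ?X)"
  proof (rule homI)
    fix g assume "g \<in> carrier ?G"
    then show "?f g \<in> carrier (BijGroup ?X)"
      using bij by (simp add: sym_group_def BijGroup_def)
  next
    fix g h assume "g \<in> carrier ?G" "h \<in> carrier ?G"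
    then have gh: "g permutes {1..a * b}" "h permutes {1..a * b}"
      by (simp_all add: sym_group_def)
    have "?f (g \<circ> h) = compose ?X (?f g) (?f h)"
    proof
      fix P show "?f (g \<circ> h) P = compose ?X (?f g) (?f h) P"
        using comp[OF gh(2), of P g]
        by (cases "P \<in> ?X") (simp_all add: compose_def partition_action_def)
    qed
    then show "?f (g \<otimes>\<^bsub>?G\<^esub> h) = ?f g \<otimes>\<^bsub>BijGroup ?X\<^esub> ?f h"
      using bij gh by (simp add: sym_group_def BijGroup_def)
  qed
  then show ?thesis
    by (simp add: group_action_def group_hom_def group_hom_axioms_def
        sym_group_is_group group_BijGroup)
qed

end

theory Submission
  imports Defs
begin

text \<open>Label the parts of each of \<open>k\<close> given regular partitions by \<open>0, \<dots>, b - 1\<close> and send a point to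
  the vector of the labels of its parts. The partitions form a base if and only if this map is
  injective and its image, a set \<open>S\<close> of vectors in \<open>{0, \<dots>, b - 1}\<^sup>k\<close> all of whose slices have \<open>a\<close>
  elements, is preserved only by the trivial element of \<open>Sym(b)\<^sup>k\<close>. Complementation exchanges the
  slice sizes \<open>a\<close> and \<open>b\<^sup>k\<^sup>-\<^sup>1 - a\<close>, and slice sizes \<open>0\<close> and \<open>1\<close> never occur; this gives the
  lower bound.

  For the upper bound with \<open>k \<ge> 3\<close>, a small rigid set is placed over two cyclic diagonals of the first
  two coordinates; all other diagonals can then be filled with cyclically invariant sets, because
  the sizes of the fibres over the first two coordinates still single out the small set. For
  \<open>k = 2\<close> one needs an asymmetric regular bipartite graph: a circulant interval graph with four
  modified rows, which is rigid since pairs of rows differing in exactly one column form two paths of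
  different lengths and an isolated row. For \<open>b = 2\<close> the group consists of translations, and six points
  without antipodal pairs can be completed by antipodal pairs.

  The exceptional lower bounds are a parity argument, the decomposition of a two-regular bipartite
  graph into two perfect matchings, and an exhaustive search up to isomorphism over four small
  families of hypergraphs.\<close>

section \<open>Bases and rigid sets of vectors\<close>

text \<open>Everything reduces to deciding \<open>realizable a b k\<close> for the least
  \<open>k\<close> with \<open>a + 2 \<le> b ^ (k - 1)\<close>, together with failure one step
  below. Complementation halves the range of slice sizes, and the constructions depend on it. For
  \<open>b \<ge> 4\<close> the \<open>b - 2\<close> diagonals outside the rigid core provide slice
  sizes up to \<open>(b - 2) * b ^ (k - 2)\<close>, at least half of \<open>b ^ (k - 1)\<close>. For
  \<open>b = 3\<close> only a third is free, so the core must come in two versions, one tiny and one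
  filling almost a whole diagonal. The exceptions come mostly from slice size 2. It fails for
  \<open>k = 2\<close>, which by complementation yields \<open>b = a + 2\<close>; it fails for
  \<open>b = 2\<close> and every \<open>k\<close>, which turns \<open>a + 2\<close> into
  \<open>a + 3\<close>; it fails for \<open>b = k = 3\<close>, and \<open>7 = 9 - 2\<close> fails
  with it. In dimension two the pair (3, 6) is its own complement and \<open>4 = 7 - 3\<close>
  carries the failure of (3, 7) over to (4, 7); slice size 4 in \<open>cube 2 4\<close> is again its
  own complement.\<close>

definition cube :: "nat \<Rightarrow> nat \<Rightarrow> (nat \<Rightarrow> nat) set" where
  "cube b k = {..<k} \<rightarrow>\<^sub>E {..<b}"

definition act :: "nat \<Rightarrow> (nat \<Rightarrow> nat \<Rightarrow> nat) \<Rightarrow> (nat \<Rightarrow> nat) \<Rightarrow> nat \<Rightarrow> nat" where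
  "act k \<pi> v = (\<lambda>c\<in>{..<k}. \<pi> c (v c))"

definition balanced :: "nat \<Rightarrow> nat \<Rightarrow> nat \<Rightarrow> (nat \<Rightarrow> nat) set \<Rightarrow> bool" where
  "balanced a b k S \<longleftrightarrow> S \<subseteq> cube b k \<and> (\<forall>c<k. \<forall>j<b. card {v\<in>S. v c = j} = a)"

text \<open>The coordinates themselves are not permuted, since a pointwise stabilizer fixes every
  partition of the base. Inclusion says as much as equality here, because \<open>act k \<pi>\<close>
  is injective on the finite cube.\<close>

definition rigid :: "nat \<Rightarrow> nat \<Rightarrow> (nat \<Rightarrow> nat) set \<Rightarrow> bool" where
  "rigid b k S \<longleftrightarrow>
    (\<forall>\<pi>. (\<forall>c<k. \<pi> c permutes {..<b}) \<and> act k \<pi> ` S \<subseteq> S \<longrightarrow> (\<forall>c<k. \<pi> c = id))"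

definition realizable :: "nat \<Rightarrow> nat \<Rightarrow> nat \<Rightarrow> bool" where
  "realizable a b k \<longleftrightarrow> (\<exists>S. balanced a b k S \<and> rigid b k S)"

lemma finite_cube: "finite (cube b k)"
  unfolding cube_def by (rule finite_PiE) auto

lemma balanced_finite: "balanced a b k S \<Longrightarrow> finite S"
  unfolding balanced_def using finite_cube finite_subset by blast

lemma balanced_less: "balanced a b k S \<Longrightarrow> v \<in> S \<Longrightarrow> c < k \<Longrightarrow> v c < b"
  unfolding balanced_def cube_def by (auto simp: PiE_def Pi_def)

lemma cube_less: "v \<in> cube b k \<Longrightarrow> c < k \<Longrightarrow> v c < b"
  unfolding cube_def by (auto simp: PiE_def Pi_def)

lemma cube_eqI: "v \<in> cube b k \<Longrightarrow> w \<in> cube b k \<Longrightarrow> (\<And>c. c < k \<Longrightarrow> v c = w c) \<Longrightarrow> v = w"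
  unfolding cube_def by (rule PiE_ext) auto

lemma act_apply [simp]: "c < k \<Longrightarrow> act k \<pi> v c = \<pi> c (v c)"
  by (simp add: act_def)

lemma act_in_cube:
  "(\<And>c. c < k \<Longrightarrow> \<pi> c permutes {..<b}) \<Longrightarrow> v \<in> cube b k \<Longrightarrow> act k \<pi> v \<in> cube b k"
  unfolding cube_def act_def by (auto simp: PiE_iff dest!: permutes_in_image)

lemma act_inj_on:
  assumes "\<And>c. c < k \<Longrightarrow> \<pi> c permutes {..<b}" shows "inj_on (act k \<pi>) (cube b k)"
proof (rule inj_onI)
  fix v w assume vw: "v \<in> cube b k" "w \<in> cube b k" "act k \<pi> v = act k \<pi> w"
  show "v = w"
  proof (rule cube_eqI[OF vw(1,2)])
    fix c assume c: "c < k"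
    have "\<pi> c (v c) = \<pi> c (w c)" using fun_cong[OF vw(3), of c] c by simp
    then show "v c = w c" using permutes_inj[OF assms[OF c]] by (auto dest: injD)
  qed
qed

lemma act_image_eq:
  assumes "\<And>c. c < k \<Longrightarrow> \<pi> c permutes {..<b}" "S \<subseteq> cube b k" "act k \<pi> ` S \<subseteq> S"
  shows "act k \<pi> ` S = S"
proof -
  have "inj_on (act k \<pi>) S" using act_inj_on[of k \<pi> b] assms(1,2) inj_on_subset by blast
  moreover have "finite S" using assms(2) finite_cube finite_subset by blast
  ultimately show ?thesis using endo_inj_surj assms(3) by blast
qed

lemma act_mem_iff:
  assumes "\<And>c. c < k \<Longrightarrow> \<pi> c permutes {..<b}" "S \<subseteq> cube b k" "act k \<pi> ` S \<subseteq> S"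
    and "v \<in> cube b k"
  shows "act k \<pi> v \<in> S \<longleftrightarrow> v \<in> S"
proof
  assume "act k \<pi> v \<in> S"
  then obtain w where w: "w \<in> S" "act k \<pi> v = act k \<pi> w"
    using act_image_eq[of k \<pi> b S] assms(1-3) by blast
  then have "v = w" using act_inj_on[of k \<pi> b] assms(1,2,4) by (meson inj_onD subsetD)
  then show "v \<in> S" using w(1) by simp
qed (use assms(3) in blast)

text \<open>Provides the two forms of invariance used later: \<open>S\<close> is its own image, and
  membership in \<open>S\<close> is reflected as well as preserved.\<close>

lemma rigidI:
  assumes "\<And>\<pi>. (\<And>c. c < k \<Longrightarrow> \<pi> c permutes {..<b}) \<Longrightarrow> act k \<pi> ` S = S
      \<Longrightarrow> (\<And>v. v \<in> cube b k \<Longrightarrow> act k \<pi> v \<in> S \<longleftrightarrow> v \<in> S)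
      \<Longrightarrow> \<forall>c<k. \<forall>j<b. \<pi> c j = j"
    and S: "S \<subseteq> cube b k"
  shows "rigid b k S"
  unfolding rigid_def
proof (intro allI impI, elim conjE)
  fix \<pi> c assume p: "\<forall>c<k. \<pi> c permutes {..<b}" and i: "act k \<pi> ` S \<subseteq> S" and c: "c < k"
  have "\<forall>c<k. \<forall>j<b. \<pi> c j = j"
    using assms(1)[of \<pi>] p act_image_eq[of k \<pi> b S] act_mem_iff[of k \<pi> b S] S i by blast
  then have "\<pi> c j = j" for j
    using p c permutes_not_in[of "\<pi> c" "{..<b}" j] by (cases "j < b") auto
  then show "\<pi> c = id" by auto
qed

lemma rigidD:
  "rigid b k S \<Longrightarrow> (\<And>c. c < k \<Longrightarrow> \<pi> c permutes {..<b}) \<Longrightarrow> act k \<pi> ` S \<subseteq> S \<Longrightarrow> c < k \<Longrightarrow> \<pi> c = id"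
  unfolding rigid_def by blast

lemma balanced_slice_nonempty:
  assumes "balanced a b k S" "1 \<le> a" "c < k" "j < b" shows "\<exists>v\<in>S. v c = j"
proof -
  have "card {v\<in>S. v c = j} = a" using assms by (auto simp: balanced_def)
  then have "{v\<in>S. v c = j} \<noteq> {}" using assms(2) by fastforce
  then show ?thesis by auto
qed

lemma card_balanced:
  assumes "balanced a b k S" "1 \<le> k" shows "card S = a * b"
proof -
  have "S = (\<Union>j<b. {v\<in>S. v 0 = j})"
    using assms balanced_less[OF assms(1), of _ 0] by auto
  then have "card S = card (\<Union>j<b. {v\<in>S. v 0 = j})" by simp
  also have "\<dots> = (\<Sum>j<b. card {v\<in>S. v 0 = j})"
    by (rule card_UN_disjoint) (use balanced_finite[OF assms(1)] in auto)
  also have "\<dots> = (\<Sum>j<b. a)"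
    by (rule sum.cong) (use assms in \<open>auto simp: balanced_def\<close>)
  finally show ?thesis by simp
qed

section \<open>Translation between bases and rigid sets\<close>

lemma mem_stabilizer_partition:
  assumes "P \<in> regular_partitions a b"
  shows "g \<in> stabilizer (sym_group (a * b)) (partition_action a b) P \<longleftrightarrow>
    g permutes {1..a * b} \<and> (`) g ` P = P"
  using assms by (auto simp: stabilizer_def sym_group_def partition_action_def)

lemma realizable_of_base:
  assumes base: "is_base (sym_group (a * b)) (regular_partitions a b) (partition_action a b) B"
    and fin: "finite B" and a: "1 \<le> a" and k: "1 \<le> card B"
  shows "realizable a b (card B)"
proof -
  let ?X = "{1..a * b}"
  define k where "k = card B"
  obtain e where e: "bij_betw e {..<k} B"
    using fin unfolding k_def by (metis lessThan_atLeast0 ex_bij_betw_nat_finite)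
  have BX: "B \<subseteq> regular_partitions a b"
    and st: "\<And>g. g permutes ?X \<Longrightarrow> (\<And>P. P \<in> B \<Longrightarrow> (`) g ` P = P) \<Longrightarrow> g = id"
  proof -
    show BX: "B \<subseteq> regular_partitions a b" using base by (simp add: is_base_def)
    fix g assume "g permutes ?X" "\<And>P. P \<in> B \<Longrightarrow> (`) g ` P = P"
    then have "g \<in> pointwise_stabilizer (sym_group (a * b)) (partition_action a b) B"
      using BX mem_stabilizer_partition[of _ a b g]
      by (auto simp: pointwise_stabilizer_def sym_group_def)
    then show "g = id" using base by (simp add: is_base_def sym_group_def)
  qed
  have eX: "e c \<in> regular_partitions a b" if "c < k" for c
    using that e BX bij_betwE by blast
  have "\<exists>q. bij_betw q {..<b} (e c)" if "c < k" for c
  proof -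
    have "card (e c) = b" using eX[OF that] by (simp add: regular_partitions_def)
    moreover have "finite (e c)"
      using eX[OF that] finite_elements[of ?X "e c"] by (simp add: regular_partitions_def)
    ultimately show ?thesis by (metis atLeast0LessThan ex_bij_betw_nat_finite)
  qed
  then obtain q where q: "\<And>c. c < k \<Longrightarrow> bij_betw (q c) {..<b} (e c)" by metis
  have ex1: "\<exists>!j. j < b \<and> x \<in> q c j" if "c < k" "x \<in> ?X" for c x
  proof -
    have po: "partition_on ?X (e c)" using eX[OF that(1)] by (simp add: regular_partitions_def)
    then have "x \<in> \<Union> (e c)" using that(2) partition_onD1 by blast
    then obtain p where p: "p \<in> e c" "x \<in> p" by blast
    have "p \<in> q c ` {..<b}" using p(1) q[OF that(1)] by (simp add: bij_betw_def)
    then obtain j where j: "j < b" "q c j = p" by auto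
    show ?thesis
    proof (rule ex1I[of _ j])
      show "j < b \<and> x \<in> q c j" using j p by simp
      fix i assume i: "i < b \<and> x \<in> q c i"
      then have "q c i \<in> e c" using q[OF that(1)] bij_betwE by blast
      then have "q c i = p" using i p po partition_onD2[OF po]
        by (auto simp: pairwise_def disjnt_def)
      then show "i = j" using i j q[OF that(1)] by (metis bij_betw_inv_into_left lessThan_iff)
    qed
  qed
  define lab where "lab c x = (THE j. j < b \<and> x \<in> q c j)" for c x
  have lab: "lab c x < b \<and> x \<in> q c (lab c x)" if "c < k" "x \<in> ?X" for c x
    unfolding lab_def by (rule theI'[OF ex1[OF that]])
  have lab_eq: "lab c x = j" if "c < k" "x \<in> ?X" "j < b" "x \<in> q c j" for c x j
    using ex1[OF that(1,2)] lab[OF that(1,2)] that(3,4) by blast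
  have qsub: "q c j \<subseteq> ?X" and qcard: "card (q c j) = a" if "c < k" "j < b" for c j
  proof -
    have m: "q c j \<in> e c" using q[OF that(1)] that(2) bij_betwE by blast
    then show "q c j \<subseteq> ?X" using eX[OF that(1)] partition_onD1[of ?X "e c"]
      by (auto simp: regular_partitions_def)
    show "card (q c j) = a" using m eX[OF that(1)] by (auto simp: regular_partitions_def)
  qed
  have qset: "q c j = {x\<in>?X. lab c x = j}" if "c < k" "j < b" for c j
  proof (intro equalityI subsetI)
    fix x assume "x \<in> q c j"
    then show "x \<in> {x\<in>?X. lab c x = j}" using lab_eq[OF that(1) _ that(2)] qsub[OF that] by blast
  next
    fix x assume "x \<in> {x\<in>?X. lab c x = j}"
    then show "x \<in> q c j" using lab[OF that(1), of x] by blast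
  qed
  \<comment> \<open>A point permutation that acts on the labels of every coordinate maps parts to
    parts, hence fixes every partition of the base.\<close>
  have key: "g = id" if g: "g permutes ?X" and pi: "\<And>c. c < k \<Longrightarrow> \<pi> c permutes {..<b}"
    and comm: "\<And>c x. c < k \<Longrightarrow> x \<in> ?X \<Longrightarrow> lab c (g x) = \<pi> c (lab c x)" for g \<pi>
  proof (rule st[OF g])
    fix P assume "P \<in> B"
    then obtain c where c: "c < k" "P = e c" using e by (metis bij_betw_iff_bijections lessThan_iff)
    have img: "g ` q c j = q c (\<pi> c j)" if j: "j < b" for j
    proof (rule card_subset_eq)
      have pj: "\<pi> c j < b" using permutes_in_image[OF pi[OF c(1)], of j] j by simp
      show "finite (q c (\<pi> c j))" using qsub[OF c(1) pj] finite_subset by blast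
      show "g ` q c j \<subseteq> q c (\<pi> c j)"
        using comm[OF c(1)] permutes_in_image[OF g] unfolding qset[OF c(1) j] qset[OF c(1) pj] by auto
      show "card (g ` q c j) = card (q c (\<pi> c j))"
        using qcard[OF c(1) j] qcard[OF c(1) pj] permutes_inj_on[OF g] by (simp add: card_image)
    qed
    have "e c = q c ` {..<b}" using q[OF c(1)] by (simp add: bij_betw_def)
    moreover have "(`) g ` q c ` {..<b} = q c ` \<pi> c ` {..<b}"
      using img by (auto simp: image_image cong: image_cong_simp)
    ultimately show "(`) g ` P = P" using permutes_image[OF pi[OF c(1)]] c(2) by simp
  qed
  define vec where "vec x = (\<lambda>c\<in>{..<k}. lab c x)" for x
  have vec_app: "vec x c = lab c x" if "c < k" for x c using that by (simp add: vec_def)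
  \<comment> \<open>Two points with equal label vectors could be transposed without changing any
    label.\<close>
  have inj: "inj_on vec ?X"
  proof (rule inj_onI)
    fix x y assume xy: "x \<in> ?X" "y \<in> ?X" "vec x = vec y"
    have "lab c x = lab c y" if "c < k" for c using xy(3) vec_app[OF that] by metis
    then have "lab c (transpose x y z) = id (lab c z)" if "c < k" for c z
      using that by (auto simp: transpose_def)
    then have "transpose x y = id"
      using key[of "transpose x y" "\<lambda>_. id"] permutes_swap_id[OF xy(1,2)] permutes_id by blast
    then show "x = y" by (metis id_apply transpose_apply_first)
  qed
  have vcube: "vec x \<in> cube b k" if "x \<in> ?X" for x
    using lab that by (auto simp: vec_def cube_def)
  have "balanced a b k (vec ` ?X)"
    unfolding balanced_def
  proof (intro conjI allI impI)
    show "vec ` ?X \<subseteq> cube b k" using vcube by auto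
    fix c j assume c: "c < k" and j: "j < b"
    have "{v \<in> vec ` ?X. v c = j} = vec ` q c j"
      unfolding qset[OF c j] using vec_app[OF c] by auto
    then show "card {v \<in> vec ` ?X. v c = j} = a"
      using qcard[OF c j] inj_on_subset[OF inj qsub[OF c j]] by (simp add: card_image)
  qed
  moreover have "rigid b k (vec ` ?X)"
  proof (rule rigidI)
    show "vec ` ?X \<subseteq> cube b k" using vcube by auto
    fix \<pi> assume pi: "\<And>c. c < k \<Longrightarrow> \<pi> c permutes {..<b}"
      and im: "act k \<pi> ` vec ` ?X = vec ` ?X"
    \<comment> \<open>Pull \<open>\<pi>\<close> back to the points along the injective labelling;
      points outside \<open>?X\<close> stay put so that \<open>g\<close> permutes
      \<open>?X\<close>.\<close>
    define g where "g x = (if x \<in> ?X then inv_into ?X vec (act k \<pi> (vec x)) else x)" for x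
    have gX: "g x \<in> ?X" and vg: "vec (g x) = act k \<pi> (vec x)" if "x \<in> ?X" for x
    proof -
      have "act k \<pi> (vec x) \<in> vec ` ?X" using im that by blast
      then show "g x \<in> ?X" "vec (g x) = act k \<pi> (vec x)"
        using that by (simp_all only: g_def if_True inv_into_into f_inv_into_f)
    qed
    have "inj_on g ?X"
    proof (rule inj_onI)
      fix x y assume xy: "x \<in> ?X" "y \<in> ?X" "g x = g y"
      then have "act k \<pi> (vec x) = act k \<pi> (vec y)" using vg by metis
      then show "x = y" using act_inj_on[of k \<pi> b] pi inj xy vcube by (meson inj_on_eq_iff)
    qed
    moreover have "g ` ?X \<subseteq> ?X" using gX by blast
    ultimately have "bij_betw g ?X ?X"
      by (simp add: bij_betw_def endo_inj_surj)
    then have gp: "g permutes ?X"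
      by (rule bij_imp_permutes) (auto simp: g_def)
    have "g = id"
    proof (rule key[OF gp pi])
      fix c x assume c: "c < k" and x: "x \<in> ?X"
      show "lab c (g x) = \<pi> c (lab c x)"
        using fun_cong[OF vg[OF x], of c] c by (simp add: vec_app)
    qed
    show "\<forall>c<k. \<forall>j<b. \<pi> c j = j"
    proof (intro allI impI)
      fix c j assume c: "c < k" and j: "j < b"
      \<comment> \<open>As \<open>a\<close> is positive, every label is attained, so
        \<open>g = id\<close> forces \<open>\<pi> c\<close> to fix it.\<close>
      have "q c j \<noteq> {}" using qcard[OF c j] a by fastforce
      then obtain x where x: "x \<in> ?X" "lab c x = j" using qset[OF c j] by auto
      have "\<pi> c (lab c x) = lab c (g x)" using fun_cong[OF vg[OF x(1)], of c] c by (simp add: vec_app)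
      then show "\<pi> c j = j" using x(2) \<open>g = id\<close> by simp
    qed
  qed
  ultimately show ?thesis unfolding realizable_def k_def by blast
qed

text \<open>The points are identified with the vectors of \<open>S\<close> along an arbitrary
  bijection, and slices become parts. Only \<open>card B \<le> k\<close> can be claimed, because
  different coordinates may induce the same partition.\<close>

lemma base_of_realizable:
  assumes "realizable a b k" and a: "1 \<le> a" and k: "1 \<le> k"
  shows "\<exists>B. finite B \<and> card B \<le> k \<and>
    is_base (sym_group (a * b)) (regular_partitions a b) (partition_action a b) B"
proof -
  let ?X = "{1..a * b}"
  obtain S where S: "balanced a b k S" "rigid b k S" using assms by (auto simp: realizable_def)
  have fS: "finite S" and Sc: "S \<subseteq> cube b k" using balanced_finite[OF S(1)] S(1) by (auto simp: balanced_def)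
  have "card S = card ?X" using card_balanced[OF S(1) k] by simp
  then obtain h where h: "bij_betw h ?X S"
    using finite_same_card_bij[of ?X S] fS by auto
  have hS: "h x \<in> S" if "x \<in> ?X" for x using h that bij_betwE by blast
  define part where "part c j = {x\<in>?X. h x c = j}" for c j
  have cp: "card (part c j) = a" if "c < k" "j < b" for c j
  proof -
    have "h ` part c j = {v\<in>S. v c = j}"
      using bij_betw_imp_surj_on[OF h] unfolding part_def by blast
    moreover have "inj_on h (part c j)"
      by (rule inj_on_subset[OF bij_betw_imp_inj_on[OF h]]) (auto simp: part_def)
    ultimately show ?thesis using S(1) that by (metis (no_types, lifting) balanced_def card_image)
  qed
  have ne: "part c j \<noteq> {}" if "c < k" "j < b" for c j using cp[OF that] a by fastforce
  have ip: "inj_on (part c) {..<b}" if c: "c < k" for c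
  proof (rule inj_onI)
    fix i j assume "i \<in> {..<b}" "j \<in> {..<b}" and eq: "part c i = part c j"
    then obtain x where "x \<in> part c i" using ne[OF c, of i] by blast
    then show "i = j" using eq by (auto simp: part_def)
  qed
  define P where "P c = part c ` {..<b}" for c
  have PX: "P c \<in> regular_partitions a b" if "c < k" for c
    unfolding regular_partitions_def
  proof (intro CollectI conjI)
    show "partition_on ?X (P c)"
    proof (rule partition_onI)
      show "\<Union> (P c) = ?X"
        using balanced_less[OF S(1) hS that] by (auto simp: P_def part_def)
      show "{} \<notin> P c" using ne[OF that] by (auto simp: P_def)
      show "disjnt p q" if "p \<in> P c" "q \<in> P c" "p \<noteq> q" for p q
        using that by (auto simp: P_def part_def disjnt_def)
    qed
    show "card (P c) = b" using ip[OF that] by (simp add: P_def card_image)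
    show "\<forall>p\<in>P c. card p = a" using cp[OF that] by (auto simp: P_def)
  qed
  let ?B = "P ` {..<k}"
  have "is_base (sym_group (a * b)) (regular_partitions a b) (partition_action a b) ?B"
    unfolding is_base_def
  proof (intro conjI)
    show "?B \<subseteq> regular_partitions a b" using PX by auto
    have "g = id" if "g \<in> pointwise_stabilizer (sym_group (a * b)) (partition_action a b) ?B" for g
    proof -
      have g: "g permutes ?X" and gP: "\<And>c. c < k \<Longrightarrow> (`) g ` P c = P c"
        using that mem_stabilizer_partition[OF PX] by (auto simp: pointwise_stabilizer_def sym_group_def)
      have "\<exists>j'<b. g ` part c j = part c j'" if "c < k" "j < b" for c j
      proof -
        have "g ` part c j \<in> P c" using gP[OF that(1)] that(2) unfolding P_def by blast
        then show ?thesis by (auto simp: P_def)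
      qed
      then obtain \<rho> where rho: "\<And>c j. c < k \<Longrightarrow> j < b \<Longrightarrow> \<rho> c j < b \<and> g ` part c j = part c (\<rho> c j)"
        by metis
      \<comment> \<open>\<open>g\<close> permutes the parts of each coordinate, which are nonempty
        and hence distinct; outside \<open>{..<b}\<close> the induced map is completed by the
        identity.\<close>
      define \<pi> where "\<pi> c j = (if j < b then \<rho> c j else j)" for c j
      have pi: "\<pi> c permutes {..<b}" if c: "c < k" for c
      proof (rule bij_imp_permutes)
        have "inj_on (\<pi> c) {..<b}"
        proof (rule inj_onI)
          fix i j assume ij: "i \<in> {..<b}" "j \<in> {..<b}" "\<pi> c i = \<pi> c j"
          then have "g ` part c i = g ` part c j" using rho[OF c] by (auto simp: \<pi>_def)
          then have "part c i = part c j" using permutes_inj[OF g] by (simp add: inj_image_eq_iff)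
          then show "i = j" using ip[OF c] ij by (auto dest: inj_onD)
        qed
        moreover have "\<pi> c ` {..<b} \<subseteq> {..<b}" using rho[OF c] by (auto simp: \<pi>_def)
        ultimately show "bij_betw (\<pi> c) {..<b} {..<b}"
          by (simp add: bij_betw_def endo_inj_surj)
      qed (auto simp: \<pi>_def)
      have hg: "h (g x) = act k \<pi> (h x)" if x: "x \<in> ?X" for x
      proof (rule cube_eqI)
        have gx: "g x \<in> ?X" using permutes_in_image[OF g] x by blast
        show "h (g x) \<in> cube b k" using hS[OF gx] Sc by blast
        show "act k \<pi> (h x) \<in> cube b k" using act_in_cube[of k \<pi> b "h x"] pi hS[OF x] Sc by blast
        fix c assume c: "c < k"
        have l: "h x c < b" using balanced_less[OF S(1) hS[OF x] c] .
        have "g x \<in> g ` part c (h x c)" using x by (auto simp: part_def)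
        then have "h (g x) c = \<rho> c (h x c)" using rho[OF c l] by (auto simp: part_def)
        then show "h (g x) c = act k \<pi> (h x) c" using c l by (simp add: \<pi>_def)
      qed
      have "act k \<pi> ` S \<subseteq> S"
      proof
        fix w assume "w \<in> act k \<pi> ` S"
        then obtain x where x: "x \<in> ?X" "w = act k \<pi> (h x)"
          using h by (auto simp: bij_betw_def)
        then show "w \<in> S" using hg[OF x(1)] hS[of "g x"] permutes_in_image[OF g] by metis
      qed
      then have id: "\<pi> c = id" if "c < k" for c using rigidD[OF S(2), of \<pi> c] pi that by blast
      have "g x = x" if x: "x \<in> ?X" for x
      proof -
        have "act k \<pi> (h x) = h x"
          by (rule cube_eqI[where b = b and k = k])
            (use act_in_cube[of k \<pi> b "h x"] pi hS[OF x] Sc id in auto)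
        then have "h (g x) = h x" using hg[OF x] by simp
        moreover have "g x \<in> ?X" using permutes_in_image[OF g] x by blast
        ultimately show ?thesis using h x by (metis bij_betw_inv_into_left)
      qed
      then show "g = id" using permutes_not_in[OF g] by fastforce
    qed
    moreover have "id \<in> pointwise_stabilizer (sym_group (a * b)) (partition_action a b) ?B"
      using PX mem_stabilizer_partition[OF PX, of _ id] by (auto simp: pointwise_stabilizer_def sym_group_def permutes_id)
    ultimately show "pointwise_stabilizer (sym_group (a * b)) (partition_action a b) ?B = {\<one>\<^bsub>sym_group (a * b)\<^esub>}"
      by (auto simp: sym_group_def)
  qed
  moreover have "card ?B \<le> k" using card_image_le[of "{..<k}" P] by simp
  ultimately show ?thesis by blast
qed

text \<open>Repeating the last coordinate changes neither slices nor symmetries: a symmetry of the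
  long vectors restricts to one of the short vectors, and on a repeated coordinate it acts as on the
  original because every value occurs.\<close>

lemma realizable_mono:
  assumes "realizable a b k" "1 \<le> k" "k \<le> l" shows "realizable a b l"
proof -
  obtain S where S: "balanced a b k S" "rigid b k S" using assms by (auto simp: realizable_def)
  have Sc: "S \<subseteq> cube b k" using S(1) by (auto simp: balanced_def)
  define r where "r c = (if c < k then c else k - 1)" for c
  have r: "r c < k" for c using assms(2) by (simp add: r_def)
  define D where "D v = (\<lambda>c\<in>{..<l}. v (r c))" for v :: "nat \<Rightarrow> nat"
  have Dapp: "D v c = v (r c)" if "c < l" for v c using that by (simp add: D_def)
  have Dinj: "inj_on D (cube b k)"
  proof (rule inj_onI)
    fix v w assume vw: "v \<in> cube b k" "w \<in> cube b k" "D v = D w"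
    show "v = w"
    proof (rule cube_eqI[OF vw(1,2)])
      fix c assume "c < k"
      then show "v c = w c" using fun_cong[OF vw(3), of c] assms(3) by (simp add: Dapp r_def)
    qed
  qed
  have Dcube: "D ` S \<subseteq> cube b l"
    using r Sc cube_less by (fastforce simp: D_def cube_def)
  have "balanced a b l (D ` S)"
    unfolding balanced_def
  proof (intro conjI allI impI Dcube)
    fix c j assume c: "c < l" and j: "j < b"
    have "{v \<in> D ` S. v c = j} = D ` {v\<in>S. v (r c) = j}" using Dapp[OF c] by auto
    moreover have "inj_on D {v\<in>S. v (r c) = j}" using Dinj Sc by (auto simp: inj_on_def)
    ultimately show "card {v \<in> D ` S. v c = j} = a"
      using S(1) r j by (simp add: card_image balanced_def)
  qed
  moreover have "rigid b l (D ` S)"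
  proof (rule rigidI[OF _ Dcube])
    fix \<pi> assume pi: "\<And>c. c < l \<Longrightarrow> \<pi> c permutes {..<b}" and im: "act l \<pi> ` D ` S = D ` S"
    have pik: "\<pi> c permutes {..<b}" if "c < k" for c using pi that assms(3) by simp
    have *: "act k \<pi> v \<in> S \<and> act l \<pi> (D v) = D (act k \<pi> v)" if v: "v \<in> S" for v
    proof -
      obtain w where w: "w \<in> S" "act l \<pi> (D v) = D w" using im v by blast
      have "act k \<pi> v = w"
      proof (rule cube_eqI)
        show "act k \<pi> v \<in> cube b k" using act_in_cube[of k \<pi> b v] pik v Sc by blast
        show "w \<in> cube b k" using w Sc by blast
        fix c assume c: "c < k"
        then show "act k \<pi> v c = w c"
          using fun_cong[OF w(2), of c] assms(3) by (simp add: Dapp r_def)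
      qed
      then show ?thesis using w by simp
    qed
    then have idk: "\<pi> c = id" if "c < k" for c using rigidD[OF S(2), of \<pi> c] pik that by blast
    show "\<forall>c<l. \<forall>j<b. \<pi> c j = j"
    proof (intro allI impI)
      fix c j assume c: "c < l" and j: "j < b"
      show "\<pi> c j = j"
      proof (cases "a = 0")
        \<comment> \<open>There are no vectors to test on, but rigidity of the empty set forces
          \<open>b = 1\<close>.\<close>
        case True
        then have "S = {}" using card_balanced[OF S(1) assms(2)] balanced_finite[OF S(1)] by simp
        then have "act k (\<lambda>_. transpose 0 j) ` S \<subseteq> S" by simp
        moreover have "transpose 0 j permutes {..<b}" using j by (intro permutes_swap_id) auto
        ultimately have "transpose 0 j = id" using rigidD[OF S(2), of "\<lambda>_. transpose 0 j" 0] assms(2) by simp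
        then have "j = 0" by (metis id_apply transpose_apply_first)
        moreover have "b = 1"
        proof (rule ccontr)
          assume "b \<noteq> 1"
          then have "transpose 0 1 permutes {..<b}" using j by (intro permutes_swap_id) auto
          then have "transpose 0 1 = (id :: nat \<Rightarrow> nat)" using \<open>S = {}\<close>
            rigidD[OF S(2), of "\<lambda>_. transpose 0 1" 0] assms(2) by simp
          then show False by (metis id_apply transpose_apply_first zero_neq_one)
        qed
        ultimately show ?thesis using permutes_in_image[OF pi[OF c], of j] by simp
      next
        case False
        then obtain v where v: "v \<in> S" "v (r c) = j"
          using balanced_slice_nonempty[OF S(1) _ r j, of c] by auto
        have "act l \<pi> (D v) c = D (act k \<pi> v) c" using * v(1) by simp
        then show ?thesis using c v(2) r[of c] idk[OF r] by (simp add: Dapp)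
      qed
    qed
  qed
  ultimately show ?thesis unfolding realizable_def by blast
qed

section \<open>The base size in terms of realizability\<close>

lemma not_base_empty:
  assumes "2 \<le> a * b"
  shows "\<not> is_base (sym_group (a * b)) (regular_partitions a b) (partition_action a b) {}"
proof
  assume "is_base (sym_group (a * b)) (regular_partitions a b) (partition_action a b) {}"
  then have "\<And>g. g permutes {1..a * b} \<Longrightarrow> g = id"
    by (auto simp: is_base_def pointwise_stabilizer_def sym_group_def)
  moreover have "transpose 1 2 permutes {1..a * b}"
  proof (rule permutes_swap_id)
    show "1 \<in> {1..a * b}" "2 \<in> {1..a * b}"
      using assms unfolding atLeastAtMost_iff by linarith+
  qed
  ultimately have "transpose 1 2 = (id :: nat \<Rightarrow> nat)" by blast
  then have "transpose 1 2 (1::nat) = 1" by simp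
  then show False by simp
qed

text \<open>By monotonicity, failure at \<open>k - 1\<close> excludes every smaller nonempty base;
  the empty set is excluded by \<open>not_base_empty\<close>.\<close>

lemma b_size_eqI:
  assumes r: "realizable a b k" and nr: "\<not> realizable a b (k - 1)"
    and k: "2 \<le> k" and a: "1 \<le> a" and ab: "2 \<le> a * b"
  shows "b_size a b = Some k"
proof -
  let ?base = "is_base (sym_group (a * b)) (regular_partitions a b) (partition_action a b)"
  have lower: "k \<le> card B" if B: "finite B" "?base B" for B
  proof (rule ccontr)
    assume "\<not> k \<le> card B"
    moreover have "B \<noteq> {}" using not_base_empty[OF ab] B(2) by blast
    then have "1 \<le> card B" using B(1) by (simp add: Suc_leI card_gt_0_iff)
    moreover have "realizable a b (card B)"
      using realizable_of_base[OF B(2,1) a] \<open>1 \<le> card B\<close> .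
    ultimately have "realizable a b (k - 1)" using realizable_mono[of a b "card B" "k - 1"] by linarith
    then show False using nr by simp
  qed
  obtain B where B: "finite B" "card B \<le> k" "?base B"
    using base_of_realizable[OF r a] k by auto
  have "(LEAST n. \<exists>B. finite B \<and> ?base B \<and> card B = n) = k"
  proof (rule Least_equality)
    show "\<exists>B. finite B \<and> ?base B \<and> card B = k" 
      using B(1,3) le_antisym[OF B(2) lower[OF B(1,3)]] by blast
    show "k \<le> n" if "\<exists>B. finite B \<and> ?base B \<and> card B = n" for n
      using that lower by blast
  qed
  moreover have "\<exists>B. finite B \<and> ?base B" using B by blast
  ultimately show ?thesis by (simp add: b_size_def base_size_def)
qed

lemma b_size_eq_None:
  assumes nr: "\<And>k. 1 \<le> k \<Longrightarrow> \<not> realizable a b k" and a: "1 \<le> a" and ab: "2 \<le> a * b"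
  shows "b_size a b = None"
proof -
  have "\<not> is_base (sym_group (a * b)) (regular_partitions a b) (partition_action a b) B" if "finite B" for B
  proof
    assume base: "is_base (sym_group (a * b)) (regular_partitions a b) (partition_action a b) B"
    then have "B \<noteq> {}" using not_base_empty[OF ab] by blast
    then have "1 \<le> card B" using that by (simp add: Suc_leI card_gt_0_iff)
    then show False using nr realizable_of_base[OF base that a] by blast
  qed
  then show ?thesis unfolding b_size_def base_size_def by auto
qed

section \<open>Complements, obstructions and cyclic orbits\<close>

lemma card_cube_slice:
  assumes "c < k" "j < b" shows "card {v \<in> cube b k. v c = j} = b ^ (k - 1)"
proof -
  let ?T = "({..<k} - {c}) \<rightarrow>\<^sub>E {..<b}"
  have "bij_betw (\<lambda>u. u(c := j)) ?T {v \<in> cube b k. v c = j}"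
  proof (rule bij_betw_byWitness[where f' = "\<lambda>v. v(c := undefined)"])
    show "\<forall>u\<in>?T. (u(c := j))(c := undefined) = u"
      by (auto simp: PiE_iff extensional_def intro!: fun_upd_idem)
    show "\<forall>v\<in>{v \<in> cube b k. v c = j}. (v(c := undefined))(c := j) = v" by auto
    show "(\<lambda>u. u(c := j)) ` ?T \<subseteq> {v \<in> cube b k. v c = j}"
      using assms by (clarsimp simp: cube_def PiE_iff extensional_def)
    show "(\<lambda>v. v(c := undefined)) ` {v \<in> cube b k. v c = j} \<subseteq> ?T"
      by (clarsimp simp: cube_def PiE_iff extensional_def)
  qed
  then have "card {v \<in> cube b k. v c = j} = card ?T" by (rule bij_betw_same_card[symmetric])
  also have "\<dots> = b ^ (k - 1)" using assms by (simp add: card_PiE)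
  finally show ?thesis .
qed

lemma balanced_cube: "balanced (b ^ (k - 1)) b k (cube b k)"
  by (simp add: balanced_def card_cube_slice)

lemma balanced_le:
  assumes "balanced a b k S" "1 \<le> k" "1 \<le> b" shows "a \<le> b ^ (k - 1)"
proof -
  have "card {v\<in>S. v 0 = 0} \<le> card {v\<in>cube b k. v 0 = 0}"
    by (rule card_mono) (use assms finite_cube in \<open>auto simp: balanced_def\<close>)
  then show ?thesis using assms by (auto simp: balanced_def card_cube_slice)
qed

lemma balanced_Diff:
  assumes S: "balanced s b k S" and T: "balanced t b k T" and sub: "T \<subseteq> S"
  shows "balanced (s - t) b k (S - T)"
  unfolding balanced_def
proof (intro conjI allI impI)
  show "S - T \<subseteq> cube b k" using S by (auto simp: balanced_def)
  fix c j assume cj: "c < k" "j < b"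
  have "{v \<in> S - T. v c = j} = {v\<in>S. v c = j} - {v\<in>T. v c = j}" by auto
  moreover have "finite {v\<in>T. v c = j}" using balanced_finite[OF T] by simp
  ultimately show "card {v \<in> S - T. v c = j} = s - t"
    using S T cj sub card_Diff_subset[of "{v\<in>T. v c = j}" "{v\<in>S. v c = j}"]
    by (auto simp: balanced_def)
qed

lemma balanced_Un:
  assumes S: "balanced s b k S" and T: "balanced t b k T" and dis: "S \<inter> T = {}"
  shows "balanced (s + t) b k (S \<union> T)"
  unfolding balanced_def
proof (intro conjI allI impI)
  show "S \<union> T \<subseteq> cube b k" using S T by (auto simp: balanced_def)
  fix c j assume cj: "c < k" "j < b"
  have "{v \<in> S \<union> T. v c = j} = {v\<in>S. v c = j} \<union> {v\<in>T. v c = j}" by auto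
  moreover have "finite {v\<in>S. v c = j}" "finite {v\<in>T. v c = j}"
    using balanced_finite[OF S] balanced_finite[OF T] by auto
  ultimately show "card {v \<in> S \<union> T. v c = j} = s + t"
    using S T cj dis card_Un_disjoint[of "{v\<in>S. v c = j}" "{v\<in>T. v c = j}"]
    by (auto simp: balanced_def)
qed

text \<open>The group acts on the whole cube by bijections, so a set and its complement have the
  same stabilizer.\<close>

lemma realizable_complement:
  assumes "realizable a b k" shows "realizable (b ^ (k - 1) - a) b k"
proof -
  obtain S where S: "balanced a b k S" "rigid b k S" using assms by (auto simp: realizable_def)
  have Sc: "S \<subseteq> cube b k" using S(1) by (simp add: balanced_def)
  have "rigid b k (cube b k - S)"
  proof (rule rigidI)
    fix \<pi> assume pi: "\<And>c. c < k \<Longrightarrow> \<pi> c permutes {..<b}"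
      and mem: "\<And>v. v \<in> cube b k \<Longrightarrow> act k \<pi> v \<in> cube b k - S \<longleftrightarrow> v \<in> cube b k - S"
    have "act k \<pi> ` S \<subseteq> S"
      using mem act_in_cube[of k \<pi> b] pi Sc by blast
    then show "\<forall>c<k. \<forall>j<b. \<pi> c j = j" using rigidD[OF S(2), of \<pi>] pi by simp
  qed auto
  then show ?thesis using balanced_Diff[OF balanced_cube S(1) Sc] by (auto simp: realizable_def)
qed

lemma realizable_of_complement:
  assumes "realizable (b ^ (k - 1) - a) b k" "a \<le> b ^ (k - 1)" shows "realizable a b k"
  using realizable_complement[OF assms(1)] assms(2) by simp

section \<open>Slice sizes that never occur\<close>

lemma not_realizable_0:
  assumes "2 \<le> b" "1 \<le> k" shows "\<not> realizable 0 b k"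
proof
  assume "realizable 0 b k"
  then obtain S where S: "balanced 0 b k S" "rigid b k S" by (auto simp: realizable_def)
  have "S = {}" using card_balanced[OF S(1) assms(2)] balanced_finite[OF S(1)] by simp
  moreover have "transpose 0 1 permutes {..<b}" using assms by (intro permutes_swap_id) auto
  ultimately have "transpose 0 1 = (id :: nat \<Rightarrow> nat)"
    using rigidD[OF S(2), of "\<lambda>_. transpose 0 1" 0] assms by simp
  then have "transpose 0 1 (0::nat) = 0" by simp
  then show False by simp
qed

text \<open>Slices of size one make the vectors pairwise different in every coordinate, so any two
  of them can be exchanged by transposing their entries while all other vectors stay fixed.\<close>

lemma not_realizable_1:
  assumes b: "2 \<le> b" and k: "1 \<le> k" shows "\<not> realizable 1 b k"
proof
  assume "realizable 1 b k"
  then obtain S where S: "balanced 1 b k S" "rigid b k S" by (auto simp: realizable_def)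
  have Sc: "S \<subseteq> cube b k" using S(1) by (simp add: balanced_def)
  have "\<exists>v\<in>S. v 0 = 0" "\<exists>w\<in>S. w 0 = 1"
    by (rule balanced_slice_nonempty[OF S(1)]; use b k in simp)+
  then obtain v w where vw: "v \<in> S" "w \<in> S" "v 0 = 0" "w 0 = 1" by blast
  have uniq: "u = u'" if "u \<in> S" "u' \<in> S" "c < k" "u c = u' c" for u u' c
  proof -
    have "card {x\<in>S. x c = u c} = 1"
      using S(1) balanced_less[OF S(1) that(1,3)] that(3) by (auto simp: balanced_def)
    then obtain x where "{x\<in>S. x c = u c} = {x}" by (auto simp: card_Suc_eq numeral_eq_Suc)
    then show ?thesis using that by (metis (mono_tags, lifting) mem_Collect_eq singletonD)
  qed
  define \<pi> where "\<pi> c = transpose (v c) (w c)" for c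
  have pi: "\<pi> c permutes {..<b}" if "c < k" for c
    unfolding \<pi>_def using balanced_less[OF S(1) _ that] vw by (intro permutes_swap_id) auto
  have "act k \<pi> u \<in> S" if u: "u \<in> S" for u
  proof -
    have "act k \<pi> u = (if u = v then w else if u = w then v else u)" (is "_ = ?r")
    proof (rule cube_eqI)
      show "act k \<pi> u \<in> cube b k" using act_in_cube[of k \<pi> b u] pi u Sc by blast
      show "?r \<in> cube b k" using u vw Sc by auto
      fix c assume c: "c < k"
      show "act k \<pi> u c = ?r c"
        using c uniq[OF u vw(1) c] uniq[OF u vw(2) c] by (auto simp: \<pi>_def transpose_def)
    qed
    then show ?thesis using u vw by simp
  qed
  then have "\<pi> 0 = id" using rigidD[OF S(2), of \<pi> 0] pi k by auto
  then have "\<pi> 0 0 = 0" by simp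
  then show False using vw by (simp add: \<pi>_def)
qed

text \<open>A slice cannot exceed the slices of the cube, and \<open>b ^ (k - 1)\<close> and
  \<open>b ^ (k - 1) - 1\<close> are the complements of 0 and 1.\<close>

lemma not_realizable_large:
  assumes "2 \<le> b" "1 \<le> k" "b ^ (k - 1) \<le> a + 1" shows "\<not> realizable a b k"
proof
  assume r: "realizable a b k"
  then have "a \<le> b ^ (k - 1)" using balanced_le assms by (auto simp: realizable_def)
  then have "b ^ (k - 1) - a = 0 \<or> b ^ (k - 1) - a = 1" using assms(3) by linarith
  then show False
    using realizable_complement[OF r] not_realizable_0[OF assms(1,2)] not_realizable_1[OF assms(1,2)]
    by auto
qed

text \<open>With two zeros and two ones in each coordinate, \<open>p\<close> and \<open>q\<close>
  differ exactly where \<open>r\<close> and \<open>s\<close> do; flipping these coordinates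
  exchanges \<open>p\<close> with \<open>q\<close> and \<open>r\<close> with \<open>s\<close>. In
  terms of partitions, the Klein four-group acts trivially on the three partitions of four points
  into pairs.\<close>

lemma not_realizable_2_2:
  assumes k: "1 \<le> k" shows "\<not> realizable 2 2 k"
proof
  assume "realizable 2 2 k"
  then obtain S where S: "balanced 2 2 k S" "rigid 2 k S" by (auto simp: realizable_def)
  have Sc: "S \<subseteq> cube 2 k" using S(1) by (simp add: balanced_def)
  have "card S = 4" using card_balanced[OF S(1) k] by simp
  then obtain p q r s where pqrs: "S = {p, q, r, s}" and d: "distinct [p, q, r, s]"
    by (auto simp: card_Suc_eq numeral_eq_Suc)
  define \<pi> where "\<pi> c = (if p c = q c then id else transpose 0 (1::nat))" for c
  have pi: "\<pi> c permutes {..<2}" for c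
    unfolding \<pi>_def by (auto intro!: permutes_swap_id simp: permutes_id)
  have lt: "v c = 0 \<or> v c = 1" if "v \<in> S" "c < k" for v c
    using balanced_less[OF S(1) that] by auto
  have par: "\<pi> c (p c) = q c \<and> \<pi> c (q c) = p c \<and> \<pi> c (r c) = s c \<and> \<pi> c (s c) = r c" if c: "c < k" for c
  proof -
    have "card {v\<in>S. v c = 0} = 2" using S(1) c by (simp add: balanced_def)
    moreover have "card {v\<in>S. v c = 0} = (\<Sum>v\<in>S. of_bool (v c = 0))"
      using balanced_finite[OF S(1)] by (simp add: sum_of_bool_eq Int_def)
    ultimately have "(\<Sum>v\<in>S. of_bool (v c = 0)) = (2::nat)" by simp
    then have "of_bool (p c = 0) + of_bool (q c = 0) + of_bool (r c = 0) + of_bool (s c = 0) = (2::nat)"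
      unfolding pqrs using d by auto
    then show ?thesis using lt[of p c] lt[of q c] lt[of r c] lt[of s c] c
      by (auto simp: \<pi>_def pqrs split: if_splits)
  qed
  have "act k \<pi> ` S \<subseteq> S"
  proof -
    have "act k \<pi> p = q" "act k \<pi> q = p" "act k \<pi> r = s" "act k \<pi> s = r"
      by (rule cube_eqI[where b = 2 and k = k];
          use act_in_cube[of k \<pi> 2] pi Sc pqrs par in auto)+
    then show ?thesis using pqrs by auto
  qed
  then have "\<pi> c = id" if "c < k" for c using rigidD[OF S(2), of \<pi> c] pi that by auto
  then have "p c = q c" if "c < k" for c using par[OF that] that by (metis id_apply)
  then have "p = q" by (intro cube_eqI[of p 2 k q]) (use Sc pqrs in auto)
  then show False using d by simp
qed

section \<open>Fibre sizes over the first two coordinates\<close>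

lemma card_image_act_filter:
  assumes pi: "\<And>c. c < k \<Longrightarrow> \<pi> c permutes {..<b}" and S: "S \<subseteq> cube b k" and im: "act k \<pi> ` S = S"
    and PQ: "\<And>v. v \<in> S \<Longrightarrow> P (act k \<pi> v) \<longleftrightarrow> Q v"
  shows "card {v\<in>S. P v} = card {v\<in>S. Q v}"
proof -
  have "{v\<in>S. P v} = act k \<pi> ` {v\<in>S. Q v}"
  proof (intro equalityI subsetI)
    fix v assume v: "v \<in> {v\<in>S. P v}"
    then have "v \<in> act k \<pi> ` S" using im by simp
    then obtain u where "u \<in> S" "v = act k \<pi> u" by (rule imageE)
    then show "v \<in> act k \<pi> ` {v\<in>S. Q v}" using v PQ[of u] by simp
  next
    fix v assume "v \<in> act k \<pi> ` {v\<in>S. Q v}"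
    then obtain u where u: "u \<in> S" "Q u" "v = act k \<pi> u" by auto
    then have "v \<in> act k \<pi> ` S" by simp
    then show "v \<in> {v\<in>S. P v}" using u PQ[of u] im by simp
  qed
  moreover have "inj_on (act k \<pi>) (cube b k)" by (rule act_inj_on) (rule pi)
  then have "inj_on (act k \<pi>) {v\<in>S. Q v}" by (rule inj_on_subset) (use S in auto)
  ultimately show ?thesis by (simp add: card_image)
qed

definition fibre :: "(nat \<Rightarrow> nat) set \<Rightarrow> nat \<Rightarrow> nat \<Rightarrow> (nat \<Rightarrow> nat) set" where
  "fibre S i j = {v\<in>S. v 0 = i \<and> v 1 = j}"

text \<open>So \<open>\<pi> 0\<close> and \<open>\<pi> 1\<close> form an automorphism of the matrix
  of fibre sizes; subsets lying over cells with a distinctive fibre size are thereby shown to be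
  invariant.\<close>

lemma card_fibre_act:
  assumes pi: "\<And>c. c < k \<Longrightarrow> \<pi> c permutes {..<b}" and S: "S \<subseteq> cube b k" and im: "act k \<pi> ` S = S"
    and k: "2 \<le> k"
  shows "card (fibre S (\<pi> 0 i) (\<pi> 1 j)) = card (fibre S i j)"
  unfolding fibre_def
proof (rule card_image_act_filter[OF pi S im])
  fix v
  have "inj (\<pi> 0)" "inj (\<pi> 1)" using permutes_inj[OF pi[of 0]] permutes_inj[OF pi[of 1]] k by auto
  then show "(act k \<pi> v 0 = \<pi> 0 i \<and> act k \<pi> v 1 = \<pi> 1 j) \<longleftrightarrow> (v 0 = i \<and> v 1 = j)"
    using k by (auto dest: injD)
qed

section \<open>Orbits of the diagonal cyclic shift\<close>

definition shift :: "nat \<Rightarrow> nat \<Rightarrow> nat \<Rightarrow> (nat \<Rightarrow> nat) \<Rightarrow> nat \<Rightarrow> nat" where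
  "shift b k i v = (\<lambda>c\<in>{..<k}. (v c + i) mod b)"

text \<open>Normalizes the first coordinate to 0. The amount \<open>b - v 0\<close> stands for
  \<open>- v 0\<close>; for \<open>v 0 = 0\<close> it equals \<open>b\<close>, which the reduction
  modulo \<open>b\<close> absorbs.\<close>

definition rep :: "nat \<Rightarrow> nat \<Rightarrow> (nat \<Rightarrow> nat) \<Rightarrow> nat \<Rightarrow> nat" where
  "rep b k v = shift b k (b - v 0) v"

definition orbits :: "nat \<Rightarrow> nat \<Rightarrow> (nat \<Rightarrow> nat) set \<Rightarrow> (nat \<Rightarrow> nat) set" where
  "orbits b k W = {v \<in> cube b k. rep b k v \<in> W}"

lemma shift_in_cube: "1 \<le> b \<Longrightarrow> shift b k i v \<in> cube b k"
  by (auto simp: shift_def cube_def)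

lemma shift_apply: "c < k \<Longrightarrow> shift b k i v c = (v c + i) mod b"
  by (simp add: shift_def)

lemma rep_apply: "c < k \<Longrightarrow> rep b k v c = (v c + (b - v 0)) mod b"
  by (simp add: rep_def shift_def)

lemma rep_in_cube: "1 \<le> b \<Longrightarrow> rep b k v \<in> cube b k"
  by (simp add: rep_def shift_in_cube)

lemma rep_0: "v \<in> cube b k \<Longrightarrow> 1 \<le> k \<Longrightarrow> rep b k v 0 = 0"
  using cube_less[of v b k 0] by (simp add: rep_apply)

lemma mod_unshift: "(x::nat) < b \<Longrightarrow> i < b \<Longrightarrow> ((x + i) mod b + (b - i)) mod b = x"
  by (cases "x + i < b") (simp_all add: le_mod_geq)

lemma mod_shift: "(x::nat) < b \<Longrightarrow> i < b \<Longrightarrow> ((x + (b - i)) mod b + i) mod b = x"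
  by (cases "x + (b - i) < b") (simp_all add: le_mod_geq)

lemma rep_shift:
  assumes "w \<in> cube b k" "w 0 = 0" "i < b" "1 \<le> k" shows "rep b k (shift b k i w) = w"
proof (rule cube_eqI[where b = b and k = k])
  show "rep b k (shift b k i w) \<in> cube b k" using assms by (intro rep_in_cube) simp
  fix c assume c: "c < k"
  have "shift b k i w 0 = i" using assms by (simp add: shift_apply)
  then show "rep b k (shift b k i w) c = w c"
    unfolding rep_apply[OF c] shift_apply[OF c]
    using mod_unshift[OF cube_less[OF assms(1) c] assms(3)] by (simp only:)
qed (use assms in simp)

lemma shift_rep:
  assumes "v \<in> cube b k" "1 \<le> k" shows "shift b k (v 0) (rep b k v) = v"
proof (rule cube_eqI[where b = b and k = k])
  have b: "v 0 < b" using cube_less[OF assms(1), of 0] assms(2) by simp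
  show "shift b k (v 0) (rep b k v) \<in> cube b k" using b by (intro shift_in_cube) simp
  fix c assume c: "c < k"
  show "shift b k (v 0) (rep b k v) c = v c"
    unfolding rep_apply[OF c] shift_apply[OF c] by (rule mod_shift[OF cube_less[OF assms(1) c] b])
qed (use assms in simp)

lemma orbits_subset: "orbits b k W \<subseteq> cube b k"
  by (auto simp: orbits_def)

text \<open>A shift orbit meets every slice exactly once, whatever the coordinate, so each
  representative adds one to all slice sizes. This is the means of adjusting the slice size
  freely.\<close>

lemma balanced_orbits:
  assumes W: "W \<subseteq> {w \<in> cube b k. w 0 = 0}" and k: "1 \<le> k" and b: "1 \<le> b"
  shows "balanced (card W) b k (orbits b k W)"
  unfolding balanced_def
proof (intro conjI allI impI orbits_subset)
  fix c j assume c: "c < k" and j: "j < b"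
  \<comment> \<open>The orbit of \<open>w\<close> reaches the value \<open>j\<close> in coordinate
    \<open>c\<close> after a shift by \<open>j - w c\<close>, written so as to avoid truncated
    subtraction.\<close>
  have "bij_betw (\<lambda>w. shift b k ((j + (b - w c)) mod b) w) W {v \<in> orbits b k W. v c = j}"
  proof (rule bij_betw_byWitness[where f' = "rep b k"])
    show "\<forall>w\<in>W. rep b k (shift b k ((j + (b - w c)) mod b) w) = w"
    proof
      fix w assume "w \<in> W"
      then have "w \<in> cube b k" "w 0 = 0" using W by auto
      then show "rep b k (shift b k ((j + (b - w c)) mod b) w) = w"
        by (rule rep_shift) (use b k in simp_all)
    qed
    show "\<forall>v\<in>{v \<in> orbits b k W. v c = j}. shift b k ((j + (b - rep b k v c)) mod b) (rep b k v) = v"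
    proof
      fix v assume "v \<in> {v \<in> orbits b k W. v c = j}"
      then have v: "v \<in> cube b k" "v c = j" by (auto simp: orbits_def)
      have v0: "v 0 < b" using cube_less[OF v(1), of 0] k by simp
      have "(j + (b - rep b k v c)) mod b = v 0"
      proof (cases "v 0 \<le> j")
        case True
        then have "rep b k v c = j - v 0"
          using c v v0 j by (simp add: rep_apply le_mod_geq)
        then show ?thesis using True j v0 by (simp add: le_mod_geq)
      next
        case False
        then have "rep b k v c = j + b - v 0"
          using c v v0 j by (simp add: rep_apply)
        then show ?thesis using False j v0 by simp
      qed
      then show "shift b k ((j + (b - rep b k v c)) mod b) (rep b k v) = v"
        using shift_rep[OF v(1) k] by simp
    qed
    show "(\<lambda>w. shift b k ((j + (b - w c)) mod b) w) ` W \<subseteq> {v \<in> orbits b k W. v c = j}"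
    proof
      fix v assume "v \<in> (\<lambda>w. shift b k ((j + (b - w c)) mod b) w) ` W"
      then obtain w where w: "w \<in> W" and v: "v = shift b k ((j + (b - w c)) mod b) w" by auto
      have wc: "w \<in> cube b k" "w 0 = 0" using w W by auto
      have "v c = j" using c v cube_less[OF wc(1) c] j by (simp add: shift_apply mod_add_right_eq)
      moreover have "rep b k v = w" unfolding v by (rule rep_shift) (use wc b k in auto)
      ultimately show "v \<in> {v \<in> orbits b k W. v c = j}"
        using w shift_in_cube[OF b] v by (auto simp: orbits_def)
    qed
    show "rep b k ` {v \<in> orbits b k W. v c = j} \<subseteq> W" by (auto simp: orbits_def)
  qed
  then show "card {v \<in> orbits b k W. v c = j} = card W" by (rule bij_betw_same_card[symmetric])
qed

text \<open>A shift preserves the difference of the first two coordinates modulo \<open>b\<close>,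
  so the fibre size depends only on the cyclic diagonal containing the cell.\<close>

lemma card_fibre_orbits:
  assumes W: "W \<subseteq> {w \<in> cube b k. w 0 = 0}" and k: "2 \<le> k" and i: "i < b" and j: "j < b"
  shows "card (fibre (orbits b k W) i j) = card {w\<in>W. w 1 = (j + (b - i)) mod b}"
proof -
  have "bij_betw (rep b k) (fibre (orbits b k W) i j) {w\<in>W. w 1 = (j + (b - i)) mod b}"
  proof (rule bij_betw_byWitness[where f' = "shift b k i"])
    show "\<forall>v\<in>fibre (orbits b k W) i j. shift b k i (rep b k v) = v"
    proof
      fix v assume "v \<in> fibre (orbits b k W) i j"
      then have "v \<in> cube b k" "v 0 = i" by (auto simp: fibre_def orbits_def)
      then show "shift b k i (rep b k v) = v" using shift_rep[of v b k] k by simp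
    qed
    show "\<forall>w\<in>{w\<in>W. w 1 = (j + (b - i)) mod b}. rep b k (shift b k i w) = w"
    proof
      fix w assume "w \<in> {w\<in>W. w 1 = (j + (b - i)) mod b}"
      then have "w \<in> cube b k" "w 0 = 0" using W by auto
      then show "rep b k (shift b k i w) = w" by (rule rep_shift) (use i k in simp_all)
    qed
    show "rep b k ` fibre (orbits b k W) i j \<subseteq> {w\<in>W. w 1 = (j + (b - i)) mod b}"
      using k by (auto simp: fibre_def orbits_def rep_apply)
    show "shift b k i ` {w\<in>W. w 1 = (j + (b - i)) mod b} \<subseteq> fibre (orbits b k W) i j"
    proof
      fix v assume "v \<in> shift b k i ` {w\<in>W. w 1 = (j + (b - i)) mod b}"
      then obtain w where w: "w \<in> W" "w 1 = (j + (b - i)) mod b" "v = shift b k i w" by auto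
      have wc: "w \<in> cube b k" "w 0 = 0" using w W by auto
      have "rep b k v = w" using rep_shift[OF wc i] k w(3) by simp
      then show "v \<in> fibre (orbits b k W) i j"
        using w wc k i j mod_shift[OF j i] shift_in_cube[of b k i w]
        by (simp add: fibre_def orbits_def shift_apply)
    qed
  qed
  then show ?thesis by (rule bij_betw_same_card)
qed

lemma card_cube_prefix:
  assumes "2 \<le> k" "i < b" "j < b" shows "card {w \<in> cube b k. w 0 = i \<and> w 1 = j} = b ^ (k - 2)"
proof -
  let ?T = "({..<k} - {0, 1}) \<rightarrow>\<^sub>E {..<b}" and ?C = "{w \<in> cube b k. w 0 = i \<and> w 1 = j}"
  have "bij_betw (\<lambda>u. u(0 := i, 1 := j)) ?T ?C"
  proof (rule bij_betw_byWitness[where f' = "\<lambda>v. v(0 := undefined, 1 := undefined)"])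
    show "\<forall>u\<in>?T. (u(0 := i, 1 := j))(0 := undefined, 1 := undefined) = u"
    proof
      fix u assume u: "u \<in> ?T"
      have "u 0 = undefined" "u 1 = undefined" by (rule PiE_arb[OF u], simp)+
      then show "(u(0 := i, 1 := j))(0 := undefined, 1 := undefined) = u" by (simp add: fun_eq_iff)
    qed
    show "\<forall>v\<in>?C. (v(0 := undefined, 1 := undefined))(0 := i, 1 := j) = v"
    proof
      fix v assume "v \<in> ?C"
      then have "v 0 = i" "v 1 = j" by simp_all
      then show "(v(0 := undefined, 1 := undefined))(0 := i, 1 := j) = v" by (simp add: fun_eq_iff)
    qed
    show "(\<lambda>u. u(0 := i, 1 := j)) ` ?T \<subseteq> ?C"
      using assms by (clarsimp simp: cube_def PiE_iff extensional_def)
    show "(\<lambda>v. v(0 := undefined, 1 := undefined)) ` ?C \<subseteq> ?T"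
      by (clarsimp simp: cube_def PiE_iff extensional_def)
  qed
  then have "card ?C = card ?T" by (rule bij_betw_same_card[symmetric])
  also have "\<dots> = b ^ card ({..<k} - {0, 1})" by (simp add: card_PiE)
  also have "card ({..<k} - {0, 1}) = k - 2"
    using assms by (subst card_Diff_subset) auto
  finally show ?thesis .
qed

section \<open>Rigid sets over two diagonals\<close>

definition const_vec :: "nat \<Rightarrow> nat \<Rightarrow> nat \<Rightarrow> nat" where
  "const_vec k j = (\<lambda>c\<in>{..<k}. j)"

text \<open>One vector above each cell \<open>(j, j)\<close>; its invariance forces the permutations
  of all coordinates to coincide.\<close>

definition main_diag :: "nat \<Rightarrow> nat \<Rightarrow> (nat \<Rightarrow> nat) set" where
  "main_diag b k = const_vec k ` {..<b}"

definition next_diag :: "nat \<Rightarrow> nat \<Rightarrow> (nat \<Rightarrow> nat) set" where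
  "next_diag b k = {v \<in> cube b k. v 1 = (v 0 + 1) mod b}"

definition edge_vec :: "nat \<Rightarrow> nat \<Rightarrow> nat \<Rightarrow> nat \<Rightarrow> nat \<Rightarrow> nat" where
  "edge_vec b k i y = (\<lambda>c\<in>{..<k}. if c = 0 then i else if c = 1 then (i + 1) mod b else y)"

text \<open>The rotation-invariant choice \<open>{i, i + 1}\<close>, with the values at \<open>0\<close> and \<open>1\<close>
  exchanged so as to break the rotation symmetry.\<close>

definition pair_at :: "nat \<Rightarrow> nat \<Rightarrow> nat set" where
  "pair_at b i = (if i = 0 then {1, 2} else if i = 1 then {0, 1} else {i, (i + 1) mod b})"

definition twisted_pairs :: "nat \<Rightarrow> nat \<Rightarrow> (nat \<Rightarrow> nat) set" where
  "twisted_pairs b k = {edge_vec b k i y | i y. i < b \<and> y \<in> pair_at b i}"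

lemma pair_at_less: "3 \<le> b \<Longrightarrow> i < b \<Longrightarrow> y \<in> pair_at b i \<Longrightarrow> y < b"
  by (auto simp: pair_at_def split: if_splits)

lemma card_pair_at: "3 \<le> b \<Longrightarrow> i < b \<Longrightarrow> card (pair_at b i) = 2"
  by (auto simp: pair_at_def card_insert_if mod_Suc)

lemma mod_Suc_eq_iff:
  "i < b \<Longrightarrow> j < b \<Longrightarrow> (i + 1) mod b = (j + 1) mod b \<longleftrightarrow> i = (j::nat)"
  by (auto simp: mod_Suc split: if_splits)

lemma mod_Suc_neq: "2 \<le> b \<Longrightarrow> i < b \<Longrightarrow> (i + 1) mod b \<noteq> (i::nat)"
  by (auto simp: mod_Suc split: if_splits)

lemma pred_mod: "1 \<le> b \<Longrightarrow> j < b \<Longrightarrow> \<exists>i<b. (i + 1) mod b = (j::nat)"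
  by (cases j) (auto intro: exI[of _ "b - 1"] exI[of _ "j - 1"])

lemma const_vec_in_cube: "j < b \<Longrightarrow> const_vec k j \<in> cube b k"
  by (auto simp: const_vec_def cube_def)

lemma edge_vec_in_cube: "i < b \<Longrightarrow> y < b \<Longrightarrow> edge_vec b k i y \<in> cube b k"
  by (auto simp: edge_vec_def cube_def)

lemma edge_vec_simps:
  "3 \<le> k \<Longrightarrow> edge_vec b k i y 0 = i"
  "3 \<le> k \<Longrightarrow> edge_vec b k i y (Suc 0) = (i + 1) mod b"
  "3 \<le> k \<Longrightarrow> 2 \<le> c \<Longrightarrow> c < k \<Longrightarrow> edge_vec b k i y c = y"
  by (auto simp: edge_vec_def)

lemma edge_vec_inject:
  assumes "3 \<le> k" shows "edge_vec b k i y = edge_vec b k i' y' \<longleftrightarrow> i = i' \<and> y = y'"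
  using assms edge_vec_simps(1)[of k b i y] edge_vec_simps(1)[of k b i' y']
    edge_vec_simps(3)[of k 2 b i y] edge_vec_simps(3)[of k 2 b i' y'] by (metis Suc_le_eq eval_nat_numeral(3) order_refl)

lemma balanced_main_diag:
  assumes "1 \<le> k" shows "balanced 1 b k (main_diag b k)"
  unfolding balanced_def
proof (intro conjI allI impI)
  show "main_diag b k \<subseteq> cube b k" by (auto simp: main_diag_def const_vec_in_cube)
  fix c j assume "c < k" "j < b"
  then have "{v \<in> main_diag b k. v c = j} = {const_vec k j}"
    by (auto simp: main_diag_def const_vec_def)
  then show "card {v \<in> main_diag b k. v c = j} = 1" by simp
qed

lemma next_diag_eq_orbits:
  assumes "3 \<le> b" "3 \<le> k"
  shows "next_diag b k = orbits b k {w \<in> cube b k. w 0 = 0 \<and> w 1 = 1}"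
proof -
  have "rep b k v \<in> {w \<in> cube b k. w 0 = 0 \<and> w 1 = 1} \<longleftrightarrow> v 1 = (v 0 + 1) mod b" if v: "v \<in> cube b k" for v
  proof -
    have l: "v 0 < b" "v 1 < b" using cube_less[OF v] assms by auto
    have "rep b k v 1 = 1 \<longleftrightarrow> v 1 = (v 0 + 1) mod b"
    proof (cases "v 0 \<le> v 1")
      case True
      then have "rep b k v 1 = v 1 - v 0" using l assms by (simp add: rep_apply le_mod_geq)
      then show ?thesis using True l assms by (auto simp: mod_Suc)
    next
      case False
      then have "rep b k v 1 = v 1 + b - v 0" using l assms by (simp add: rep_apply)
      then show ?thesis using False l assms by (auto simp: mod_Suc)
    qed
    then show ?thesis using rep_in_cube[of b k v] rep_0[OF v] assms by simp
  qed
  then show ?thesis by (auto simp: next_diag_def orbits_def)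
qed

lemma balanced_next_diag:
  assumes "3 \<le> b" "3 \<le> k" shows "balanced (b ^ (k - 2)) b k (next_diag b k)"
  using balanced_orbits[of "{w \<in> cube b k. w 0 = 0 \<and> w 1 = 1}" b k] assms
    card_cube_prefix[of k 0 b 1] next_diag_eq_orbits[OF assms] by auto

lemma twisted_pairs_subset:
  assumes "3 \<le> b" "3 \<le> k" shows "twisted_pairs b k \<subseteq> next_diag b k"
proof
  fix v assume "v \<in> twisted_pairs b k"
  then obtain i y where v: "v = edge_vec b k i y" "i < b" "y \<in> pair_at b i"
    by (auto simp: twisted_pairs_def)
  then have "v \<in> cube b k" using edge_vec_in_cube pair_at_less[OF assms(1)] by simp
  then show "v \<in> next_diag b k" using v(1) assms by (simp add: next_diag_def edge_vec_simps)
qed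

lemma balanced_twisted_pairs:
  assumes b: "3 \<le> b" and k: "3 \<le> k" shows "balanced 2 b k (twisted_pairs b k)"
  unfolding balanced_def
proof (intro conjI allI impI)
  show "twisted_pairs b k \<subseteq> cube b k"
    using twisted_pairs_subset[OF assms] by (auto simp: next_diag_def)
  fix c j assume c: "c < k" and j: "j < b"
  have row: "card {edge_vec b k i y | y. y \<in> pair_at b i} = 2" if "i < b" for i
  proof -
    have "{edge_vec b k i y | y. y \<in> pair_at b i} = edge_vec b k i ` pair_at b i" by auto
    moreover have "inj_on (edge_vec b k i) (pair_at b i)" using k by (simp add: inj_on_def edge_vec_inject)
    ultimately show ?thesis using card_pair_at[OF b that] by (simp add: card_image)
  qed
  consider "c = 0" | "c = 1" | "2 \<le> c" by linarith
  then show "card {v \<in> twisted_pairs b k. v c = j} = 2"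
  proof cases
    case 1
    then have "{v \<in> twisted_pairs b k. v c = j} = {edge_vec b k j y | y. y \<in> pair_at b j}"
      using j k by (auto simp: twisted_pairs_def edge_vec_simps)
    then show ?thesis using row[OF j] by simp
  next
    case 2
    obtain i where i: "i < b" "(i + 1) mod b = j" using pred_mod[of b j] b j by auto
    have "{v \<in> twisted_pairs b k. v c = j} = {edge_vec b k i y | y. y \<in> pair_at b i}"
      using 2 i k by (auto simp: twisted_pairs_def edge_vec_simps mod_Suc_eq_iff[simplified])
    then show ?thesis using row[OF i(1)] by simp
  next
    case 3
    \<comment> \<open>Exchanging the pairs at 0 and 1 does not alter how often a value occurs;
      before the exchange \<open>j\<close> lies in the pairs at \<open>j - 1\<close> and
      \<open>j\<close>, cyclically.\<close>
    have "\<exists>i i'. i < b \<and> i' < b \<and> i \<noteq> i' \<and> (\<forall>n<b. j \<in> pair_at b n \<longleftrightarrow> n = i \<or> n = i')"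
    proof -
      consider "j = 0" | "j = 1" | "j = 2" | "3 \<le> j" by linarith
      then show ?thesis
      proof cases
        case 1 then show ?thesis using b
          by (intro exI[of _ 1] exI[of _ "b - 1"]) (auto simp: pair_at_def mod_Suc)
      next
        case 2 then show ?thesis using b
          by (intro exI[of _ 0] exI[of _ 1]) (auto simp: pair_at_def mod_Suc)
      next
        case 3 then show ?thesis using b
          by (intro exI[of _ 0] exI[of _ 2]) (auto simp: pair_at_def mod_Suc)
      next
        case 4 then show ?thesis using b j
          by (intro exI[of _ "j - 1"] exI[of _ j]) (auto simp: pair_at_def mod_Suc)
      qed
    qed
    then obtain i i' where i: "i < b" "i' < b" "i \<noteq> i'" "\<And>n. n < b \<Longrightarrow> j \<in> pair_at b n \<longleftrightarrow> n = i \<or> n = i'"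
      by blast
    have "{v \<in> twisted_pairs b k. v c = j} = {edge_vec b k i j, edge_vec b k i' j}"
      using 3 k c i by (auto simp: twisted_pairs_def edge_vec_simps)
    then show ?thesis using i(3) k by (simp add: edge_vec_inject)
  qed
qed

text \<open>The main diagonal makes all \<open>\<pi> c\<close> equal to \<open>\<pi> 0\<close>, and
  the cells \<open>(i, i + 1)\<close> make this a rotation by some \<open>h\<close>. The pair
  \<open>{1, 2}\<close> at 0 is the only one that consists of \<open>i + 1\<close> and
  \<open>i + 2\<close> modulo \<open>b\<close>, so \<open>h = 0\<close>; the cases below treat the
  wrap-around.\<close>

lemma twisted_pairs_rigid:
  assumes b: "3 \<le> b" and k: "3 \<le> k" and pi: "\<And>c. c < k \<Longrightarrow> \<pi> c permutes {..<b}"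
    and diag: "act k \<pi> ` main_diag b k \<subseteq> main_diag b k"
    and pairs: "act k \<pi> ` twisted_pairs b k \<subseteq> twisted_pairs b k"
  shows "\<forall>c<k. \<forall>j<b. \<pi> c j = j"
proof -
  have less: "\<pi> c j < b" if "c < k" "j < b" for c j
    using permutes_in_image[OF pi[OF that(1)], of j] that(2) by simp
  have same: "\<pi> c j = \<pi> 0 j" if c: "c < k" and j: "j < b" for c j
  proof -
    have "const_vec k j \<in> main_diag b k" using j by (auto simp: main_diag_def)
    then have "act k \<pi> (const_vec k j) \<in> main_diag b k" using diag by blast
    then obtain i where "act k \<pi> (const_vec k j) = const_vec k i" by (auto simp: main_diag_def)
    then have "act k \<pi> (const_vec k j) c = i" "act k \<pi> (const_vec k j) 0 = i"
      using c k by (simp_all add: const_vec_def)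
    then show ?thesis using c k by (simp add: const_vec_def)
  qed
  have edge: "\<pi> 0 ((i + 1) mod b) = (\<pi> 0 i + 1) mod b \<and> \<pi> 0 y \<in> pair_at b (\<pi> 0 i)"
    if i: "i < b" and y: "y \<in> pair_at b i" for i y
  proof -
    have "edge_vec b k i y \<in> twisted_pairs b k" using i y by (auto simp: twisted_pairs_def)
    then have "act k \<pi> (edge_vec b k i y) \<in> twisted_pairs b k" using pairs by blast
    then obtain i' y' where e: "act k \<pi> (edge_vec b k i y) = edge_vec b k i' y'" "y' \<in> pair_at b i'"
      by (auto simp: twisted_pairs_def)
    have "\<pi> 0 i = i'" using fun_cong[OF e(1), of 0] k by (simp add: edge_vec_simps)
    moreover have "\<pi> 1 ((i + 1) mod b) = (i' + 1) mod b"
      using fun_cong[OF e(1), of 1] k by (simp add: edge_vec_simps)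
    moreover have "\<pi> 2 y = y'" using fun_cong[OF e(1), of 2] k by (simp add: edge_vec_simps)
    ultimately show ?thesis
      using same[of 1 "(i + 1) mod b"] same[of 2 y] pair_at_less[OF b i y] k b e(2) by simp
  qed
  define h where "h = \<pi> 0 0"
  have h: "h < b" using less[of 0 0] b k by (simp add: h_def)
  have rot: "\<pi> 0 i = (i + h) mod b" if "i < b" for i
    using that
  proof (induction i)
    case 0 then show ?case using h by (simp add: h_def)
  next
    case (Suc i)
    have "pair_at b i \<noteq> {}" by (simp add: pair_at_def)
    then obtain y where "y \<in> pair_at b i" by blast
    then have "\<pi> 0 ((i + 1) mod b) = (\<pi> 0 i + 1) mod b" using edge[of i y] Suc.prems by simp
    then show ?case using Suc by (simp add: mod_Suc_eq)
  qed
  have "\<pi> 0 2 \<in> pair_at b (\<pi> 0 0)" "\<pi> 0 1 \<in> pair_at b (\<pi> 0 0)"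
    using edge[of 0 2] edge[of 0 1] b by (simp_all add: pair_at_def)
  then have m: "(2 + h) mod b \<in> pair_at b h" "(1 + h) mod b \<in> pair_at b h"
    using rot[of 2] rot[of 1] b by (simp_all add: h_def)
  have "h = 0"
  proof (rule ccontr)
    assume "h \<noteq> 0"
    consider "h = 1" | "2 \<le> h" "h + 2 < b" | "2 \<le> h" "h + 2 = b" | "2 \<le> h" "h + 1 = b"
      using h \<open>h \<noteq> 0\<close> by linarith
    then show False
    proof cases
      case 1 then show False using m(2) b by (simp add: pair_at_def)
    next
      case 2 then show False using m(1) by (simp add: pair_at_def)
    next
      case 3
      then have "(2 + h) mod b = 0" by (simp add: add.commute)
      then show False using m(1) 3 by (simp add: pair_at_def)
    next
      case 4
      then have "(2 + h) mod b = 1" using b by (simp add: le_mod_geq)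
      moreover have "(h + 1) mod b = 0" using 4 by simp
      ultimately show False using m(1) 4 by (simp add: pair_at_def)
    qed
  qed
  then show ?thesis using same rot by simp
qed

text \<open>The representatives lie on the diagonals 2, ..., b - 1, and shifts never leave a
  diagonal.\<close>

lemma orbits_off_diagonals:
  assumes W: "W \<subseteq> {w \<in> cube b k. w 0 = 0 \<and> 2 \<le> w 1}" and b: "2 \<le> b" and k: "2 \<le> k"
    and v: "v \<in> orbits b k W"
  shows "v 1 \<noteq> v 0 \<and> v 1 \<noteq> (v 0 + 1) mod b"
proof -
  have vc: "v \<in> cube b k" "rep b k v \<in> W" using v by (auto simp: orbits_def)
  then have "2 \<le> rep b k v 1" using W by blast
  then have 2: "2 \<le> (v 1 + (b - v 0)) mod b" using k by (simp add: rep_apply)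
  have l: "v 0 < b" "v 1 < b" using cube_less[OF vc(1)] k by auto
  have "v 1 \<noteq> (v 0 + 1) mod b"
  proof
    assume "v 1 = (v 0 + 1) mod b"
    then have "(v 1 + (b - v 0)) mod b = 1" using mod_unshift[of 1 b "v 0"] l b by (simp add: add.commute)
    then show False using 2 by simp
  qed
  then show ?thesis using 2 l by auto
qed

text \<open>The sizes of the fibres over the first two coordinates single out the cells of the two
  diagonals, so the orbits on the remaining diagonals can be chosen freely.\<close>

lemma realizable_two_diagonals:
  assumes b: "3 \<le> b" and k: "3 \<le> k"
    and X: "X = twisted_pairs b k \<and> x = 2 \<or> X = next_diag b k - twisted_pairs b k \<and> x = b ^ (k - 2) - 2"
    and x: "2 \<le> x"
    and W: "W \<subseteq> {w \<in> cube b k. w 0 = 0 \<and> 2 \<le> w 1}"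
    and Wt: "\<And>t. 2 \<le> t \<Longrightarrow> t < b \<Longrightarrow> card {w\<in>W. w 1 = t} \<notin> {1, x}"
  shows "realizable (1 + x + card W) b k"
proof -
  let ?D = "main_diag b k" and ?N = "next_diag b k" and ?T = "twisted_pairs b k"
  let ?O = "orbits b k W"
  define S where "S = ?D \<union> X \<union> ?O"
  have XN: "X \<subseteq> ?N" using X twisted_pairs_subset[OF b k] by auto
  have D0: "v 1 = v 0" if "v \<in> ?D" for v
    using that k by (auto simp: main_diag_def const_vec_def)
  have N1: "v 1 = (v 0 + 1) mod b" "v 0 < b" if "v \<in> ?N" for v
    using that k cube_less[of v b k 0] by (auto simp: next_diag_def)
  have b2: "2 \<le> b" using b by simp
  have O0: "v 1 \<noteq> v 0" "v 1 \<noteq> (v 0 + 1) mod b" if "v \<in> ?O" for v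
    using orbits_off_diagonals[OF W b2 _ that] k by simp_all
  have Scube: "S \<subseteq> cube b k"
    using XN balanced_main_diag[of k b] k by (auto simp: S_def next_diag_def orbits_def balanced_def)
  have SD: "v \<in> ?D" if "v \<in> S" "v 1 = v 0" for v
  proof -
    have "v \<notin> X"
    proof
      assume "v \<in> X"
      then have "v \<in> ?N" using XN by blast
      then show False using N1[of v] mod_Suc_neq[OF b2, of "v 0"] that(2) by simp
    qed
    then show ?thesis using O0(1)[of v] that unfolding S_def by blast
  qed
  have SX: "v \<in> S \<longleftrightarrow> v \<in> X" if v: "v \<in> ?N" for v
    using O0(2)[of v] N1[OF v] D0[of v] mod_Suc_neq[OF b2, of "v 0"] unfolding S_def by auto
  have W0: "W \<subseteq> {w \<in> cube b k. w 0 = 0}" using W by auto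
  have balX: "balanced x b k X"
    using X balanced_twisted_pairs[OF b k]
      balanced_Diff[OF balanced_next_diag[OF b k] balanced_twisted_pairs[OF b k] twisted_pairs_subset[OF b k]]
    by auto
  have disj: "v \<notin> X \<and> v \<notin> ?O" if "v \<in> ?D" for v
    using D0[OF that] N1[of v] XN O0(1)[of v] mod_Suc_neq[OF b2, of "v 0"] by auto
  have disj': "v \<notin> ?O" if "v \<in> X" for v
    using N1(1)[of v] XN O0(2)[of v] that by auto
  have bal: "balanced (1 + x + card W) b k S"
    unfolding S_def
  proof (intro balanced_Un balX)
    show "balanced 1 b k ?D" using balanced_main_diag k by simp
    show "balanced (card W) b k ?O" using balanced_orbits[OF W0] k b by simp
    show "?D \<inter> X = {}" using disj by blast
    show "(?D \<union> X) \<inter> ?O = {}" using disj disj' by blast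
  qed
  \<comment> \<open>The fibre sizes are 1 on the main diagonal, \<open>x\<close> on the next one
    and, by \<open>Wt\<close>, neither of these elsewhere; \<open>x \<ge> 2\<close> keeps the first
    two apart.\<close>
  have fD: "card (fibre S i i) = 1" if i: "i < b" for i
  proof -
    have "fibre S i i = {const_vec k i}"
    proof (intro equalityI subsetI)
      fix v assume "v \<in> fibre S i i"
      then have "v \<in> ?D" "v 0 = i" using SD by (auto simp: fibre_def)
      then show "v \<in> {const_vec k i}" using k by (auto simp: main_diag_def const_vec_def)
    next
      fix v assume "v \<in> {const_vec k i}"
      then show "v \<in> fibre S i i"
        using i k by (auto simp: fibre_def S_def main_diag_def const_vec_def)
    qed
    then show ?thesis by simp
  qed
  have fT: "card {v\<in>?T. v 0 = i} = 2" if "i < b" for i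
    using balanced_twisted_pairs[OF b k] k that by (simp add: balanced_def)
  have fX: "card (fibre S i ((i + 1) mod b)) = x" if i: "i < b" for i
  proof -
    have "fibre S i ((i + 1) mod b) = {v\<in>X. v 0 = i}"
    proof (intro equalityI subsetI)
      fix v assume v: "v \<in> fibre S i ((i + 1) mod b)"
      then have "v \<in> ?N" using Scube by (auto simp: fibre_def next_diag_def)
      then show "v \<in> {v\<in>X. v 0 = i}" using SX v by (auto simp: fibre_def)
    next
      fix v assume v: "v \<in> {v\<in>X. v 0 = i}"
      then have "v \<in> ?N" using XN by auto
      then show "v \<in> fibre S i ((i + 1) mod b)" using SX N1(1) v by (auto simp: fibre_def)
    qed
    then show ?thesis using balX k i by (simp add: balanced_def)
  qed
  have fO: "card (fibre S i j) \<notin> {1, x}" if ij: "i < b" "j < b" "j \<noteq> i" "j \<noteq> (i + 1) mod b" for i j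
  proof -
    have "fibre S i j = fibre ?O i j"
      using ij(3,4) D0 N1(1) XN by (auto simp: fibre_def S_def)
    then have c: "card (fibre S i j) = card {w\<in>W. w 1 = (j + (b - i)) mod b}"
      using card_fibre_orbits[OF W0 _ ij(1,2)] k by simp
    define t where "t = (j + (b - i)) mod b"
    have j: "(t + i) mod b = j" unfolding t_def by (rule mod_shift[OF ij(2,1)])
    have "t \<noteq> 0"
    proof
      assume "t = 0"
      then show False using j ij(1,3) by simp
    qed
    moreover have "t \<noteq> 1"
    proof
      assume "t = 1"
      then show False using j ij(4) by (simp add: add.commute)
    qed
    moreover have "t < b" using b by (simp add: t_def)
    ultimately show ?thesis using Wt[of t] c by (simp add: t_def)
  qed
  have "rigid b k S"
  proof (rule rigidI[OF _ Scube])
    fix \<pi> assume pi: "\<And>c. c < k \<Longrightarrow> \<pi> c permutes {..<b}" and im: "act k \<pi> ` S = S"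
      and mem: "\<And>v. v \<in> cube b k \<Longrightarrow> act k \<pi> v \<in> S \<longleftrightarrow> v \<in> S"
    have less: "\<pi> c j < b" if "c < k" "j < b" for c j
      using permutes_in_image[OF pi[OF that(1)], of j] that(2) by simp
    have fib: "card (fibre S (\<pi> 0 i) (\<pi> 1 j)) = card (fibre S i j)" for i j
      by (rule card_fibre_act[OF _ Scube im]) (use pi k in simp_all)
    have "act k \<pi> v \<in> ?D" if v: "v \<in> ?D" for v
    proof (rule SD)
      have vS: "v \<in> S" using v by (simp add: S_def)
      then show "act k \<pi> v \<in> S" using im by blast
      have l: "v 0 < b" using cube_less[of v b k 0] Scube vS k by auto
      have "card (fibre S (\<pi> 0 (v 0)) (\<pi> 1 (v 0))) = 1" using fib fD[OF l] by simp
      then have "\<pi> 1 (v 0) = \<pi> 0 (v 0)"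
        using fO[of "\<pi> 0 (v 0)" "\<pi> 1 (v 0)"] fX[of "\<pi> 0 (v 0)"] x less[of 0 "v 0"] less[of 1 "v 0"] l k by (cases "\<pi> 1 (v 0) = (\<pi> 0 (v 0) + 1) mod b") auto
      then show "act k \<pi> v 1 = act k \<pi> v 0" using D0[OF v] k by simp
    qed
    then have 1: "act k \<pi> ` ?D \<subseteq> ?D" by blast
    have N: "act k \<pi> v \<in> ?N" if v: "v \<in> ?N" for v
    proof -
      have vc: "v \<in> cube b k" using v by (simp add: next_diag_def)
      have l: "v 0 < b" using N1[OF v] by simp
      have l1: "v 1 < b" using cube_less[OF vc] k by simp
      have "card (fibre S (\<pi> 0 (v 0)) (\<pi> 1 (v 1))) = x" using fib fX[OF l] N1(1)[OF v] by simp
      then have "\<pi> 1 (v 1) = (\<pi> 0 (v 0) + 1) mod b"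
        using fO[of "\<pi> 0 (v 0)" "\<pi> 1 (v 1)"] fD[of "\<pi> 0 (v 0)"] x less[of 0 "v 0"] less[of 1 "v 1"] l l1 k by (cases "\<pi> 1 (v 1) = \<pi> 0 (v 0)") auto
      then show ?thesis
        using act_in_cube[of k \<pi> b v] pi vc k by (simp add: next_diag_def)
    qed
    \<comment> \<open>Both choices of \<open>X\<close> determine \<open>?T\<close> within the next
      diagonal, either as \<open>X\<close> or as its complement there, so invariance of
      \<open>X\<close> gives invariance of \<open>?T\<close>.\<close>
    have "act k \<pi> v \<in> ?T" if v: "v \<in> ?T" for v
    proof -
      have vN: "v \<in> ?N" using v twisted_pairs_subset[OF b k] by blast
      have "act k \<pi> v \<in> S \<longleftrightarrow> v \<in> S" using mem vN by (simp add: next_diag_def)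
      then have "act k \<pi> v \<in> X \<longleftrightarrow> v \<in> X" using SX[OF vN] SX[OF N[OF vN]] by simp
      then show ?thesis using X v N[OF vN] by auto
    qed
    then have 2: "act k \<pi> ` ?T \<subseteq> ?T" by blast
    show "\<forall>c<k. \<forall>j<b. \<pi> c j = j"
      by (rule twisted_pairs_rigid[OF b k _ 1 2]) (rule pi)
  qed
  then show ?thesis using bal by (auto simp: realizable_def)
qed

text \<open>The \<open>2 b\<close> cells \<open>(i, i)\<close> and \<open>(i, i + 1)\<close>, in cyclic order; cell \<open>p\<close> carries the label
  \<open>lab c p\<close> in each further coordinate \<open>c\<close>.\<close>

definition cell_vec :: "nat \<Rightarrow> nat \<Rightarrow> (nat \<Rightarrow> nat \<Rightarrow> nat) \<Rightarrow> nat \<Rightarrow> nat \<Rightarrow> nat" where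
  "cell_vec b k lab p =
    (\<lambda>c\<in>{..<k}. if c = 0 then p div 2 else if c = 1 then ((p + 1) div 2) mod b else lab c p)"

definition cycle_set :: "nat \<Rightarrow> nat \<Rightarrow> (nat \<Rightarrow> nat \<Rightarrow> nat) \<Rightarrow> (nat \<Rightarrow> nat) set" where
  "cycle_set b k lab = cell_vec b k lab ` {..<2 * b}"

text \<open>This gives the further coordinates slices of size two, which the rows and columns of the
  cell cycle have already.\<close>

definition pairing :: "nat \<Rightarrow> (nat \<Rightarrow> nat) \<Rightarrow> bool" where
  "pairing b f \<longleftrightarrow> (\<forall>p<2*b. f p < b) \<and> (\<forall>l<b. card {p. p < 2*b \<and> f p = l} = 2)"

lemma cell_vec_simps:
  "3 \<le> k \<Longrightarrow> cell_vec b k lab p 0 = p div 2"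
  "3 \<le> k \<Longrightarrow> cell_vec b k lab p (Suc 0) = ((p + 1) div 2) mod b"
  "2 \<le> c \<Longrightarrow> c < k \<Longrightarrow> cell_vec b k lab p c = lab c p"
  by (auto simp: cell_vec_def)

lemma cell_eqI:
  fixes p q :: nat
  assumes "2 \<le> b" "p < 2 * b" "q < 2 * b" "p div 2 = q div 2" "((p + 1) div 2) mod b = ((q + 1) div 2) mod b"
  shows "p = q"
proof (rule ccontr)
  have pb: "p div 2 < b" using assms(2) by linarith
  assume "p \<noteq> q"
  then consider "p = 2 * (p div 2)" "q = 2 * (p div 2) + 1" | "q = 2 * (p div 2)" "p = 2 * (p div 2) + 1"
    using assms(4) by linarith
  then show False
  proof cases
    case 1
    then have "(p + 1) div 2 = p div 2" "(q + 1) div 2 = p div 2 + 1" by linarith+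
    then show False using assms(5) mod_Suc_neq[OF assms(1) pb] pb by simp
  next
    case 2
    then have "(q + 1) div 2 = p div 2" "(p + 1) div 2 = p div 2 + 1" by linarith+
    then show False using assms(5) mod_Suc_neq[OF assms(1) pb] pb by simp
  qed
qed

lemma cell_vec_inj:
  assumes "2 \<le> b" "3 \<le> k" shows "inj_on (cell_vec b k lab) {..<2 * b}"
proof (rule inj_onI)
  fix p q assume pq: "p \<in> {..<2 * b}" "q \<in> {..<2 * b}" "cell_vec b k lab p = cell_vec b k lab q"
  show "p = q"
  proof (rule cell_eqI[of b])
    show "p div 2 = q div 2" "(p + 1) div 2 mod b = (q + 1) div 2 mod b"
      using fun_cong[OF pq(3), of 0] fun_cong[OF pq(3), of 1] assms by (simp_all add: cell_vec_simps)
  qed (use pq(1,2) assms in simp_all)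
qed

lemma cell_in_column:
  fixes p :: nat
  assumes "2 \<le> b" "p < 2 * b" "j < b"
  shows "((p + 1) div 2) mod b = j \<longleftrightarrow> (if j = 0 then p = 0 \<or> p = 2 * b - 1 else p = 2 * j - 1 \<or> p = 2 * j)"
proof (cases "(p + 1) div 2 < b")
  case True
  then have "((p + 1) div 2) mod b = (p + 1) div 2" by simp
  then show ?thesis using True assms by (auto; presburger)
next
  case False
  then have "p = 2 * b - 1" using assms by linarith
  then show ?thesis using assms by (auto; presburger)
qed

lemma cycle_set_subset:
  assumes "2 \<le> b" "3 \<le> k" "\<And>c. 2 \<le> c \<Longrightarrow> c < k \<Longrightarrow> pairing b (lab c)"
  shows "cycle_set b k lab \<subseteq> cube b k"
proof
  fix v assume "v \<in> cycle_set b k lab"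
  then obtain p where p: "p < 2 * b" "v = cell_vec b k lab p" by (auto simp: cycle_set_def)
  have "lab c p < b" if "2 \<le> c" "c < k" for c using assms(3)[OF that] p(1) by (simp add: pairing_def)
  then show "v \<in> cube b k" using p assms(1) by (auto simp: cell_vec_def cube_def)
qed

lemma balanced_cycle_set:
  assumes b: "2 \<le> b" and k: "3 \<le> k" and lab: "\<And>c. 2 \<le> c \<Longrightarrow> c < k \<Longrightarrow> pairing b (lab c)"
  shows "balanced 2 b k (cycle_set b k lab)"
  unfolding balanced_def
proof (intro conjI allI impI)
  show "cycle_set b k lab \<subseteq> cube b k" by (rule cycle_set_subset) (use assms in auto)
  fix c j assume c: "c < k" and j: "j < b"
  have "{v \<in> cycle_set b k lab. v c = j} = cell_vec b k lab ` {p. p < 2 * b \<and> cell_vec b k lab p c = j}"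
    by (auto simp: cycle_set_def)
  moreover have "inj_on (cell_vec b k lab) {p. p < 2 * b \<and> cell_vec b k lab p c = j}"
    by (rule inj_on_subset[OF cell_vec_inj[OF b k]]) auto
  moreover have "card {p. p < 2 * b \<and> cell_vec b k lab p c = j} = 2"
  proof -
    consider "c = 0" | "c = 1" | "2 \<le> c" by linarith
    then show ?thesis
    proof cases
      case 1
      have "{p. p < 2 * b \<and> cell_vec b k lab p c = j} = {2 * j, 2 * j + 1}"
        using 1 k j by (auto simp: cell_vec_simps)
      then show ?thesis by simp
    next
      case 2
      have "{p. p < 2 * b \<and> cell_vec b k lab p c = j} =
          {p. p < 2 * b \<and> (if j = 0 then p = 0 \<or> p = 2 * b - 1 else p = 2 * j - 1 \<or> p = 2 * j)}"
        using 2 k cell_in_column[OF b _ j] by (simp add: cell_vec_simps cong: conj_cong)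
      also have "\<dots> = (if j = 0 then {0, 2 * b - 1} else {2 * j - 1, 2 * j})"
        using b j by auto
      finally show ?thesis using b by auto
    next
      case 3
      then show ?thesis using lab[OF 3 c] j c by (simp add: cell_vec_simps pairing_def)
    qed
  qed
  ultimately show "card {v \<in> cycle_set b k lab. v c = j} = 2" by (simp add: card_image)
qed

text \<open>Rows and columns alternate along a cycle of length \<open>2 * b\<close>. With row 0
  fixed, only the identity and the reflection exchanging columns 0 and 1 remain, and
  \<open>t1\<close> excludes the latter. Walking on, the next column or row is always the only
  neighbour not yet used.\<close>

lemma cycle_fixed:
  assumes b: "3 \<le> b" and inj: "inj \<sigma>" "inj \<tau>"
    and less: "\<And>i. i < b \<Longrightarrow> \<sigma> i < b"
    and d0: "\<And>i. i < b \<Longrightarrow> \<tau> i = \<sigma> i \<or> \<tau> i = (\<sigma> i + 1) mod b"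
    and d1: "\<And>i. i < b \<Longrightarrow> \<tau> ((i + 1) mod b) = \<sigma> i \<or> \<tau> ((i + 1) mod b) = (\<sigma> i + 1) mod b"
    and s0: "\<sigma> 0 = (0::nat)" and t1: "\<tau> 1 \<noteq> (0::nat)"
    and i: "i < b"
  shows "\<sigma> i = i \<and> \<tau> i = i"
  using i
proof (induction i)
  case 0
  have "\<tau> 1 = 1" using d1[of 0] s0 t1 b by simp
  moreover have "\<tau> 0 \<noteq> \<tau> 1" using inj(2) by (simp add: inj_eq)
  ultimately show ?case using d0[of 0] s0 b by simp
next
  case (Suc i)
  then have ih: "\<sigma> i = i" "\<tau> i = i" by simp_all
  have ne: "\<tau> (Suc i) \<noteq> \<tau> i" "\<sigma> (Suc i) \<noteq> \<sigma> i" using inj by (simp_all add: inj_eq)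
  have t: "\<tau> (Suc i) = Suc i" using d1[of i] Suc.prems ih ne(1) by simp
  moreover have "\<sigma> (Suc i) = Suc i"
  proof (rule ccontr)
    assume "\<sigma> (Suc i) \<noteq> Suc i"
    then have "(\<sigma> (Suc i) + 1) mod b = (i + 1) mod b" using d0[of "Suc i"] Suc.prems t by simp
    then show False using mod_Suc_eq_iff[of "\<sigma> (Suc i)" b i] less[of "Suc i"] Suc.prems ih ne(2) by simp
  qed
  ultimately show ?case by simp
qed

text \<open>One symmetry of the labelled cycle; the labelling stays abstract because
  \<open>b \<ge> 4\<close> and \<open>b = 3\<close> use different ones.\<close>

locale cycle_symmetry =
  fixes b k :: nat and lab :: "nat \<Rightarrow> nat \<Rightarrow> nat" and \<pi> :: "nat \<Rightarrow> nat \<Rightarrow> nat"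
  assumes b: "3 \<le> b" and k: "3 \<le> k"
    and lab: "\<And>c. 2 \<le> c \<Longrightarrow> c < k \<Longrightarrow> pairing b (lab c)"
    and pi: "\<And>c. c < k \<Longrightarrow> \<pi> c permutes {..<b}"
    and im: "act k \<pi> ` cycle_set b k lab \<subseteq> cycle_set b k lab"
begin

lemma less: "c < k \<Longrightarrow> j < b \<Longrightarrow> \<pi> c j < b"
  using permutes_in_image[OF pi, of c j] by simp

lemma inj_01: "inj (\<pi> 0)" "inj (\<pi> 1)"
  using permutes_inj[OF pi[of 0]] permutes_inj[OF pi[of 1]] k by simp_all

lemma image_cell:
  assumes "p < 2 * b"
  obtains q where "q < 2 * b" "\<pi> 0 (p div 2) = q div 2"
    "\<pi> 1 (((p + 1) div 2) mod b) = ((q + 1) div 2) mod b"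
    "\<And>c. 2 \<le> c \<Longrightarrow> c < k \<Longrightarrow> \<pi> c (lab c p) = lab c q"
proof -
  have "act k \<pi> (cell_vec b k lab p) \<in> cycle_set b k lab" using im assms by (auto simp: cycle_set_def)
  then obtain q where q: "q < 2 * b" and e: "act k \<pi> (cell_vec b k lab p) = cell_vec b k lab q"
    by (auto simp: cycle_set_def)
  show thesis
  proof (rule that[OF q])
    show "\<pi> 0 (p div 2) = q div 2" using fun_cong[OF e, of 0] k by (simp add: cell_vec_simps)
    show "\<pi> 1 (((p + 1) div 2) mod b) = ((q + 1) div 2) mod b"
      using fun_cong[OF e, of 1] k by (simp add: cell_vec_simps)
    show "\<pi> c (lab c p) = lab c q" if "2 \<le> c" "c < k" for c
      using fun_cong[OF e, of c] that by (simp add: cell_vec_simps)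
  qed
qed

text \<open>The two cells of a row lie in different columns, so they go to the two different cells
  of the image row; agreement of their labels is therefore an invariant of the row.\<close>

lemma row_pair:
  assumes c: "2 \<le> c" "c < k" and i: "i < b" and eq: "lab c (2 * i) = lab c (2 * i + 1)"
  shows "lab c (2 * \<pi> 0 i) = lab c (2 * \<pi> 0 i + 1)"
proof -
  obtain q where q: "q < 2 * b" "\<pi> 0 i = q div 2" "\<pi> 1 i = ((q + 1) div 2) mod b"
    "\<pi> c (lab c (2 * i)) = lab c q"
    using image_cell[of "2 * i"] i c by auto
  obtain r where r: "r < 2 * b" "\<pi> 0 i = r div 2" "\<pi> 1 ((i + 1) mod b) = ((r + 1) div 2) mod b"
    "\<pi> c (lab c (2 * i + 1)) = lab c r"
    using image_cell[of "2 * i + 1"] i c by auto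
  have "\<pi> 1 i \<noteq> \<pi> 1 ((i + 1) mod b)"
    using inj_01 mod_Suc_neq[of b i] i b by (auto simp: inj_eq)
  then have "q \<noteq> r" using q(3) r(3) by auto
  then have "q = 2 * \<pi> 0 i \<and> r = 2 * \<pi> 0 i + 1 \<or> r = 2 * \<pi> 0 i \<and> q = 2 * \<pi> 0 i + 1"
    using q(2) r(2) by linarith
  then show ?thesis using q(4) r(4) eq by auto
qed

text \<open>The column analogue of \<open>row_pair\<close>. The cycle closes up in column 0, whose
  cells are the first and the last; \<open>ends\<close> excludes it as an image.\<close>

lemma column_pair:
  assumes c: "2 \<le> c" "c < k" and j: "0 < j" "j < b" and eq: "lab c (2 * j - 1) = lab c (2 * j)"
    and ends: "lab c 0 \<noteq> lab c (2 * b - 1)"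
  shows "0 < \<pi> 1 j \<and> lab c (2 * \<pi> 1 j - 1) = lab c (2 * \<pi> 1 j)"
proof -
  obtain q where q: "q < 2 * b" "\<pi> 0 (j - 1) = q div 2" "\<pi> 1 j = ((q + 1) div 2) mod b"
    "\<pi> c (lab c (2 * j - 1)) = lab c q"
  proof -
    have "(2 * j - 1) div 2 = j - 1" "((2 * j - 1 + 1) div 2) mod b = j" "2 * j - 1 < 2 * b"
      using j by auto
    then show thesis using image_cell[of "2 * j - 1"] c that by metis
  qed
  obtain r where r: "r < 2 * b" "\<pi> 0 j = r div 2" "\<pi> 1 j = ((r + 1) div 2) mod b"
    "\<pi> c (lab c (2 * j)) = lab c r"
    using image_cell[of "2 * j"] j c by auto
  have "\<pi> 0 (j - 1) \<noteq> \<pi> 0 j" using inj_01 j by (auto simp: inj_eq)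
  then have ne: "q \<noteq> r" using q(2) r(2) by auto
  have le: "\<pi> 1 j < b" using less j k by simp
  have e: "lab c q = lab c r" using q(4) r(4) eq by simp
  have col: "if \<pi> 1 j = 0 then s = 0 \<or> s = 2 * b - 1 else s = 2 * \<pi> 1 j - 1 \<or> s = 2 * \<pi> 1 j"
    if "s < 2 * b" "\<pi> 1 j = ((s + 1) div 2) mod b" for s
    using cell_in_column[OF _ that(1) le] that(2) b by simp
  show ?thesis using col[OF q(1,3)] col[OF r(1,3)] ne e ends by (auto split: if_splits)
qed

text \<open>Fixing row 0 and excluding the reflection fixes all rows and columns, hence all cells;
  every label sits on some cell and is fixed with it.\<close>

lemma all_fixed:
  assumes s0: "\<pi> 0 0 = 0" and t1: "\<pi> 1 1 \<noteq> 0"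
  shows "\<forall>c<k. \<forall>j<b. \<pi> c j = j"
proof -
  have nb: "\<pi> 1 j = \<pi> 0 i \<or> \<pi> 1 j = (\<pi> 0 i + 1) mod b" if "i < b" "j = i \<or> j = (i + 1) mod b" for i j
  proof -
    have "\<exists>p<2*b. p div 2 = i \<and> ((p + 1) div 2) mod b = j"
    proof (cases "j = i")
      case True
      then show ?thesis using that(1) by (intro exI[of _ "2 * i"]) simp
    next
      case False
      then show ?thesis using that by (intro exI[of _ "2 * i + 1"]) simp
    qed
    then obtain p where p: "p < 2 * b" "p div 2 = i" "((p + 1) div 2) mod b = j" by blast
    obtain q where q: "q < 2 * b" "\<pi> 0 i = q div 2" "\<pi> 1 j = ((q + 1) div 2) mod b"
      using image_cell[OF p(1)] p(2,3) by metis
    have "(q + 1) div 2 = q div 2 \<or> (q + 1) div 2 = q div 2 + 1" by linarith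
    moreover have "q div 2 < b" using q(1) by linarith
    ultimately show ?thesis using q(2,3) by auto
  qed
  have fixed: "\<pi> 0 i = i \<and> \<pi> 1 i = i" if i: "i < b" for i
  proof (rule cycle_fixed[OF b])
    show "inj (\<pi> 0)" "inj (\<pi> 1)" by (rule inj_01)+
    show "\<pi> 0 i < b" if "i < b" for i using less that k by simp
  qed (use nb s0 t1 i in auto)
  show ?thesis
  proof (intro allI impI)
    fix c l assume c: "c < k" and l: "l < b"
    show "\<pi> c l = l"
    proof (cases "c < 2")
      case True
      then have "c = 0 \<or> c = 1" by auto
      then show ?thesis using fixed[OF l] by auto
    next
      case False
      then have c2: "2 \<le> c" by simp
      have "card {p. p < 2*b \<and> lab c p = l} = 2" using lab[OF c2 c] l by (simp add: pairing_def)
      then have "{p. p < 2*b \<and> lab c p = l} \<noteq> {}" by (metis card.empty zero_neq_numeral)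
      then obtain p where p: "p < 2 * b" "lab c p = l" by auto
      obtain q where q: "q < 2 * b" "\<pi> 0 (p div 2) = q div 2"
        "\<pi> 1 (((p + 1) div 2) mod b) = ((q + 1) div 2) mod b" "\<pi> c (lab c p) = lab c q"
        using image_cell[OF p(1)] c2 c by metis
      have pb: "p div 2 < b" "((p + 1) div 2) mod b < b" using p(1) b by auto
      have "p = q"
      proof (rule cell_eqI[OF _ p(1) q(1)])
        show "p div 2 = q div 2" using q(2) fixed[OF pb(1)] by simp
        show "(p + 1) div 2 mod b = (q + 1) div 2 mod b" using q(3) fixed[OF pb(2)] by simp
      qed (use b in simp)
      then show ?thesis using q(4) p(2) by simp
    qed
  qed
qed

end

text \<open>Around the cycle the labels read 0, 0, 2, 1, 1, 3, ..., b - 1, 2, 3, ..., b - 1. For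
  \<open>b \<ge> 4\<close> row 0 is the only row and column 2 the only column whose two labels
  agree.\<close>

definition cycle_label :: "nat \<Rightarrow> nat \<Rightarrow> nat" where
  "cycle_label b p = (if p \<le> 1 then 0 else if p = 2 then 2 else if p \<le> 4 then 1
    else if p < b + 2 then p - 2 else p - b)"

lemma pairing_cycle_label:
  assumes "4 \<le> b" shows "pairing b (cycle_label b)"
  unfolding pairing_def
proof (intro conjI allI impI)
  show "cycle_label b p < b" if "p < 2 * b" for p using that assms by (auto simp: cycle_label_def)
  fix l assume l: "l < b"
  consider "l = 0" | "l = 1" | "l = 2" | "3 \<le> l" by linarith
  then show "card {p. p < 2 * b \<and> cycle_label b p = l} = 2"
  proof cases
    case 1
    then have "{p. p < 2 * b \<and> cycle_label b p = l} = {0, 1}"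
      using assms by (auto simp: cycle_label_def split: if_splits)
    then show ?thesis by simp
  next
    case 2
    then have "{p. p < 2 * b \<and> cycle_label b p = l} = {3, 4}"
      using assms by (auto simp: cycle_label_def split: if_splits)
    then show ?thesis by simp
  next
    case 3
    then have "{p. p < 2 * b \<and> cycle_label b p = l} = {2, b + 2}"
      using assms by (auto simp: cycle_label_def split: if_splits)
    then show ?thesis using assms by simp
  next
    case 4
    then have "{p. p < 2 * b \<and> cycle_label b p = l} = {l + 2, l + b}"
      using assms l by (auto simp: cycle_label_def split: if_splits)
    then show ?thesis using assms by simp
  qed
qed

text \<open>The cells of the cycle are recognized by their fibres of size one, and the agreeing
  labels fix row 0 and column 2. The reflection at row 0 takes column 2 to column
  \<open>b - 1\<close>, so it is excluded precisely because \<open>b \<ge> 4\<close>.\<close>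

lemma realizable_cycle:
  assumes b: "4 \<le> b" and k: "3 \<le> k"
    and W: "W \<subseteq> {w \<in> cube b k. w 0 = 0 \<and> 2 \<le> w 1}"
    and Wt: "\<And>t. t < b \<Longrightarrow> card {w\<in>W. w 1 = t} \<noteq> 1"
  shows "realizable (2 + card W) b k"
proof -
  let ?lab = "\<lambda>c :: nat. cycle_label b"
  let ?C = "cycle_set b k ?lab" and ?O = "orbits b k W"
  have b2: "2 \<le> b" and b3: "3 \<le> b" using b by simp_all
  have bC: "balanced 2 b k ?C" by (rule balanced_cycle_set[OF b2 k]) (rule pairing_cycle_label[OF b])
  have W0: "W \<subseteq> {w \<in> cube b k. w 0 = 0}" using W by auto
  have bO: "balanced (card W) b k ?O" by (rule balanced_orbits[OF W0]) (use b k in simp_all)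
  have C: "v 1 = v 0 \<or> v 1 = (v 0 + 1) mod b" if v: "v \<in> ?C" for v
  proof -
    obtain p where p: "p < 2 * b" "v = cell_vec b k ?lab p" using v by (auto simp: cycle_set_def)
    have "(p + 1) div 2 = p div 2 \<or> (p + 1) div 2 = p div 2 + 1" by linarith
    moreover have "p div 2 < b" using p(1) by linarith
    ultimately show ?thesis using p(2) k by (auto simp: cell_vec_simps)
  qed
  have O: "v 1 \<noteq> v 0 \<and> v 1 \<noteq> (v 0 + 1) mod b" if "v \<in> ?O" for v
    by (rule orbits_off_diagonals[OF W b2 _ that]) (use k in simp)
  have disj: "?C \<inter> ?O = {}"
  proof (rule ccontr)
    assume "?C \<inter> ?O \<noteq> {}"
    then obtain v where "v \<in> ?C" "v \<in> ?O" by blast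
    then show False using C[of v] O[of v] by blast
  qed
  define S where "S = ?C \<union> ?O"
  have bal: "balanced (2 + card W) b k S" unfolding S_def by (rule balanced_Un[OF bC bO disj])
  then have Sc: "S \<subseteq> cube b k" by (simp add: balanced_def)
  have fC: "card (fibre S (v 0) (v 1)) = 1" if v: "v \<in> ?C" for v
  proof -
    have "u = v" if u: "u \<in> S" "u 0 = v 0" "u 1 = v 1" for u
    proof -
      have "u \<in> ?C" using u C[OF v] O[of u] by (auto simp: S_def)
      then obtain p q where p: "p < 2 * b" "u = cell_vec b k ?lab p" and q: "q < 2 * b" "v = cell_vec b k ?lab q"
        using v by (auto simp: cycle_set_def)
      have "p = q"
      proof (rule cell_eqI[OF b2 p(1) q(1)])
        show "p div 2 = q div 2" using u(2) p(2) q(2) k by (simp add: cell_vec_simps)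
        show "(p + 1) div 2 mod b = (q + 1) div 2 mod b" using u(3) p(2) q(2) k by (simp add: cell_vec_simps)
      qed
      then show ?thesis using p q by simp
    qed
    moreover have "v \<in> S" using v by (simp add: S_def)
    ultimately have "fibre S (v 0) (v 1) = {v}" unfolding fibre_def by blast
    then show ?thesis by simp
  qed
  have fO: "card (fibre S (v 0) (v 1)) \<noteq> 1" if v: "v \<in> ?O" for v
  proof -
    have "u \<in> ?O" if "u \<in> S" "u 0 = v 0" "u 1 = v 1" for u
      using that C[of u] O[OF v] by (auto simp: S_def)
    then have "fibre S (v 0) (v 1) = fibre ?O (v 0) (v 1)" unfolding fibre_def S_def by auto
    moreover have "v 0 < b" "v 1 < b" using cube_less[of v b k] v k by (auto simp: orbits_def)
    ultimately show ?thesis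
      using card_fibre_orbits[OF W0, of "v 0" "v 1"] Wt[of "(v 1 + (b - v 0)) mod b"] k b by simp
  qed
  have "rigid b k S"
  proof (rule rigidI[OF _ Sc])
    fix \<pi> assume pi: "\<And>c. c < k \<Longrightarrow> \<pi> c permutes {..<b}" and im: "act k \<pi> ` S = S"
    have "act k \<pi> v \<in> ?C" if v: "v \<in> ?C" for v
    proof -
      have "act k \<pi> v \<in> S" using im v by (auto simp: S_def)
      moreover have "card (fibre S (act k \<pi> v 0) (act k \<pi> v 1)) = 1"
      proof -
        have "card (fibre S (\<pi> 0 (v 0)) (\<pi> 1 (v 1))) = card (fibre S (v 0) (v 1))"
          by (rule card_fibre_act[OF _ Sc im]) (use pi k in simp_all)
        then show ?thesis using fC[OF v] k by simp
      qed
      ultimately show ?thesis using fO by (auto simp: S_def)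
    qed
    then have "act k \<pi> ` ?C \<subseteq> ?C" by blast
    then interpret cycle_symmetry b k ?lab \<pi>
      using b3 k pairing_cycle_label[OF b] pi by unfold_locales
    have "\<pi> 0 0 = 0"
    proof -
      have "cycle_label b (2 * \<pi> 0 0) = cycle_label b (2 * \<pi> 0 0 + 1)"
        using row_pair[of 2 0] k b by (simp add: cycle_label_def)
      moreover have "\<pi> 0 0 < b" using less[of 0 0] k b by simp
      ultimately show ?thesis using b by (auto simp: cycle_label_def split: if_splits)
    qed
    moreover have t2: "\<pi> 1 2 = 2"
    proof -
      have "0 < \<pi> 1 2 \<and> cycle_label b (2 * \<pi> 1 2 - 1) = cycle_label b (2 * \<pi> 1 2)"
        using column_pair[of 2 2] k b by (simp add: cycle_label_def)
      moreover have "\<pi> 1 2 < b" using less[of 1 2] k b by simp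
      ultimately show ?thesis using b by (auto simp: cycle_label_def split: if_splits)
    qed
    moreover have "\<pi> 1 1 \<noteq> 0"
    proof
      \<comment> \<open>Row 1 meets columns 1 and 2. Its image would be row \<open>b - 1\<close>,
        the other row of column 0, and would still have to meet column 2.\<close>
      assume t1: "\<pi> 1 1 = 0"
      have s1: "\<pi> 0 1 \<noteq> 0" using \<open>\<pi> 0 0 = 0\<close> inj_01(1) by (metis inj_eq zero_neq_one)
      have "\<pi> 0 1 < b" using less[of 0 1] k b by simp
      obtain q where q: "q < 2 * b" "\<pi> 0 1 = q div 2" "\<pi> 1 1 = ((q + 1) div 2) mod b"
        using image_cell[of 2] b by auto
      have "q = 2 * b - 1" using cell_in_column[OF b2 q(1), of 0] q(2,3) t1 s1 b by auto
      then have s: "\<pi> 0 1 = b - 1" using q(2) b by simp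
      obtain r where r: "r < 2 * b" "\<pi> 0 1 = r div 2" "\<pi> 1 2 = ((r + 1) div 2) mod b"
        using image_cell[of 3] b by auto
      have "r = 3 \<or> r = 4" using cell_in_column[OF b2 r(1), of 2] r(3) t2 b by auto
      then show False using r(2) s assms(1) by auto
    qed
    ultimately show "\<forall>c<k. \<forall>j<b. \<pi> c j = j" by (intro all_fixed)
  qed
  then show ?thesis using bal by (auto simp: realizable_def)
qed

section \<open>Distributing orbits over the free diagonals\<close>

lemma sum_profile_exists:
  assumes "3 \<le> M" "T \<le> n * M" "T \<noteq> 1"
  shows "\<exists>g. (\<forall>t<n. g t \<le> M \<and> g t \<noteq> 1) \<and> (\<Sum>t<n. g t) = (T::nat)"
  using assms(2,3)
proof (induction n arbitrary: T)
  case 0 then show ?case by simp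
next
  case (Suc n)
  have ex: ?case if m: "m \<le> M" "m \<noteq> 1" "m \<le> T" "T - m \<le> n * M" "T - m \<noteq> 1" for m
  proof -
    obtain g where g: "\<forall>t<n. g t \<le> M \<and> g t \<noteq> 1" "(\<Sum>t<n. g t) = T - m"
      using Suc.IH[OF m(4,5)] by blast
    have "(\<Sum>t<Suc n. (g(n := m)) t) = T" using g(2) m(3) by simp
    moreover have "\<forall>t<Suc n. (g(n := m)) t \<le> M \<and> (g(n := m)) t \<noteq> 1"
      using g(1) m by (auto simp: less_Suc_eq)
    ultimately show ?thesis by blast
  qed
  consider "T \<le> M" | "M < T" "T \<noteq> M + 1" | "T = M + 1" by linarith
  then show ?case
  proof cases
    case 1 then show ?thesis using ex[of T] Suc.prems by simp
  next
    case 2 then show ?thesis using ex[of M] Suc.prems assms(1) by simp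
  next
    \<comment> \<open>Taking \<open>M\<close> would leave the forbidden remainder 1; take
      \<open>M - 1\<close> and leave 2 instead, which \<open>M \<ge> 3\<close> permits.\<close>
    case 3
    then have "n \<noteq> 0" using Suc.prems assms(1) by (cases n) auto
    then have "2 \<le> n * M" using assms(1) by (cases n) auto
    then show ?thesis using ex[of "M - 1"] 3 assms(1) by simp
  qed
qed

text \<open>The free diagonal \<open>t + 2\<close> offers \<open>b ^ (k - 2)\<close>
  representatives, and any number of them may be taken.\<close>

lemma orbit_choice_exists:
  assumes b: "3 \<le> b" and k: "2 \<le> k" and g: "\<And>t. t < b - 2 \<Longrightarrow> g t \<le> b ^ (k - 2)"
  shows "\<exists>W \<subseteq> {w \<in> cube b k. w 0 = 0 \<and> 2 \<le> w 1}.
    card W = (\<Sum>t<b-2. g t) \<and> (\<forall>t<b-2. card {w\<in>W. w 1 = t + 2} = g t)"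
proof -
  have "\<exists>V. t < b - 2 \<longrightarrow> V \<subseteq> {w \<in> cube b k. w 0 = 0 \<and> w 1 = t + 2} \<and> card V = g t" for t
  proof (cases "t < b - 2")
    case True
    note that = True
    have "g t \<le> card {w \<in> cube b k. w 0 = 0 \<and> w 1 = t + 2}"
      using card_cube_prefix[OF k, of 0 b "t + 2"] g[OF that] that by simp
    then show ?thesis by (meson obtain_subset_with_card_n)
  qed simp
  then have "\<forall>t. \<exists>V. t < b - 2 \<longrightarrow> V \<subseteq> {w \<in> cube b k. w 0 = 0 \<and> w 1 = t + 2} \<and> card V = g t" by blast
  from choice[OF this] obtain V where
    V: "\<And>t. t < b - 2 \<Longrightarrow> V t \<subseteq> {w \<in> cube b k. w 0 = 0 \<and> w 1 = t + 2} \<and> card (V t) = g t"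
    by blast
  define W where "W = (\<Union>t<b-2. V t)"
  have fin: "finite (V t)" if "t < b - 2" for t
  proof (rule finite_subset[OF _ finite_cube])
    show "V t \<subseteq> cube b k" using V[OF that] by auto
  qed
  have "card W = (\<Sum>t<b-2. card (V t))"
    unfolding W_def
  proof (rule card_UN_disjoint)
    show "\<forall>i\<in>{..<b-2}. \<forall>j\<in>{..<b-2}. i \<noteq> j \<longrightarrow> V i \<inter> V j = {}"
    proof (intro ballI impI)
      fix i j assume ij: "i \<in> {..<b-2}" "j \<in> {..<b-2}" "i \<noteq> j"
      then have "w 1 = i + 2" if "w \<in> V i" for w using V[of i] that by auto
      moreover have "w 1 = j + 2" if "w \<in> V j" for w using V[of j] ij that by auto
      ultimately show "V i \<inter> V j = {}" using ij(3) by fastforce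
    qed
  qed (use fin in auto)
  also have "\<dots> = (\<Sum>t<b-2. g t)" using V by simp
  finally have "card W = (\<Sum>t<b-2. g t)" .
  moreover have Wt: "{w\<in>W. w 1 = t + 2} = V t" if "t < b - 2" for t
  proof (intro equalityI subsetI)
    fix w assume w: "w \<in> {w\<in>W. w 1 = t + 2}"
    then obtain i where i: "i < b - 2" "w \<in> V i" by (auto simp: W_def)
    then have "w 1 = i + 2" using V[of i] by auto
    then show "w \<in> V t" using w i by auto
  qed (use V[OF that] that in \<open>auto simp: W_def\<close>)
  moreover have "W \<subseteq> {w \<in> cube b k. w 0 = 0 \<and> 2 \<le> w 1}"
  proof
    fix w assume "w \<in> W"
    then obtain t where "t < b - 2" "w \<in> V t" by (auto simp: W_def)
    then show "w \<in> {w \<in> cube b k. w 0 = 0 \<and> 2 \<le> w 1}" using V[of t] by auto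
  qed
  moreover have "\<forall>t<b-2. card {w\<in>W. w 1 = t + 2} = g t" using Wt V by simp
  ultimately show ?thesis by blast
qed

lemma realizable_3: "3 \<le> b \<Longrightarrow> 3 \<le> k \<Longrightarrow> realizable 3 b k"
  using realizable_two_diagonals[of b k "twisted_pairs b k" 2 "{}"] by (simp add: numeral_3_eq_3)

lemma power_split: "2 \<le> k \<Longrightarrow> b ^ (k - 1) = b * b ^ (k - 2)" for b :: nat
  by (cases k; cases "k - 1") (auto simp: numeral_2_eq_2)

text \<open>Only \<open>s = 3\<close> resists the labelled cycle, as its remainder 1 would be a
  singleton fibre off the cycle; the two-diagonal set supplies it. Above half of
  \<open>b ^ (k - 1)\<close> the complement takes over.\<close>

lemma realizable_ge_4:
  assumes b: "4 \<le> b" and k: "3 \<le> k" and s: "2 \<le> s" "s + 2 \<le> b ^ (k - 1)"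
  shows "realizable s b k"
proof -
  let ?M = "b ^ (k - 2)"
  have pw: "b ^ (k - 1) = b * ?M" using power_split k by simp
  have "b ^ 1 \<le> ?M" using b k by (intro power_increasing) auto
  then have M: "4 \<le> ?M" using b by simp
  have low: "realizable s b k" if s: "2 \<le> s" "2 * s \<le> b * ?M" for s
  proof (cases "s = 3")
    case True then show ?thesis using realizable_3 b k by simp
  next
    case False
    have "b * ?M \<le> 2 * ((b - 2) * ?M)"
    proof -
      have "b \<le> 2 * (b - 2)" using b by simp
      then have "b * ?M \<le> (2 * (b - 2)) * ?M" by (rule mult_le_mono1)
      then show ?thesis by (simp add: mult.assoc)
    qed
    then have "s - 2 \<le> (b - 2) * ?M" using s by linarith
    moreover have "s - 2 \<noteq> 1" using False s(1) by linarith
    ultimately obtain g where g: "\<forall>t<b-2. g t \<le> ?M \<and> g t \<noteq> 1" "(\<Sum>t<b-2. g t) = s - 2"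
      using sum_profile_exists[of ?M "s - 2" "b - 2"] M by auto
    then obtain W where W: "W \<subseteq> {w \<in> cube b k. w 0 = 0 \<and> 2 \<le> w 1}" "card W = s - 2"
      "\<forall>t<b-2. card {w\<in>W. w 1 = t + 2} = g t"
      using orbit_choice_exists[of b k g] b k by auto
    have "card {w\<in>W. w 1 = t} \<noteq> 1" if t: "t < b" for t
    proof (cases "t < 2")
      case True
      then have "{w\<in>W. w 1 = t} = {}" using W(1) by auto
      then have "card {w\<in>W. w 1 = t} = 0" by (simp only: card.empty)
      then show ?thesis by simp
    next
      case False
      then have "t - 2 < b - 2" "t - 2 + 2 = t" using t by auto
      then show ?thesis using W(3) g(1) by metis
    qed
    then have "realizable (2 + card W) b k" by (intro realizable_cycle[OF b k W(1)])
    moreover have "2 + card W = s" using W(2) s(1) by simp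
    ultimately show ?thesis by (simp only:)
  qed
  show ?thesis
  proof (cases "2 * s \<le> b * ?M")
    case True then show ?thesis using low s(1) by simp
  next
    case False
    have "realizable (b ^ (k - 1) - s) b k" using s(2) False pw by (intro low) linarith+
    then show ?thesis using realizable_of_complement s(2) by simp
  qed
qed

section \<open>Three symbols\<close>

definition list_vec :: "nat list \<Rightarrow> nat \<Rightarrow> nat" where
  "list_vec xs = (\<lambda>c\<in>{..<length xs}. xs ! c)"

lemma list_vec_inj: "inj_on list_vec {xs. length xs = k}"
proof (rule inj_onI)
  fix xs ys assume l: "xs \<in> {xs. length xs = k}" "ys \<in> {xs. length xs = k}"
    and e: "list_vec xs = list_vec ys"
  show "xs = ys"
  proof (rule nth_equalityI)
    show "length xs = length ys" using l by simp
    fix c assume "c < length xs"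
    then show "xs ! c = ys ! c" using fun_cong[OF e, of c] l by (simp add: list_vec_def)
  qed
qed

lemma balanced_list_vec:
  assumes L: "\<forall>xs\<in>set L. length xs = k \<and> (\<forall>x\<in>set xs. x < b)" and d: "distinct L"
    and cnt: "\<And>c j. c < k \<Longrightarrow> j < b \<Longrightarrow> length (filter (\<lambda>xs. xs ! c = j) L) = a"
  shows "balanced a b k (list_vec ` set L)"
  unfolding balanced_def
proof (intro conjI allI impI)
  show "list_vec ` set L \<subseteq> cube b k"
    using L by (fastforce simp: list_vec_def cube_def)
  fix c j assume c: "c < k" and j: "j < b"
  have "{v \<in> list_vec ` set L. v c = j} = list_vec ` set (filter (\<lambda>xs. xs ! c = j) L)"
    using L c by (auto simp: list_vec_def)
  moreover have "inj_on list_vec (set (filter (\<lambda>xs. xs ! c = j) L))"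
    by (rule inj_on_subset[OF list_vec_inj[of k]]) (use L in auto)
  ultimately show "card {v \<in> list_vec ` set L. v c = j} = a"
    using cnt[OF c j] distinct_card[OF distinct_filter[OF d]] by (metis card_image)
qed

definition perms_3 :: "nat list list" where
  "perms_3 = [[0,1,2],[0,2,1],[1,0,2],[1,2,0],[2,0,1],[2,1,0]]"

lemma less_3_cases: "(n::nat) < 3 \<Longrightarrow> n = 0 \<or> n = 1 \<or> n = 2"
  by arith

lemma permutes_3:
  assumes "\<pi> permutes {..<3}"
  shows "[\<pi> 0, \<pi> 1, \<pi> 2] \<in> set perms_3"
proof -
  have l: "\<pi> 0 < 3" "\<pi> 1 < 3" "\<pi> 2 < 3"
    using permutes_in_image[OF assms, of 0] permutes_in_image[OF assms, of 1] permutes_in_image[OF assms, of 2]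
    by simp_all
  have "\<pi> 0 \<noteq> \<pi> 1" "\<pi> 0 \<noteq> \<pi> 2" "\<pi> 1 \<noteq> \<pi> 2"
    using permutes_inj[OF assms] by (simp_all add: inj_eq)
  then show ?thesis
    using less_3_cases[OF l(1)] less_3_cases[OF l(2)] less_3_cases[OF l(3)]
    unfolding perms_3_def by (elim disjE) simp_all
qed

text \<open>Slice size 4 for \<open>b = k = 3\<close> escapes the diagonal constructions: with the
  twisted pairs it would need a single orbit, hence a fibre of the forbidden size 1, and the
  complementary core has only \<open>x = 1\<close>. Rigidity is checked over all triples of
  permutations.\<close>

definition set_4_3 :: "nat list list" where
  "set_4_3 = [[0,0,0],[1,1,0],[2,2,0],[0,1,1],[1,2,1],[2,0,2],[0,2,1],[0,2,2],[1,0,1],[1,0,2],[2,1,0],[2,1,2]]"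

lemma set_4_3_rigid:
  "\<forall>p\<in>set perms_3.
   \<forall>q\<in>set perms_3.
   \<forall>r\<in>set perms_3.
    (\<forall>xs\<in>set set_4_3. [p ! (xs ! 0), q ! (xs ! 1), r ! (xs ! 2)] \<in> set set_4_3) \<longrightarrow>
    p = [0,1,2] \<and> q = [0,1,2] \<and> r = [0,1,2]"
  by code_simp

lemma realizable_4_3_3: "realizable 4 3 3"
proof -
  let ?S = "list_vec ` set set_4_3"
  have L: "\<forall>xs\<in>set set_4_3. length xs = 3 \<and> (\<forall>x\<in>set xs. x < 3)" by code_simp
  have cnt: "\<forall>c\<in>set [0,1,2]. \<forall>j\<in>set [0,1,2::nat]. length (filter (\<lambda>xs. xs ! c = j) set_4_3) = 4" by code_simp
  have bal: "balanced 4 3 3 ?S"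
  proof (rule balanced_list_vec[OF L])
    show "distinct set_4_3" by code_simp
    fix c j :: nat assume "c < 3" "j < 3"
    then have "c \<in> set [0,1,2]" "j \<in> set [0,1,2]" by auto
    then show "length (filter (\<lambda>xs. xs ! c = j) set_4_3) = 4" using cnt by blast
  qed
  have "rigid 3 3 ?S"
  proof (rule rigidI)
    show "?S \<subseteq> cube 3 3" using bal by (simp add: balanced_def)
    fix \<pi> assume pi: "\<And>c. c < 3 \<Longrightarrow> \<pi> c permutes {..<3}" and im: "act 3 \<pi> ` ?S = ?S"
    define t where "t c = [\<pi> c 0, \<pi> c 1, \<pi> c 2]" for c
    have t: "t c ! x = \<pi> c x" if "x < 3" for c x
      using that by (auto simp: t_def numeral_3_eq_3 less_Suc_eq numeral_2_eq_2)
    have "[t 0 ! (xs ! 0), t 1 ! (xs ! 1), t 2 ! (xs ! 2)] \<in> set set_4_3" if xs: "xs \<in> set set_4_3" for xs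
    proof -
      have "act 3 \<pi> (list_vec xs) \<in> ?S" using im xs by blast
      then obtain ys where ys: "ys \<in> set set_4_3" "act 3 \<pi> (list_vec xs) = list_vec ys" by auto
      have lx: "length xs = 3" "\<And>c. c < 3 \<Longrightarrow> xs ! c < 3" and ly: "length ys = 3"
        using L xs ys(1) by auto
      have "ys ! c = t c ! (xs ! c)" if "c < 3" for c
        using fun_cong[OF ys(2), of c] that lx ly t[of "xs ! c" c] by (simp add: list_vec_def)
      then have "ys = [t 0 ! (xs ! 0), t 1 ! (xs ! 1), t 2 ! (xs ! 2)]"
        using ly by (intro nth_equalityI) (auto simp: numeral_3_eq_3 less_Suc_eq numeral_2_eq_2)
      then show ?thesis using ys(1) by simp
    qed
    moreover have m: "t c \<in> set perms_3" if "c < 3" for c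
      unfolding t_def by (rule permutes_3[OF pi[OF that]])
    ultimately have "t 0 = [0,1,2] \<and> t 1 = [0,1,2] \<and> t 2 = [0,1,2]"
      using set_4_3_rigid[THEN bspec[OF _ m[of 0]], THEN bspec[OF _ m[of 1]], THEN bspec[OF _ m[of 2]]] by simp
    then show "\<forall>c<3. \<forall>j<3. \<pi> c j = j"
      by (auto simp: t_def numeral_3_eq_3 less_Suc_eq numeral_2_eq_2)
  qed
  then show ?thesis using bal by (auto simp: realizable_def)
qed

text \<open>For three symbols one labelling is not enough, since slice size 2 fails in dimension
  three. The two labellings mark different rows: agreement of labels singles out row 0 in coordinate
  2 and row 2 in coordinate 3. Fixing both leaves no reflection.\<close>

lemma realizable_2_3_4: "realizable 2 3 4"
proof -
  define lab where "lab c = (!) (if c = 2 then [0,0,2,1,1,2] else [0,1,0,1,2,2::nat])" for c :: nat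
  have pr: "pairing 3 ((!) xs)" if "xs = [0,0,2,1,1,2] \<or> xs = [0,1,0,1,2,2]" for xs
    unfolding pairing_def
  proof (intro conjI allI impI)
    fix p :: nat assume "p < 2 * 3"
    then have "xs ! p \<in> set xs" using that by (intro nth_mem) auto
    then show "xs ! p < 3" using that by auto
  next
    fix l :: nat assume "l < 3"
    then have l: "l = 0 \<or> l = 1 \<or> l = 2" by auto
    have "length (filter (\<lambda>x. x = l) xs) = card {i. i < length xs \<and> xs ! i = l}"
      by (rule length_filter_conv_card)
    moreover have "length xs = 2 * 3" "length (filter (\<lambda>x. x = l) xs) = 2" using that l by auto
    ultimately show "card {p. p < 2 * 3 \<and> xs ! p = l} = 2" by simp
  qed
  have pl: "pairing 3 (lab c)" for c unfolding lab_def by (rule pr) simp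
  let ?C = "cycle_set 3 4 lab"
  have bal: "balanced 2 3 4 ?C" by (rule balanced_cycle_set) (use pl in simp_all)
  have "rigid 3 4 ?C"
  proof (rule rigidI)
    show "?C \<subseteq> cube 3 4" using bal by (simp add: balanced_def)
    fix \<pi> assume pi: "\<And>c. c < 4 \<Longrightarrow> \<pi> c permutes {..<3}" and im: "act 4 \<pi> ` ?C = ?C"
    interpret cycle_symmetry 3 4 lab \<pi>
      using pl pi im by unfold_locales simp_all
    have 3: "\<pi> c j = 0 \<or> \<pi> c j = 1 \<or> \<pi> c j = 2" if "c < 4" "j < 3" for c j
      using less[OF that] by auto
    have s0: "\<pi> 0 0 = 0"
      using row_pair[of 2 0] 3[of 0 0] by (auto simp: lab_def)
    have s2: "\<pi> 0 2 = 2"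
      using row_pair[of 3 2] 3[of 0 2] by (auto simp: lab_def)
    have "\<pi> 1 1 \<noteq> 0"
    proof
      assume t1: "\<pi> 1 1 = 0"
      have "\<pi> 0 1 \<noteq> \<pi> 0 0" "\<pi> 0 1 \<noteq> \<pi> 0 2" using inj_01(1) by (simp_all add: inj_eq)
      then have s1: "\<pi> 0 1 = 1" using 3[of 0 1] s0 s2 by auto
      obtain q where q: "q < 6" "\<pi> 0 1 = q div 2" "\<pi> 1 1 = ((q + 1) div 2) mod 3"
        using image_cell[of 2] by auto
      then have "q = 2 \<or> q = 3" using s1 by auto
      then show False using q(3) t1 by auto
    qed
    then show "\<forall>c<4. \<forall>j<3. \<pi> c j = j" using all_fixed[OF s0] by blast
  qed
  then show ?thesis using bal by (auto simp: realizable_def)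
qed

lemma realizable_base_3_dim_3:
  assumes "3 \<le> s" "s \<le> 6" shows "realizable s 3 3"
proof -
  have 3: "realizable 3 3 3" by (rule realizable_3) simp_all
  have "realizable 5 3 3" "realizable 6 3 3"
    using realizable_of_complement[of 3 3 5] realizable_4_3_3 realizable_of_complement[of 3 3 6] 3 by simp_all
  moreover have "s = 3 \<or> s = 4 \<or> s = 5 \<or> s = 6" using assms by auto
  ultimately show ?thesis using 3 realizable_4_3_3 by auto
qed

text \<open>With a single free diagonal, the cardinality of \<open>W\<close> itself has to avoid 1
  and \<open>x\<close>. The twisted pairs give 3 and 6, ..., \<open>?M + 3\<close>, and their
  complement in the next diagonal gives the rest up to half of the range; 4 and 5 come from three
  coordinates and 2 from four.\<close>

lemma realizable_base_3:
  assumes k: "4 \<le> k" and s: "2 \<le> s" "s + 2 \<le> 3 ^ (k - 1)"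
  shows "realizable s 3 k"
proof -
  let ?M = "3 ^ (k - 2) :: nat"
  have pw: "3 ^ (k - 1) = 3 * ?M" using power_split[of k 3] k by simp
  have "3 ^ 2 \<le> ?M" using k by (intro power_increasing) auto
  then have M: "9 \<le> ?M" by simp
  have choice: "\<exists>W \<subseteq> {w \<in> cube 3 k. w 0 = 0 \<and> 2 \<le> w 1}. card W = z \<and> card {w\<in>W. w 1 = 2} = z"
    if "z \<le> ?M" for z
  proof -
    have "\<exists>W \<subseteq> {w \<in> cube 3 k. w 0 = 0 \<and> 2 \<le> w 1}. card W = (\<Sum>t<(3::nat)-2. z) \<and>
      (\<forall>t<(3::nat)-2. card {w\<in>W. w 1 = t + 2} = z)"
      by (rule orbit_choice_exists) (use that k in simp_all)
    then obtain W where W: "W \<subseteq> {w \<in> cube 3 k. w 0 = 0 \<and> 2 \<le> w 1}" "card W = (\<Sum>t<(3::nat)-2. z)"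
      "\<forall>t<(3::nat)-2. card {w\<in>W. w 1 = t + 2} = z" by blast
    have "card {w\<in>W. w 1 = 2} = z" using W(3)[rule_format, of 0] by (simp only: add_0)
    moreover have "card W = z" using W(2) by simp
    ultimately show ?thesis using W(1) by blast
  qed
  have low: "realizable s 3 k" if s: "2 \<le> s" "2 * s \<le> 3 * ?M" for s
  proof -
    consider "s = 2" | "s = 4 \<or> s = 5" | "s = 3 \<or> 6 \<le> s \<and> s \<le> ?M + 3" | "?M + 3 < s"
      using s(1) by linarith
    then show ?thesis
    proof cases
      case 1 then show ?thesis using realizable_mono[OF realizable_2_3_4, of k] k by simp
    next
      case 2
      then have "realizable s 3 3" by (intro realizable_base_3_dim_3) auto
      then show ?thesis using realizable_mono[of s 3 3 k] k by simp
    next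
      case 3
      obtain W where W: "W \<subseteq> {w \<in> cube 3 k. w 0 = 0 \<and> 2 \<le> w 1}" "card W = s - 3" "card {w\<in>W. w 1 = 2} = s - 3"
      proof -
        have "s - 3 \<le> ?M" using 3 by auto
        from choice[OF this] show thesis using that by blast
      qed
      have "realizable (1 + 2 + card W) 3 k"
      proof (rule realizable_two_diagonals[where X = "twisted_pairs 3 k"])
        fix t :: nat assume "2 \<le> t" "t < 3"
        then have "t = 2" by simp
        then show "card {w\<in>W. w 1 = t} \<notin> {1, 2}" using W(3) 3 by auto
      qed (use k W(1) in auto)
      moreover have "1 + 2 + card W = s" using W(2) 3 by auto
      ultimately show ?thesis by (simp only:)
    next
      case 4
      obtain W where W: "W \<subseteq> {w \<in> cube 3 k. w 0 = 0 \<and> 2 \<le> w 1}"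
        "card W = s - (?M - 1)" "card {w\<in>W. w 1 = 2} = s - (?M - 1)"
      proof -
        have "s - (?M - 1) \<le> ?M" using s(2) M by linarith
        from choice[OF this] show thesis using that by blast
      qed
      have "realizable (1 + (?M - 2) + card W) 3 k"
      proof (rule realizable_two_diagonals[where X = "next_diag 3 k - twisted_pairs 3 k"])
        fix t :: nat assume "2 \<le> t" "t < 3"
        then have "t = 2" by simp
        \<comment> \<open>As \<open>?M + 3 < s\<close> and \<open>2 * s \<le> 3 * ?M\<close>, the
          number \<open>s - (?M - 1)\<close> lies strictly between 1 and \<open>?M - 2\<close>; the
          upper estimate uses \<open>?M \<ge> 9\<close>.\<close>
        moreover have "s - (?M - 1) \<noteq> 1" "s - (?M - 1) \<noteq> ?M - 2" using 4 s(2) M by linarith+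
        ultimately show "card {w\<in>W. w 1 = t} \<notin> {1, ?M - 2}" using W(3) by simp
      qed (use k W(1) M in auto)
      moreover have "1 + (?M - 2) + card W = s" using W(2) 4 M by linarith
      ultimately show ?thesis by (simp only:)
    qed
  qed
  show ?thesis
  proof (cases "2 * s \<le> 3 * ?M")
    case True then show ?thesis using low s(1) by simp
  next
    case False
    have "realizable (3 ^ (k - 1) - s) 3 k" using s(2) False pw by (intro low) linarith+
    then show ?thesis using realizable_of_complement s(2) by simp
  qed
qed

section \<open>Two symbols\<close>

definition flip :: "nat \<Rightarrow> (nat \<Rightarrow> nat) \<Rightarrow> nat \<Rightarrow> nat" where
  "flip k v = (\<lambda>c\<in>{..<k}. 1 - v c)"

lemma flip_in_cube: "flip k v \<in> cube 2 k"
  by (auto simp: flip_def cube_def)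

lemma permutes_2:
  assumes "\<pi> permutes {..<2}" shows "\<pi> 0 = 0 \<and> \<pi> 1 = 1 \<or> \<pi> 0 = 1 \<and> \<pi> 1 = (0::nat)"
proof -
  have "\<pi> 0 < 2" "\<pi> 1 < 2" using permutes_in_image[OF assms, of 0] permutes_in_image[OF assms, of 1] by auto
  moreover have "\<pi> 0 \<noteq> \<pi> 1" using permutes_inj[OF assms] by (simp add: inj_eq)
  ultimately show ?thesis by auto
qed

text \<open>If coordinate \<open>c\<close> were kept and \<open>d\<close> flipped, the symmetry
  would split the slice \<open>v c = 0\<close> evenly by the value at \<open>d\<close>, against odd
  \<open>a\<close>. Hence a symmetry flips all coordinates or none.\<close>

lemma odd_slices_symmetry:
  assumes B: "balanced a 2 k B" and odd: "odd a" and pi: "\<And>c. c < k \<Longrightarrow> \<pi> c permutes {..<2}"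
    and im: "act k \<pi> ` B = B"
    and c: "c < k" "\<pi> c 0 = 0" and d: "d < k"
  shows "\<pi> d 0 = 0"
proof (rule ccontr)
  assume "\<pi> d 0 \<noteq> 0"
  then have pd: "\<pi> d 0 = 1" "\<pi> d 1 = 0" using permutes_2[OF pi[OF d]] by auto
  have pc: "\<pi> c 1 = 1" using permutes_2[OF pi[OF c(1)]] c(2) by auto
  have Bc: "B \<subseteq> cube 2 k" using B by (simp add: balanced_def)
  have bin: "v e = 0 \<or> v e = 1" if "v \<in> B" "e < k" for v e
    using balanced_less[OF B that] by auto
  have "card {v\<in>B. v c = 0 \<and> v d = 1} = card {v\<in>B. v c = 0 \<and> v d = 0}"
  proof (rule card_image_act_filter[OF _ Bc im])
    show "\<pi> e permutes {..<2}" if "e < k" for e by (rule pi[OF that])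
    fix v assume v: "v \<in> B"
    show "(act k \<pi> v c = 0 \<and> act k \<pi> v d = 1) \<longleftrightarrow> (v c = 0 \<and> v d = 0)"
      using bin[OF v c(1)] bin[OF v d] c d pc pd by auto
  qed
  moreover have "{v\<in>B. v c = 0} = {v\<in>B. v c = 0 \<and> v d = 0} \<union> {v\<in>B. v c = 0 \<and> v d = 1}"
    using bin[OF _ d] by blast
  moreover have "card ({v\<in>B. v c = 0 \<and> v d = 0} \<union> {v\<in>B. v c = 0 \<and> v d = 1}) =
      card {v\<in>B. v c = 0 \<and> v d = 0} + card {v\<in>B. v c = 0 \<and> v d = 1}"
    by (rule card_Un_disjoint) (use balanced_finite[OF B] in auto)
  moreover have "card {v\<in>B. v c = 0} = a" using B c(1) by (simp add: balanced_def)
  ultimately have "a = 2 * card {v\<in>B. v c = 0 \<and> v d = 0}" by (simp only: mult_2)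
  then show False using odd by simp
qed

text \<open>Apart from the identity only the flip of all coordinates remains, and one point whose
  antipode is missing rules it out.\<close>

lemma odd_slices_rigid:
  assumes B: "balanced a 2 k B" and odd: "odd a" and pi: "\<And>c. c < k \<Longrightarrow> \<pi> c permutes {..<2}"
    and im: "act k \<pi> ` B = B" and v: "v \<in> B" "flip k v \<notin> B"
  shows "\<forall>c<k. \<forall>j<2. \<pi> c j = j"
proof -
  have "\<pi> c 0 = 0" if c: "c < k" for c
  proof (rule ccontr)
    assume n: "\<pi> c 0 \<noteq> 0"
    have sw: "\<pi> d 0 = 1 \<and> \<pi> d 1 = 0" if d: "d < k" for d
    proof -
      have "\<pi> d 0 \<noteq> 0"
      proof
        assume "\<pi> d 0 = 0"
        then have "\<pi> c 0 = 0" using odd_slices_symmetry[OF B odd _ im d _ c] pi by blast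
        then show False using n by simp
      qed
      then show ?thesis using permutes_2[OF pi[OF d]] by auto
    qed
    have "act k \<pi> v = flip k v"
    proof (rule cube_eqI[of _ 2 k])
      show "act k \<pi> v \<in> cube 2 k" using act_in_cube[of k \<pi> 2 v] pi v(1) B by (auto simp: balanced_def)
      show "flip k v \<in> cube 2 k" by (rule flip_in_cube)
      fix d assume d: "d < k"
      have "v d = 0 \<or> v d = 1" using balanced_less[OF B v(1) d] by auto
      then show "act k \<pi> v d = flip k v d" using sw[OF d] d by (auto simp: flip_def)
    qed
    moreover have "act k \<pi> v \<in> B" using im v(1) by blast
    ultimately show False using v(2) by simp
  qed
  then have "\<pi> c 0 = 0 \<and> \<pi> c 1 = 1" if "c < k" for c using permutes_2[OF pi[OF that]] that by auto
  then show ?thesis by (auto simp: less_2_cases_iff)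
qed

text \<open>Five coordinates are the fewest possible for six points with slices of size three and no
  antipodal pair: such a set in \<open>cube 2 4\<close>, enlarged by one antipodal pair, would
  realize slice size 4, which \<open>not_realizable_4_2_4\<close> forbids. In higher dimension the
  fifth coordinate is repeated.\<close>

definition six_points :: "nat list list" where
  "six_points = [[1,1,1,1,1],[1,1,1,1,0],[1,0,0,0,1],[0,1,0,0,1],[0,0,1,0,0],[0,0,0,1,0]]"

definition six_vec :: "nat \<Rightarrow> nat list \<Rightarrow> nat \<Rightarrow> nat" where
  "six_vec k xs = (\<lambda>c\<in>{..<k}. xs ! (min c 4))"

lemma six_points_facts:
  "\<forall>xs\<in>set six_points. length xs = 5 \<and> (\<forall>x\<in>set xs. x < 2)"
  "distinct six_points"
  "\<forall>c\<in>set [0,1,2,3,4::nat]. \<forall>j\<in>set [0,1::nat]. length (filter (\<lambda>xs. xs ! c = j) six_points) = 3"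
  "\<forall>xs\<in>set six_points. \<forall>ys\<in>set six_points. \<exists>c\<in>set [0,1,2,3,4]. ys ! c \<noteq> 1 - xs ! c"
  "[1,1,1,1,1] \<in> set six_points"
  by code_simp+


text \<open>Dimension four has its own set, which does contain the antipodal pair 1101, 0010. No
  pairs are added here, and rigidity asks only for one point without antipode, namely 1111.\<close>

lemma realizable_3_2_4: "realizable 3 2 4"
proof -
  let ?L = "[[1,1,1,1],[1,1,0,1],[1,0,1,0],[0,1,0,0],[0,0,1,0],[0,0,0,1]] :: nat list list"
  let ?B = "list_vec ` set ?L"
  have "\<forall>c\<in>set [0,1,2,3]. \<forall>j\<in>set [0,1]. length (filter (\<lambda>xs. xs ! c = j) ?L) = 3" by code_simp
  then have cnt: "length (filter (\<lambda>xs. xs ! c = j) ?L) = 3" if "c < 4" "j < 2" for c j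
  proof -
    have "c \<in> set [0,1,2,3]" "j \<in> set [0,1]" using that by auto
    then show ?thesis using \<open>\<forall>c\<in>set [0,1,2,3]. \<forall>j\<in>set [0,1]. length (filter (\<lambda>xs. xs ! c = j) ?L) = 3\<close>
      by blast
  qed
  have bal: "balanced 3 2 4 ?B"
  proof (rule balanced_list_vec)
    show "\<forall>xs\<in>set ?L. length xs = 4 \<and> (\<forall>x\<in>set xs. x < 2)" by code_simp
    show "distinct ?L" by code_simp
  qed (rule cnt)
  have "rigid 2 4 ?B"
  proof (rule rigidI)
    show "?B \<subseteq> cube 2 4" using bal by (simp add: balanced_def)
    fix \<pi> assume pi: "\<And>c. c < 4 \<Longrightarrow> \<pi> c permutes {..<2}" and im: "act 4 \<pi> ` ?B = ?B"
    show "\<forall>c<4. \<forall>j<2. \<pi> c j = j"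
    proof (rule odd_slices_rigid[OF bal _ _ im])
      show "odd (3::nat)" by simp
      show "\<pi> c permutes {..<2}" if "c < 4" for c by (rule pi[OF that])
      show "list_vec [1,1,1,1] \<in> ?B" by simp
      have ones: "flip 4 (list_vec [1,1,1,1]) c = 0" if "c < 4" for c
      proof -
        have "c = 0 \<or> c = 1 \<or> c = 2 \<or> c = 3" using that by auto
        then show ?thesis by (auto simp: flip_def list_vec_def)
      qed
      show "flip 4 (list_vec [1,1,1,1]) \<notin> ?B"
      proof
        assume "flip 4 (list_vec [1,1,1,1]) \<in> ?B"
        then obtain ys where ys: "ys \<in> set ?L" "flip 4 (list_vec [1,1,1,1]) = list_vec ys" by blast
        have "\<forall>ys\<in>set ?L. length ys = 4 \<and> (\<exists>c\<in>set [0,1,2,3]. ys ! c \<noteq> 0)" by code_simp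
        then obtain c where c: "length ys = 4" "c \<in> set [0,1,2,3]" "ys ! c \<noteq> 0" using ys(1) by blast
        have c4: "c < 4" using c(2) by auto
        then show False using ones[OF c4] ys(2) c(1,3) by (simp add: list_vec_def)
      qed
    qed
  qed
  then show ?thesis using bal by (auto simp: realizable_def)
qed

text \<open>For \<open>b = 2\<close> the cyclic shift is the antipodal map, so the shift orbits are
  the antipodal pairs.\<close>

lemma rep_flip:
  assumes "v \<in> cube 2 k" "1 \<le> k" shows "rep 2 k (flip k v) = rep 2 k v"
proof (rule cube_eqI[of _ 2 k])
  fix c assume c: "c < k"
  have "v c = 0 \<or> v c = 1" "v 0 = 0 \<or> v 0 = 1"
    using cube_less[OF assms(1) c] cube_less[OF assms(1), of 0] assms(2) by auto
  moreover have "flip k v c = 1 - v c" "flip k v 0 = 1 - v 0" using c assms(2) by (simp_all add: flip_def)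
  ultimately show "rep 2 k (flip k v) c = rep 2 k v c" using c by (auto simp: rep_apply)
qed (simp_all add: rep_in_cube)

text \<open>The group commutes with the antipodal map, so it preserves \<open>B\<close>, the set of
  points of \<open>S\<close> without antipode. Of the \<open>2 ^ (k - 1)\<close> antipodal pairs
  \<open>B\<close> blocks six, and the others have room for the missing \<open>a - 3\<close> exactly
  when \<open>a + 3 \<le> 2 ^ (k - 1)\<close>.\<close>

lemma realizable_base_2:
  assumes k: "5 \<le> k" and a: "3 \<le> a" "a + 3 \<le> 2 ^ (k - 1)"
  shows "realizable a 2 k"
proof -
  define B where "B = six_vec k ` set six_points"
  have six: "six_vec k xs c = xs ! (min c 4)" if "c < k" for xs c using that by (simp add: six_vec_def)
  have inj: "inj_on (six_vec k) (set six_points)"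
  proof (rule inj_onI)
    fix xs ys assume xy: "xs \<in> set six_points" "ys \<in> set six_points" "six_vec k xs = six_vec k ys"
    have l: "length xs = 5" "length ys = 5" using six_points_facts(1) xy(1,2) by blast+
    show "xs = ys"
    proof (rule nth_equalityI)
      fix c assume "c < length xs"
      then have "c < k" "min c 4 = c" using l k by auto
      then show "xs ! c = ys ! c" using six fun_cong[OF xy(3), of c] by simp
    qed (use l in simp)
  qed
  have Bc: "B \<subseteq> cube 2 k"
  proof
    fix v assume "v \<in> B"
    then obtain xs where xs: "xs \<in> set six_points" "v = six_vec k xs" by (auto simp: B_def)
    have "xs ! (min c 4) < 2" for c
    proof -
      have "length xs = 5" "\<forall>x\<in>set xs. x < 2" using six_points_facts(1) xs(1) by blast+
      then show ?thesis by simp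
    qed
    then show "v \<in> cube 2 k" using xs(2) by (auto simp: six_vec_def cube_def)
  qed
  have balB: "balanced 3 2 k B"
    unfolding balanced_def
  proof (intro conjI allI impI Bc)
    fix c j :: nat assume c: "c < k" and j: "j < 2"
    have "{v\<in>B. v c = j} = six_vec k ` set (filter (\<lambda>xs. xs ! (min c 4) = j) six_points)"
      using six[OF c] by (auto simp: B_def)
    moreover have "inj_on (six_vec k) (set (filter (\<lambda>xs. xs ! (min c 4) = j) six_points))"
      by (rule inj_on_subset[OF inj]) auto
    moreover have "card (set (filter (\<lambda>xs. xs ! (min c 4) = j) six_points)) = 3"
    proof -
      have "min c 4 \<in> set [0,1,2,3,4]" "j \<in> set [0,1]" using j by auto
      then have "length (filter (\<lambda>xs. xs ! (min c 4) = j) six_points) = 3"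
        using six_points_facts(3) by blast
      then show ?thesis using distinct_card[OF distinct_filter[OF six_points_facts(2)]] by metis
    qed
    ultimately show "card {v\<in>B. v c = j} = 3" by (metis card_image)
  qed
  have noflip: "flip k v \<notin> B" if v: "v \<in> B" for v
  proof
    assume "flip k v \<in> B"
    then obtain xs ys where xy: "xs \<in> set six_points" "ys \<in> set six_points" "v = six_vec k xs" "flip k v = six_vec k ys"
      using v by (auto simp: B_def)
    obtain c where c: "c \<in> set [0,1,2,3,4]" "ys ! c \<noteq> 1 - xs ! c"
      using six_points_facts(4) xy(1,2) by blast
    have "c < k" "min c 4 = c" using c(1) k by auto
    then show False using fun_cong[OF xy(4), of c] c(2) xy(3) by (simp add: flip_def six)
  qed
  let ?A = "{w \<in> cube 2 k. w 0 = 0}"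
  have "card (?A - rep 2 k ` B) \<ge> 2 ^ (k - 1) - 6"
  proof -
    have "card (rep 2 k ` B) \<le> card B" using card_image_le balanced_finite[OF balB] by blast
    also have "\<dots> = 6" using card_balanced[OF balB] k by simp
    finally have "card (rep 2 k ` B) \<le> 6" .
    moreover have "card ?A = 2 ^ (k - 1)" using card_cube_slice[of 0 k 0 2] k by simp
    moreover have "card ?A - card (rep 2 k ` B) \<le> card (?A - rep 2 k ` B)"
      by (rule diff_card_le_card_Diff) (use balanced_finite[OF balB] in simp)
    ultimately show ?thesis by linarith
  qed
  then have "a - 3 \<le> card (?A - rep 2 k ` B)" using a by linarith
  then obtain W where W: "W \<subseteq> ?A - rep 2 k ` B" "card W = a - 3" by (meson obtain_subset_with_card_n)
  let ?O = "orbits 2 k W"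
  have W0: "W \<subseteq> ?A" using W(1) by blast
  have balO: "balanced (a - 3) 2 k ?O" using balanced_orbits[OF W0] W(2) k by simp
  have BO: "v \<notin> ?O" if "v \<in> B" for v using W(1) that by (auto simp: orbits_def)
  define S where "S = B \<union> ?O"
  have "balanced (3 + (a - 3)) 2 k S"
    unfolding S_def by (rule balanced_Un[OF balB balO]) (use BO in blast)
  then have bal: "balanced a 2 k S" using a(1) by simp
  then have Sc: "S \<subseteq> cube 2 k" by (simp add: balanced_def)
  have flipO: "flip k v \<in> ?O \<longleftrightarrow> v \<in> ?O" if v: "v \<in> cube 2 k" for v
    using rep_flip[OF v] flip_in_cube[of k v] v k by (simp add: orbits_def)
  have SB: "v \<in> B \<longleftrightarrow> flip k v \<notin> S" if v: "v \<in> S" for v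
  proof
    assume "v \<in> B"
    then show "flip k v \<notin> S" using noflip[of v] BO[of v] flipO[of v] Sc v by (auto simp: S_def)
  next
    assume "flip k v \<notin> S"
    then have "v \<notin> ?O" using flipO[of v] Sc v by (auto simp: S_def)
    then show "v \<in> B" using v by (simp add: S_def)
  qed
  have "rigid 2 k S"
  proof (rule rigidI[OF _ Sc])
    fix \<pi> assume pi: "\<And>c. c < k \<Longrightarrow> \<pi> c permutes {..<2}" and im: "act k \<pi> ` S = S"
      and mem: "\<And>v. v \<in> cube 2 k \<Longrightarrow> act k \<pi> v \<in> S \<longleftrightarrow> v \<in> S"
    have comm: "act k \<pi> (flip k v) = flip k (act k \<pi> v)" if v: "v \<in> cube 2 k" for v
    proof (rule cube_eqI[of _ 2 k])
      show "act k \<pi> (flip k v) \<in> cube 2 k"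
        by (rule act_in_cube) (use pi flip_in_cube in auto)
      show "flip k (act k \<pi> v) \<in> cube 2 k" by (rule flip_in_cube)
      fix c assume c: "c < k"
      have "v c = 0 \<or> v c = 1" using cube_less[OF v c] by auto
      then show "act k \<pi> (flip k v) c = flip k (act k \<pi> v) c"
        using permutes_2[OF pi[OF c]] c by (auto simp: flip_def)
    qed
    have "act k \<pi> ` B \<subseteq> B"
    proof
      fix w assume "w \<in> act k \<pi> ` B"
      then obtain v where v: "v \<in> B" "w = act k \<pi> v" by blast
      have vS: "v \<in> S" using v(1) by (simp add: S_def)
      have "flip k v \<notin> S" using SB[OF vS] v(1) by blast
      then have "act k \<pi> (flip k v) \<notin> S" using mem[OF flip_in_cube] by blast
      then have "flip k w \<notin> S" using comm[of v] Sc vS v(2) by auto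
      moreover have "w \<in> S" using im vS v(2) by blast
      ultimately show "w \<in> B" using SB by blast
    qed
    then have imB: "act k \<pi> ` B = B" using act_image_eq[of k \<pi> 2 B] pi Bc by blast
    have "six_vec k [1,1,1,1,1] \<in> B" using six_points_facts(5) by (auto simp: B_def)
    then show "\<forall>c<k. \<forall>j<2. \<pi> c j = j"
      using noflip odd_slices_rigid[OF balB _ _ imB] pi by (metis odd_numeral)
  qed
  then show ?thesis using bal by (auto simp: realizable_def)
qed

section \<open>Asymmetric regular bipartite graphs\<close>

definition matrix_set :: "nat \<Rightarrow> (nat \<Rightarrow> nat \<Rightarrow> bool) \<Rightarrow> (nat \<Rightarrow> nat) set" where
  "matrix_set b R = {v \<in> cube b 2. R (v 0) (v 1)}"

definition pair_vec :: "nat \<Rightarrow> nat \<Rightarrow> nat \<Rightarrow> nat" where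
  "pair_vec i j = (\<lambda>c\<in>{..<2}. if c = 0 then i else j)"

definition rigid_matrix :: "nat \<Rightarrow> (nat \<Rightarrow> nat \<Rightarrow> bool) \<Rightarrow> bool" where
  "rigid_matrix b R \<longleftrightarrow> (\<forall>\<sigma> \<tau>. \<sigma> permutes {..<b} \<and> \<tau> permutes {..<b} \<and>
    (\<forall>i<b. \<forall>j<b. R (\<sigma> i) (\<tau> j) \<longleftrightarrow> R i j) \<longrightarrow> (\<forall>i<b. \<sigma> i = i \<and> \<tau> i = i))"

lemma pair_vec_simps [simp]: "pair_vec i j 0 = i" "pair_vec i j (Suc 0) = j"
  by (simp_all add: pair_vec_def)

lemma pair_vec_in_cube: "i < b \<Longrightarrow> j < b \<Longrightarrow> pair_vec i j \<in> cube b 2"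
  by (auto simp: pair_vec_def cube_def)

lemma pair_vec_eta: "v \<in> cube b 2 \<Longrightarrow> pair_vec (v 0) (v 1) = v"
  using cube_less[of v b 2 0] cube_less[of v b 2 1]
  by (intro cube_eqI[of _ b 2]) (auto simp: pair_vec_in_cube less_2_cases_iff)

lemma card_matrix_slice:
  shows "i < b \<Longrightarrow> card {v \<in> matrix_set b R. v 0 = i} = card {j. j < b \<and> R i j}"
    and "j < b \<Longrightarrow> card {v \<in> matrix_set b R. v 1 = j} = card {i. i < b \<and> R i j}"
proof -
  assume i: "i < b"
  have "bij_betw (pair_vec i) {j. j < b \<and> R i j} {v \<in> matrix_set b R. v 0 = i}"
  proof (rule bij_betw_byWitness[where f' = "\<lambda>v. v 1"])
    show "\<forall>v\<in>{v \<in> matrix_set b R. v 0 = i}. pair_vec i (v 1) = v"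
      using pair_vec_eta[of _ b] by (auto simp: matrix_set_def)
    show "(\<lambda>v. v 1) ` {v \<in> matrix_set b R. v 0 = i} \<subseteq> {j. j < b \<and> R i j}"
      using cube_less[of _ b 2 1] by (auto simp: matrix_set_def)
  qed (use i in \<open>auto simp: matrix_set_def pair_vec_in_cube\<close>)
  then show "card {v \<in> matrix_set b R. v 0 = i} = card {j. j < b \<and> R i j}"
    by (rule bij_betw_same_card[symmetric])
next
  assume j: "j < b"
  have "bij_betw (\<lambda>i. pair_vec i j) {i. i < b \<and> R i j} {v \<in> matrix_set b R. v 1 = j}"
  proof (rule bij_betw_byWitness[where f' = "\<lambda>v. v 0"])
    show "\<forall>v\<in>{v \<in> matrix_set b R. v 1 = j}. pair_vec (v 0) j = v"
      using pair_vec_eta[of _ b] by (auto simp: matrix_set_def)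
    show "(\<lambda>v. v 0) ` {v \<in> matrix_set b R. v 1 = j} \<subseteq> {i. i < b \<and> R i j}"
      using cube_less[of _ b 2 0] by (auto simp: matrix_set_def)
  qed (use j in \<open>auto simp: matrix_set_def pair_vec_in_cube\<close>)
  then show "card {v \<in> matrix_set b R. v 1 = j} = card {i. i < b \<and> R i j}"
    by (rule bij_betw_same_card[symmetric])
qed

lemma all_less_2: "(\<forall>c<2. P c) \<longleftrightarrow> P 0 \<and> P (1::nat)"
  by (auto simp: less_2_cases_iff)

lemma balanced_matrix_set:
  "balanced a b 2 (matrix_set b R) \<longleftrightarrow>
    (\<forall>i<b. card {j. j < b \<and> R i j} = a) \<and> (\<forall>j<b. card {i. i < b \<and> R i j} = a)"
proof -
  have "matrix_set b R \<subseteq> cube b 2" by (auto simp: matrix_set_def)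
  then have "balanced a b 2 (matrix_set b R) \<longleftrightarrow>
    (\<forall>j<b. card {v \<in> matrix_set b R. v 0 = j} = a) \<and> (\<forall>j<b. card {v \<in> matrix_set b R. v 1 = j} = a)"
    unfolding balanced_def all_less_2 by simp
  then show ?thesis using card_matrix_slice by simp
qed

lemma rigid_matrix_set: "rigid b 2 (matrix_set b R) \<longleftrightarrow> rigid_matrix b R"
proof
  assume r: "rigid b 2 (matrix_set b R)"
  show "rigid_matrix b R"
    unfolding rigid_matrix_def
  proof (intro allI impI, elim conjE)
    fix \<sigma> \<tau> i assume s: "\<sigma> permutes {..<b}" and t: "\<tau> permutes {..<b}"
      and R: "\<forall>i<b. \<forall>j<b. R (\<sigma> i) (\<tau> j) \<longleftrightarrow> R i j" and i: "i < b"
    define \<pi> where "\<pi> c = (if c = 0 then \<sigma> else \<tau>)" for c :: nat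
    have pi: "\<pi> c permutes {..<b}" for c using s t by (simp add: \<pi>_def)
    have "act 2 \<pi> ` matrix_set b R \<subseteq> matrix_set b R"
    proof
      fix w assume "w \<in> act 2 \<pi> ` matrix_set b R"
      then obtain v where v: "v \<in> cube b 2" "R (v 0) (v 1)" "w = act 2 \<pi> v" by (auto simp: matrix_set_def)
      have "w \<in> cube b 2" unfolding v(3) by (rule act_in_cube[OF pi v(1)])
      moreover have "v 0 < b" "v 1 < b" using cube_less[OF v(1)] by auto
      ultimately show "w \<in> matrix_set b R" using R v(2,3) by (simp add: matrix_set_def \<pi>_def)
    qed
    then have "\<pi> c = id" if "c < 2" for c using rigidD[OF r, of \<pi> c] pi that by blast
    then have "\<pi> 0 = id" "\<pi> 1 = id" by auto
    then show "\<sigma> i = i \<and> \<tau> i = i" by (simp add: \<pi>_def)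
  qed
next
  assume r: "rigid_matrix b R"
  show "rigid b 2 (matrix_set b R)"
  proof (rule rigidI)
    show "matrix_set b R \<subseteq> cube b 2" by (auto simp: matrix_set_def)
    fix \<pi> assume pi: "\<And>c. c < 2 \<Longrightarrow> \<pi> c permutes {..<b}"
      and mem: "\<And>v. v \<in> cube b 2 \<Longrightarrow> act 2 \<pi> v \<in> matrix_set b R \<longleftrightarrow> v \<in> matrix_set b R"
    have "R (\<pi> 0 i) (\<pi> 1 j) \<longleftrightarrow> R i j" if "i < b" "j < b" for i j
    proof -
      have v: "pair_vec i j \<in> cube b 2" using that by (rule pair_vec_in_cube)
      have "act 2 \<pi> (pair_vec i j) \<in> cube b 2" by (rule act_in_cube[OF _ v]) (rule pi)
      then show ?thesis using mem[OF v] v by (simp add: matrix_set_def)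
    qed
    then have "\<forall>i<b. \<pi> 0 i = i \<and> \<pi> 1 i = i" 
      using r[unfolded rigid_matrix_def, rule_format, of "\<pi> 0" "\<pi> 1"] pi[of 0] pi[of 1] by simp
    then show "\<forall>c<2. \<forall>j<b. \<pi> c j = j" by (auto simp: less_2_cases_iff)
  qed
qed

text \<open>The parts of two partitions are the two sides of a bipartite graph and each point is the
  edge joining its two parts; there are no multiple edges because a base separates points.\<close>

lemma realizable_dim_2_iff:
  "realizable a b 2 \<longleftrightarrow> (\<exists>R. (\<forall>i<b. card {j. j < b \<and> R i j} = a) \<and>
    (\<forall>j<b. card {i. i < b \<and> R i j} = a) \<and> rigid_matrix b R)"
proof
  assume "realizable a b 2"
  then obtain S where S: "balanced a b 2 S" "rigid b 2 S" by (auto simp: realizable_def)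
  define R where "R i j \<longleftrightarrow> pair_vec i j \<in> S" for i j
  have Sc: "S \<subseteq> cube b 2" using S(1) by (simp add: balanced_def)
  have "matrix_set b R = S"
  proof (intro equalityI subsetI)
    fix v assume "v \<in> matrix_set b R"
    then show "v \<in> S" using pair_vec_eta[of v b] by (simp add: matrix_set_def R_def)
  next
    fix v assume v: "v \<in> S"
    then show "v \<in> matrix_set b R" using pair_vec_eta[of v b] Sc by (auto simp: matrix_set_def R_def)
  qed
  then show "\<exists>R. (\<forall>i<b. card {j. j < b \<and> R i j} = a) \<and>
    (\<forall>j<b. card {i. i < b \<and> R i j} = a) \<and> rigid_matrix b R"
    using S balanced_matrix_set[of a b R] rigid_matrix_set[of b R] by auto
next
  assume "\<exists>R. (\<forall>i<b. card {j. j < b \<and> R i j} = a) \<and>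
    (\<forall>j<b. card {i. i < b \<and> R i j} = a) \<and> rigid_matrix b R"
  then show "realizable a b 2"
    unfolding realizable_def using balanced_matrix_set[of a b] rigid_matrix_set[of b] by blast
qed

text \<open>The circulant matrix with the cyclic intervals \<open>{i..i+a-1}\<close> as rows, where the first four
  rows have been rearranged in the columns \<open>0, 1, 2, a, a+1, a+2\<close>.\<close>

definition band :: "nat \<Rightarrow> nat \<Rightarrow> nat \<Rightarrow> nat \<Rightarrow> bool" where
  "band a b i j \<longleftrightarrow>
    (if i = 0 then j = 0 \<or> 2 \<le> j \<and> j \<le> a
     else if i = 1 then 2 \<le> j \<and> j \<le> a + 1
     else if i = 2 then 1 \<le> j \<and> j < a \<or> j = a + 1
     else if i = 3 then j = 1 \<or> 3 \<le> j \<and> j \<le> a \<or> j = a + 2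
     else i \<le> j \<and> j < i + a \<or> j + b < i + a)"

text \<open>\<open>a + 3 \<le> b\<close> provides the column \<open>a + 2\<close>;
  \<open>8 \<le> b\<close> makes the path formed by the rows 4, ..., b - 1 longer than the path 0,
  1, 2.\<close>

locale band_matrix =
  fixes a b :: nat
  assumes a: "3 \<le> a" and ab: "a + 3 \<le> b" and b: "8 \<le> b"
begin

abbreviation row :: "nat \<Rightarrow> nat set" where
  "row i \<equiv> {j. j < b \<and> band a b i j}"

lemma card_row:
  assumes "i < b" shows "card (row i) = a"
proof -
  consider "i = 0" | "i = 1" | "i = 2" | "i = 3" | "4 \<le> i" "i + a \<le> b" | "4 \<le> i" "b < i + a"
    by linarith
  then show ?thesis
  proof cases
    case 1
    then have "row i = insert 0 {2..a}" using ab by (auto simp: band_def)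
    then show ?thesis using a by simp
  next
    case 2
    then have "row i = {2..a + 1}" using ab by (auto simp: band_def)
    then show ?thesis using a by simp
  next
    case 3
    then have "row i = insert (a + 1) {1..<a}" using ab by (auto simp: band_def)
    then show ?thesis using a by simp
  next
    case 4
    then have "row i = insert 1 (insert (a + 2) {3..a})" using ab by (auto simp: band_def)
    then show ?thesis using a by simp
  next
    case 5
    then have "row i = {i..<i + a}" using ab by (auto simp: band_def)
    then show ?thesis by simp
  next
    case 6
    then have "row i = {i..<b} \<union> {..<i + a - b}" using ab assms by (auto simp: band_def)
    moreover have "card ({i..<b} \<union> {..<i + a - b}) = card {i..<b} + card {..<i + a - b}"
      by (rule card_Un_disjoint) (use ab in auto)
    ultimately show ?thesis using 6 assms by simp
  qed
qed

lemma card_column: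
  assumes j: "j < b" shows "card {i. i < b \<and> band a b i j} = a"
proof -
  \<comment> \<open>Only the four rearranged rows deviate from the circulant, so they are counted
    apart from the interval rows.\<close>
  let ?s = "{i. i < 4 \<and> band a b i j}" and ?l = "{i. 4 \<le> i \<and> i < b \<and> band a b i j}"
  have "{i. i < b \<and> band a b i j} = ?s \<union> ?l" using b by auto
  moreover have "card (?s \<union> ?l) = card ?s + card ?l" by (rule card_Un_disjoint) auto
  moreover have "card ?s + card ?l = a"
  proof -
    have lt4: "i < 4 \<longleftrightarrow> i = 0 \<or> i = 1 \<or> i = 2 \<or> i = 3" for i :: nat by auto
    consider "j = 0" | "j = 1" | "j = 2" | "3 \<le> j" "j < a" | "j = a" | "j = a + 1" | "j = a + 2" | "a + 3 \<le> j"
      by linarith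
    then show ?thesis
    proof cases
      case 1
      have "?s = {0}" unfolding lt4 using 1 a by (auto simp: band_def)
      moreover have "?l = {b - a + 1..<b}" using 1 ab by (auto simp: band_def)
      ultimately show ?thesis using a ab by simp
    next
      case 2
      have "?s = {2, 3}" unfolding lt4 using 2 a by (auto simp: band_def)
      moreover have "?l = {b - a + 2..<b}" using 2 ab by (auto simp: band_def)
      ultimately show ?thesis using a ab by simp
    next
      case 3
      have "?s = {0, 1, 2}" unfolding lt4 using 3 a by (auto simp: band_def)
      moreover have "?l = {b - a + 3..<b}" using 3 ab by (auto simp: band_def)
      ultimately show ?thesis using a ab by simp
    next
      case 4
      have "?s = {0, 1, 2, 3}" unfolding lt4 using 4 a by (auto simp: band_def)
      moreover have "?l = {4..j} \<union> {j + b - a + 1..<b}" using 4 ab by (auto simp: band_def)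
      moreover have "card ({4..j} \<union> {j + b - a + 1..<b}) = card {4..j} + card {j + b - a + 1..<b}"
        by (rule card_Un_disjoint) (use ab in auto)
      ultimately show ?thesis using 4 a ab by simp
    next
      case 5
      have "?s = {0, 1, 3}" unfolding lt4 using 5 a by (auto simp: band_def)
      moreover have "?l = {4..a}" using 5 ab by (auto simp: band_def)
      ultimately show ?thesis using a ab by simp
    next
      case 6
      have "?s = {1, 2}" unfolding lt4 using 6 a by (auto simp: band_def)
      moreover have "?l = {4..a + 1}" using 6 ab by (auto simp: band_def)
      ultimately show ?thesis using a ab by simp
    next
      case 7
      have "?s = {3}" unfolding lt4 using 7 a by (auto simp: band_def)
      moreover have "?l = {4..a + 2}" using 7 ab j by (auto simp: band_def)
      ultimately show ?thesis using a ab by simp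
    next
      case 8
      have "?s = {}" unfolding lt4 using 8 a by (auto simp: band_def)
      moreover have "?l = {j + 1 - a..j}" using 8 ab j by (auto simp: band_def)
      ultimately show ?thesis using 8 a ab by simp
    qed
  qed
  ultimately show ?thesis by simp
qed

section \<open>The graph of rows at distance one\<close>

definition adj :: "nat \<Rightarrow> nat \<Rightarrow> bool" where
  "adj i i' \<longleftrightarrow> card (row i - row i') = 1"

text \<open>All rows have the same size, so the two differences of a pair of rows are equally
  large.\<close>

lemma adj_sym:
  assumes "i < b" "i' < b" shows "adj i i' \<longleftrightarrow> adj i' i"
proof -
  have "card (row i - row i') = card (row i) - card (row i \<inter> row i')"
    by (rule card_Diff_subset_Int) simp
  moreover have "card (row i' - row i) = card (row i') - card (row i' \<inter> row i)"
    by (rule card_Diff_subset_Int) simp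
  ultimately show ?thesis using assms by (simp add: adj_def card_row Int_commute)
qed

lemma adjI: "row i - row i' = {x} \<Longrightarrow> adj i i'"
  by (simp add: adj_def)

lemma not_adjI:
  assumes "x \<noteq> y" "x < b" "y < b" "band a b i x" "band a b i y" "\<not> band a b i' x" "\<not> band a b i' y"
  shows "\<not> adj i i'"
proof
  assume "adj i i'"
  then obtain z where "row i - row i' = {z}" unfolding adj_def by (auto simp: card_1_singleton_iff)
  moreover have "x \<in> row i - row i'" "y \<in> row i - row i'" using assms by auto
  ultimately show False using assms(1) by auto
qed

lemma adj_long:
  assumes "4 \<le> i" "i < i'" "i' < b" shows "adj i i' \<longleftrightarrow> i' = i + 1"
proof (cases "i' = i + 1")
  case True
  have "row i - row i' = {i}" unfolding True using assms a ab by (auto simp: band_def)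
  then show ?thesis using True adjI by blast
next
  case False
  have "\<not> adj i i'"
  \<comment> \<open>Either the first two columns of row \<open>i\<close> lie before the start of row
    \<open>i'\<close> and beyond its wrapped end, or this wrapped end reaches past column
    \<open>i\<close> and the two columns following it still belong to row \<open>i\<close>.\<close>
  proof (cases "i' - i \<le> b - a")
    case True
    then show ?thesis using False assms a ab
      by (intro not_adjI[of i "i + 1"]) (auto simp: band_def)
  next
    case f: False
    then show ?thesis using False assms a ab
      by (intro not_adjI[of "i' + a - b" "i' + a - b + 1"]) (auto simp: band_def)
  qed
  then show ?thesis using False by simp
qed

text \<open>Two columns of row 3 outside an interval row are found according to where that interval
  ends after wrapping around. If it ends in column 1 and \<open>a = 3\<close>, the part
  \<open>{3..a}\<close> of row 3 is a single column and \<open>a + 2 = 5\<close> serves as the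
  second witness.\<close>

lemma not_adj_3:
  assumes "i < b" "i \<noteq> 3" shows "\<not> adj 3 i"
proof -
  consider "i = 0" | "i = 1" | "i = 2" | "4 \<le> i" "i + a \<le> b + 1" | "i + a = b + 2" "4 \<le> a" | "i + a = b + 2" "a = 3"
    | "4 \<le> i" "b + 3 \<le> i + a"
    using assms a by linarith
  then show ?thesis
  proof cases
    case 1 then show ?thesis using a ab by (intro not_adjI[of 1 "a + 2"]) (auto simp: band_def)
  next
    case 2 then show ?thesis using a ab by (intro not_adjI[of 1 "a + 2"]) (auto simp: band_def)
  next
    case 3 then show ?thesis using a ab by (intro not_adjI[of a "a + 2"]) (auto simp: band_def)
  next
    case 4 then show ?thesis using a ab by (intro not_adjI[of 1 3]) (auto simp: band_def)
  next
    case 5 then show ?thesis using a ab by (intro not_adjI[of 3 4]) (auto simp: band_def)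
  next
    case 6 then show ?thesis using a ab b by (intro not_adjI[of 3 5]) (auto simp: band_def)
  next
    case 7 then show ?thesis using a ab assms
      by (intro not_adjI[of "i + a - b" "i + a - b + 1"]) (auto simp: band_def)
  qed
qed

lemma adj_short: "adj 0 1" "adj 1 0" "adj 1 2" "adj 2 1" "\<not> adj 0 2" "\<not> adj 2 0"
proof -
  have "row 0 - row 1 = {0}" using a ab by (auto simp: band_def)
  then show 01: "adj 0 1" by (rule adjI)
  have "row 1 - row 2 = {a}" using a ab by (auto simp: band_def)
  then show 12: "adj 1 2" by (rule adjI)
  show 02: "\<not> adj 0 2" using a ab by (intro not_adjI[of 0 a]) (auto simp: band_def)
  show "adj 1 0" "adj 2 1" "\<not> adj 2 0" using 01 12 02 adj_sym b by auto
qed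

lemma not_adj_short_long:
  assumes "i < 3" "4 \<le> i'" "i' < b" shows "\<not> adj i i'"
proof -
  consider "i = 0" | "i = 1" | "i = 2" using assms(1) by linarith
  then show ?thesis
  proof cases
    case 1
    show ?thesis
    proof (cases "i' + a \<le> b + 2")
      case True then show ?thesis using 1 a ab assms
        by (intro not_adjI[of 2 3]) (auto simp: band_def)
    next
      case False then show ?thesis using 1 a ab assms
        by (intro not_adjI[of "i' + a - b" "i' + a - b + 1"]) (auto simp: band_def)
    qed
  next
    case 2
    show ?thesis
    proof (cases "i' + a \<le> b + 2")
      case True then show ?thesis using 2 a ab assms
        by (intro not_adjI[of 2 3]) (auto simp: band_def)
    next
      case False then show ?thesis using 2 a ab assms
        by (intro not_adjI[of "i' + a - b" "i' + a - b + 1"]) (auto simp: band_def)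
    qed
  next
    case 3
    consider "i' + a \<le> b + 1" | "b + 2 \<le> i' + a" "i' + 1 < b" | "i' + 1 = b" using assms by linarith
    then show ?thesis
    proof cases
      case 1 then show ?thesis using 3 a ab assms by (intro not_adjI[of 1 2]) (auto simp: band_def)
    next
      case 2 then show ?thesis using 3 a ab assms
        by (intro not_adjI[of "i' + a - b" "i' + a - b + 1"]) (auto simp: band_def)
    next
      case h: 3 then show ?thesis using 3 a ab assms
        by (intro not_adjI[of "a - 1" "a + 1"]) (auto simp: band_def)
    qed
  qed
qed


lemma row_iso:
  assumes t: "\<tau> permutes {..<b}" and R: "\<And>i j. i < b \<Longrightarrow> j < b \<Longrightarrow> band a b (\<sigma> i) (\<tau> j) \<longleftrightarrow> band a b i j"
    and "i < b" "i' < b"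
  shows "card (row (\<sigma> i) - row (\<sigma> i')) = card (row i - row i')"
proof -
  have "\<tau> ` (row i - row i') = row (\<sigma> i) - row (\<sigma> i')"
  proof (intro equalityI subsetI)
    fix x assume "x \<in> \<tau> ` (row i - row i')"
    then obtain j where j: "j < b" "band a b i j" "\<not> band a b i' j" "x = \<tau> j" by auto
    moreover have "\<tau> j < b" using permutes_in_image[OF t, of j] j(1) by simp
    ultimately show "x \<in> row (\<sigma> i) - row (\<sigma> i')" using R assms(3,4) by simp
  next
    fix x assume x: "x \<in> row (\<sigma> i) - row (\<sigma> i')"
    then have "x \<in> \<tau> ` {..<b}" using permutes_image[OF t] by simp
    then obtain j where "j < b" "x = \<tau> j" by auto
    then show "x \<in> \<tau> ` (row i - row i')" using x R assms(3,4) by simp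
  qed
  then show ?thesis using card_image[OF permutes_inj_on[OF t]] by metis
qed

text \<open>Once all rows are fixed, a column can only move to one with the same entries; this lemma
  then fixes the columns.\<close>

lemma columns_distinct:
  assumes "j < j'" "j' < b" shows "\<exists>i<b. band a b i j \<noteq> band a b i j'"
proof -
  consider "j \<le> 2" | "3 \<le> j" "j' \<le> j + a" | "j = 3" "3 + a < j'" | "4 \<le> j" "j + a < j'"
    using assms by linarith
  then show ?thesis
  proof cases
    case 1
    consider "j = 0" | "j = 1" | "j = 2" using 1 by linarith
    then show ?thesis
    proof cases
      case j: 1
      show ?thesis
      proof (cases "2 \<le> j' \<and> j' \<le> a")
        case True then show ?thesis using j a ab assms by (intro exI[of _ 1]) (auto simp: band_def)
      next
        case False then show ?thesis using j a ab assms by (intro exI[of _ 0]) (auto simp: band_def)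
      qed
    next
      case j: 2
      consider "j' \<le> a" | "j' = a + 1" | "a + 1 < j'" by linarith
      then show ?thesis
      proof cases
        case 1 then show ?thesis using j a ab assms by (intro exI[of _ 0]) (auto simp: band_def)
      next
        case 2 then show ?thesis using j a ab assms by (intro exI[of _ 3]) (auto simp: band_def)
      next
        case 3 then show ?thesis using j a ab assms by (intro exI[of _ 2]) (auto simp: band_def)
      qed
    next
      case j: 3
      consider "j' < a" | "j' = a + 1" | "j' = a \<or> a + 1 < j'" by linarith
      then show ?thesis
      proof cases
        case 1 then show ?thesis using j a ab assms by (intro exI[of _ 3]) (auto simp: band_def)
      next
        case 2 then show ?thesis using j a ab assms by (intro exI[of _ 0]) (auto simp: band_def)
      next
        case 3 then show ?thesis using j a ab assms by (intro exI[of _ 2]) (auto simp: band_def)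
      qed
    qed
  next
    case 2 then show ?thesis using a ab assms by (intro exI[of _ "j + 1"]) (auto simp: band_def)
  next
    case 3 then show ?thesis using a ab assms by (intro exI[of _ 0]) (auto simp: band_def)
  next
    case 4 then show ?thesis using a ab assms by (intro exI[of _ j]) (auto simp: band_def)
  qed
qed

lemma adj_cases:
  assumes "i < b" "i' < b" "adj i i'"
  shows "{i, i'} = {0, 1} \<or> {i, i'} = {1, 2} \<or> 4 \<le> i \<and> i' = i + 1 \<or> 4 \<le> i' \<and> i = i' + 1"
proof -
  have ne: "i \<noteq> i'" using assms(3) by (auto simp: adj_def)
  have n3: "i \<noteq> 3" "i' \<noteq> 3" using not_adj_3 assms adj_sym[OF assms(1,2)] ne by auto
  have sym: "adj i' i" using assms adj_sym by blast
  consider "i < 3" "i' < 3" | "i < 3" "4 \<le> i'" | "4 \<le> i" "i' < 3" | "4 \<le> i" "4 \<le> i'"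
    using n3 by linarith
  then show ?thesis
  proof cases
    case 1
    then have "(i = 0 \<or> i = 1 \<or> i = 2) \<and> (i' = 0 \<or> i' = 1 \<or> i' = 2)" by auto
    then show ?thesis using ne assms(3) adj_short by auto
  next
    case 2 then show ?thesis using not_adj_short_long assms by blast
  next
    case 3 then show ?thesis using not_adj_short_long sym assms by blast
  next
    case 4
    then show ?thesis using adj_long[of i i'] adj_long[of i' i] assms sym ne by (cases "i < i'") auto
  qed
qed

lemma rigid_band: "rigid_matrix b (band a b)"
  unfolding rigid_matrix_def
proof (intro allI impI, elim conjE)
  fix \<sigma> \<tau> i0 assume s: "\<sigma> permutes {..<b}" and t: "\<tau> permutes {..<b}"
    and R: "\<forall>i<b. \<forall>j<b. band a b (\<sigma> i) (\<tau> j) \<longleftrightarrow> band a b i j" and i0: "i0 < b"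
  have less: "\<sigma> i < b" "\<tau> i < b" if "i < b" for i
    using permutes_in_image[OF s, of i] permutes_in_image[OF t, of i] that by auto
  have inj: "inj \<sigma>" using permutes_inj[OF s] .
  have iso: "card (row (\<sigma> i) - row (\<sigma> i')) = card (row i - row i')" if "i < b" "i' < b" for i i'
    by (rule row_iso[OF t]) (use R that in auto)
  have adj: "adj (\<sigma> i) (\<sigma> i') \<longleftrightarrow> adj i i'" if "i < b" "i' < b" for i i'
    using iso[OF that] by (simp add: adj_def)
  have surj: "\<exists>i<b. \<sigma> i = m" if "m < b" for m
    using permutes_image[OF s] that by (metis imageE lessThan_iff)
  have b3: "0 < b" "1 < b" "2 < b" "3 < b" "4 < b" "5 < b" using b by auto
  have nb: "\<exists>i'<b. adj i i'" if i: "i < b" "i \<noteq> 3" for i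
  proof -
    consider "i = 0" | "i = 1" | "i = 2" | "4 \<le> i" "i + 1 < b" | "4 \<le> i - 1" "i + 1 = b"
      using i b by linarith
    then show ?thesis
    proof cases
      case 4 then show ?thesis using adj_long[of i "i + 1"] by auto
    next
      case 5
      then have "adj (i - 1) i" using adj_long[of "i - 1" i] that by auto
      then have "adj i (i - 1)" using adj_sym[of i "i - 1"] that by auto
      then show ?thesis using that by (intro exI[of _ "i - 1"]) auto
    qed (use adj_short b in \<open>auto intro: exI[of _ 0] exI[of _ 1]\<close>)
  qed
  have s3: "\<sigma> 3 = 3"
  proof (rule ccontr)
    assume "\<sigma> 3 \<noteq> 3"
    then obtain m where m: "m < b" "adj (\<sigma> 3) m" using nb less(1)[OF b3(4)] by blast
    obtain i where i: "i < b" "\<sigma> i = m" using surj[OF m(1)] by blast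
    then have ad: "adj 3 i" using adj[OF b3(4) i(1)] m(2) by simp
    moreover have "i \<noteq> 3" using ad by (auto simp: adj_def)
    ultimately show False using not_adj_3 i(1) by blast
  qed
  have only1: "i = 1" if "i < b" "adj 0 i \<or> adj 2 i" for i
    using adj_cases[of 0 i] adj_cases[of 2 i] that b3 by (auto simp: doubleton_eq_iff)
  \<comment> \<open>Row 1 has two neighbours that have no further neighbour. On the long path this
    would require exactly three rows, but it has \<open>b - 4 \<ge> 4\<close>.\<close>
  have s1: "\<sigma> 1 = 1"
  proof (rule ccontr)
    assume n: "\<sigma> 1 \<noteq> 1"
    let ?y = "\<sigma> 1"
    have 0: "adj ?y (\<sigma> 0)" "adj ?y (\<sigma> 2)" using adj[of 1 0] adj[of 1 2] adj_short b3 by auto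
    have y: "?y < b" "\<sigma> 0 < b" "\<sigma> 2 < b" using less(1) b3 by auto
    have ne: "\<sigma> 0 \<noteq> \<sigma> 2" using inj by (simp add: inj_eq)
    have un: "m = ?y" if m: "m < b" "adj (\<sigma> 0) m \<or> adj (\<sigma> 2) m" for m
    proof -
      obtain i where i: "i < b" "\<sigma> i = m" using surj[OF m(1)] by blast
      then have "adj 0 i \<or> adj 2 i" using m(2) adj b3 by auto
      then show ?thesis using only1 i by auto
    qed
    have "4 \<le> ?y \<and> (\<sigma> 0 = ?y + 1 \<and> ?y = \<sigma> 2 + 1 \<or> \<sigma> 2 = ?y + 1 \<and> ?y = \<sigma> 0 + 1) \<and> 4 \<le> \<sigma> 0 \<and> 4 \<le> \<sigma> 2"
      using adj_cases[OF y(1,2) 0(1)] adj_cases[OF y(1,3) 0(2)] n ne by (auto simp: doubleton_eq_iff)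
    then have q: "5 \<le> ?y" "?y + 1 < b" "adj (?y - 1) m \<or> adj (?y + 1) m \<Longrightarrow> m < b \<Longrightarrow> m = ?y" for m
      using un[of m] y by auto
    have "?y \<noteq> 5 \<or> ?y + 2 < b" using q(2) b by linarith
    then show False
    proof
      assume "?y \<noteq> 5"
      then have "adj (?y - 2) (?y - 1)" using adj_long[of "?y - 2" "?y - 1"] q(1,2) by auto
      then have "adj (?y - 1) (?y - 2)" using adj_sym[of "?y - 1" "?y - 2"] q(2) by auto
      moreover have "?y - 2 < b" using q(2) by simp
      ultimately have "?y - 2 = ?y" using q(3) by blast
      then show False using q(1) by simp
    next
      assume "?y + 2 < b"
      then have "adj (?y + 1) (?y + 2)" using adj_long[of "?y + 1" "?y + 2"] q(1) by auto
      then have "?y + 2 = ?y" using q(3) \<open>?y + 2 < b\<close> by blast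
      then show False by simp
    qed
  qed
  have s02: "\<sigma> 0 = 0 \<or> \<sigma> 0 = 2" "\<sigma> 2 = 0 \<or> \<sigma> 2 = 2"
  proof -
    have "adj 1 (\<sigma> 0)" "adj 1 (\<sigma> 2)" using adj[of 1 0] adj[of 1 2] adj_short b3 s1 by auto
    then show "\<sigma> 0 = 0 \<or> \<sigma> 0 = 2" "\<sigma> 2 = 0 \<or> \<sigma> 2 = 2"
      using adj_cases[of 1 "\<sigma> 0"] adj_cases[of 1 "\<sigma> 2"] less(1) b3 by (auto simp: doubleton_eq_iff)
  qed
  have big: "4 \<le> \<sigma> i" if "4 \<le> i" "i < b" for i
  proof (rule ccontr)
    assume "\<not> 4 \<le> \<sigma> i"
    then have "\<sigma> i \<in> {0, 1, 2, 3}" by auto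
    moreover have "\<sigma> i \<noteq> \<sigma> 0" "\<sigma> i \<noteq> \<sigma> 1" "\<sigma> i \<noteq> \<sigma> 2" "\<sigma> i \<noteq> \<sigma> 3" "\<sigma> 0 \<noteq> \<sigma> 2"
      using inj that(1) by (simp_all add: inj_eq)
    ultimately show False using s1 s3 s02 by auto
  qed
  \<comment> \<open>Row 4 is an end of the long path, so it goes to one of its ends. The other end
    is excluded by comparison with the fixed row 1: row \<open>b - 1\<close> has at least three
    columns outside row 1, row 4 at most two.\<close>
  have s4: "\<sigma> 4 = 4"
  proof -
    let ?y = "\<sigma> 4"
    have y: "4 \<le> ?y" "?y < b" using big[of 4] less(1)[of 4] b3 by auto
    have un: "m = \<sigma> 5" if m: "m < b" "adj ?y m" for m
    proof -
      obtain i where i: "i < b" "\<sigma> i = m" using surj[OF m(1)] by blast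
      then have "adj 4 i" using adj[of 4 i] m(2) b3 by simp
      then have "i = 5" using adj_cases[of 4 i] i(1) b3 by (auto simp: doubleton_eq_iff)
      then show ?thesis using i(2) by simp
    qed
    have "?y = 4 \<or> ?y + 1 = b"
    proof (rule ccontr)
      assume "\<not> ?thesis"
      then have yy: "5 \<le> ?y" "?y + 1 < b" using y by auto
      have "adj ?y (?y + 1)" using adj_long[of ?y "?y + 1"] yy by auto
      then have "?y + 1 = \<sigma> 5" using un yy(2) by blast
      moreover have "adj (?y - 1) ?y" using adj_long[of "?y - 1" ?y] yy by auto
      then have "adj ?y (?y - 1)" using adj_sym[of ?y "?y - 1"] yy by auto
      then have "?y - 1 = \<sigma> 5" using un[of "?y - 1"] yy(2) by simp
      ultimately show False by linarith
    qed
    moreover have "?y + 1 \<noteq> b"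
    proof
      assume e: "?y + 1 = b"
      have "row 4 - row 1 \<subseteq> {a + 2, if a + 3 < b then a + 3 else 0}"
        using a ab by (auto simp: band_def)
      then have "card (row 4 - row 1) \<le> card {a + 2, if a + 3 < b then a + 3 else 0}" by (rule card_mono[rotated]) simp
      also have "\<dots> \<le> 2" by (simp add: card_insert_if)
      finally have le: "card (row 4 - row 1) \<le> 2" .
      have "{b - 1, 0, 1} \<subseteq> row ?y - row 1" using e a ab b by (auto simp: band_def)
      then have "card {b - 1, 0, 1} \<le> card (row ?y - row 1)" by (rule card_mono[rotated]) simp
      moreover have "card {b - 1, 0, 1} = 3" using b by simp
      ultimately show False using le iso[of 4 1] s1 b3 by simp
    qed
    ultimately show ?thesis by simp
  qed
  have slong: "\<sigma> i = i" if "4 \<le> i" "i < b" for i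
    using that
  proof (induction i rule: less_induct)
    case (less i)
    show ?case
    proof (cases "i = 4")
      case True then show ?thesis using s4 by simp
    next
      case False
      then have i: "5 \<le> i" using less.prems by simp
      have p: "\<sigma> (i - 1) = i - 1" using less.IH[of "i - 1"] less.prems i by auto
      have "adj (i - 1) i" using adj_long[of "i - 1" i] less.prems i by auto
      then have ad: "adj (i - 1) (\<sigma> i)" using adj[of "i - 1" i] less.prems p by auto
      have "\<sigma> i = i \<or> i - 1 = \<sigma> i + 1"
        using adj_cases[OF _ _ ad] big[of i] permutes_in_image[OF s, of i] less.prems i
        by (auto simp: doubleton_eq_iff)
      moreover have "i - 1 \<noteq> \<sigma> i + 1"
      proof
        assume e: "i - 1 = \<sigma> i + 1"
        then have "\<sigma> (i - 2) = i - 2" using less.IH[of "i - 2"] less.prems big[of i] by auto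
        moreover have "\<sigma> i = i - 2" using e by simp
        ultimately have "\<sigma> i = \<sigma> (i - 2)" by simp
        then have "i = i - 2" using inj by (simp add: inj_eq)
        then show False using i by simp
      qed
      ultimately show ?thesis by simp
    qed
  qed
  \<comment> \<open>The graph allows an exchange of rows 0 and 2. Column 0 excludes it: it belongs
    to row 0 but not to rows 1 and 3, whereas every column of row 2 belongs to row 1 or row
    3.\<close>
  have s0: "\<sigma> 0 = 0"
  proof (rule ccontr)
    assume "\<sigma> 0 \<noteq> 0"
    then have s0: "\<sigma> 0 = 2" using s02 by simp
    have "band a b 2 (\<tau> 0)" using R[rule_format, of 0 0] b3 s0 by (simp add: band_def)
    moreover have "\<not> band a b 1 (\<tau> 0)" using R[rule_format, of 1 0] b3 s1 by (simp add: band_def)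
    moreover have "\<not> band a b 3 (\<tau> 0)" using R[rule_format, of 3 0] b3 s3 by (simp add: band_def)
    ultimately show False using a by (auto simp: band_def)
  qed
  have s2: "\<sigma> 2 = 2"
  proof -
    have "\<sigma> 2 \<noteq> \<sigma> 0" using inj by (simp add: inj_eq)
    then show ?thesis using s0 s02 by simp
  qed
  have sid: "\<sigma> i = i" if i: "i < b" for i
  proof -
    have "i = 0 \<or> i = 1 \<or> i = 2 \<or> i = 3 \<or> 4 \<le> i" by linarith
    then show ?thesis using s0 s1 s2 s3 slong[OF _ i] by (elim disjE) simp_all
  qed
  have "\<tau> i0 = i0"
  proof (rule ccontr)
    assume n: "\<tau> i0 \<noteq> i0"
    have same: "band a b i (\<tau> i0) \<longleftrightarrow> band a b i i0" if "i < b" for i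
      using R[rule_format, OF that i0] sid[OF that] by simp
    show False
    proof (cases "\<tau> i0 < i0")
      case True then show False using columns_distinct[OF True i0] same by auto
    next
      case False
      then have "i0 < \<tau> i0" using n by simp
      then show False using columns_distinct[OF _ less(2)[OF i0]] same by auto
    qed
  qed
  then show "\<sigma> i0 = i0 \<and> \<tau> i0 = i0" using sid[OF i0] by simp
qed

end

lemma realizable_dim_2:
  assumes "3 \<le> a" "a + 3 \<le> b" "8 \<le> b" shows "realizable a b 2"
proof -
  interpret band_matrix a b using assms by unfold_locales
  show ?thesis unfolding realizable_dim_2_iff using card_row card_column rigid_band by blast
qed

section \<open>Exhaustive search\<close>

text \<open>Vertex \<open>x\<close> lies in block \<open>x div m\<close>. Relabellings may permute
  whole blocks, while the automorphisms sought in \<open>symmetric\<close> fix every block; the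
  larger group identifies more cases of the search.\<close>

definition block_perm :: "nat \<Rightarrow> nat \<Rightarrow> (nat \<Rightarrow> nat) \<Rightarrow> bool" where
  "block_perm n m \<rho> \<longleftrightarrow> \<rho> permutes {..<n} \<and>
    (\<forall>x<n. \<forall>y<n. \<rho> x div m = \<rho> y div m \<longleftrightarrow> x div m = y div m)"

definition regular_hypergraph :: "nat \<Rightarrow> nat \<Rightarrow> nat set set \<Rightarrow> nat set set \<Rightarrow> bool" where
  "regular_hypergraph n d U R \<longleftrightarrow> R \<subseteq> U \<and> (\<forall>x<n. card {e\<in>R. x \<in> e} = d)"

definition symmetric :: "nat \<Rightarrow> nat \<Rightarrow> nat set set \<Rightarrow> bool" where
  "symmetric n m R \<longleftrightarrow> (\<exists>\<pi>. \<pi> permutes {..<n} \<and> (\<forall>x<n. \<pi> x div m = x div m) \<and>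
    (\<exists>x<n. \<pi> x \<noteq> x) \<and> (\<forall>e\<in>R. \<pi> ` e \<in> R))"

text \<open>\<open>P\<close> is a partial hypergraph, a node of the search; larger \<open>P\<close>
  have fewer regular completions.\<close>

definition always_symmetric :: "nat \<Rightarrow> nat \<Rightarrow> nat \<Rightarrow> nat set set \<Rightarrow> nat set set \<Rightarrow> bool" where
  "always_symmetric n m d U P \<longleftrightarrow>
    (\<forall>R. regular_hypergraph n d U R \<and> P \<subseteq> R \<longrightarrow> symmetric n m R)"

locale edge_universe =
  fixes n m d :: nat and U :: "nat set set"
  assumes U: "U \<subseteq> Pow {..<n}"
    and closed: "\<And>\<rho> e. block_perm n m \<rho> \<Longrightarrow> e \<in> U \<Longrightarrow> \<rho> ` e \<in> U"
begin

lemma finite_hypergraph: "regular_hypergraph n d U R \<Longrightarrow> finite R"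
  unfolding regular_hypergraph_def using U by (meson finite_Pow_iff finite_lessThan finite_subset)

text \<open>Every completion of the relabelled \<open>P\<close> also completes its part
  \<open>P'\<close>, so an inclusion is enough. The automorphism found is carried back by
  conjugation with \<open>\<rho>\<close>, which keeps each block fixed because \<open>\<rho>\<close>
  maps blocks to blocks.\<close>

lemma always_symmetric_relabel:
  assumes rho: "block_perm n m \<rho>" and P': "always_symmetric n m d U P'" and sub: "P' \<subseteq> (`) \<rho> ` P"
  shows "always_symmetric n m d U P"
  unfolding always_symmetric_def
proof (intro allI impI, elim conjE)
  fix R assume R: "regular_hypergraph n d U R" and PR: "P \<subseteq> R"
  have perm: "\<rho> permutes {..<n}" and blk: "\<And>x y. x < n \<Longrightarrow> y < n \<Longrightarrow> \<rho> x div m = \<rho> y div m \<longleftrightarrow> x div m = y div m"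
    using rho by (auto simp: block_perm_def)
  have inj: "inj \<rho>" by (rule permutes_inj[OF perm])
  let ?R = "(`) \<rho> ` R"
  have "regular_hypergraph n d U ?R"
    unfolding regular_hypergraph_def
  proof (intro conjI allI impI)
    show "?R \<subseteq> U" using R closed[OF rho] by (auto simp: regular_hypergraph_def)
    fix x assume x: "x < n"
    then have "x \<in> \<rho> ` {..<n}" using permutes_image[OF perm] by simp
    then obtain y where y: "y < n" "x = \<rho> y" by auto
    have "{e\<in>?R. x \<in> e} = (`) \<rho> ` {e\<in>R. y \<in> e}"
      unfolding y(2) using inj_image_mem_iff[OF inj] by blast
    moreover have "inj_on ((`) \<rho>) {e\<in>R. y \<in> e}" using inj by (auto simp: inj_on_def inj_image_eq_iff)
    ultimately show "card {e\<in>?R. x \<in> e} = d"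
      using R y(1) by (simp add: card_image regular_hypergraph_def)
  qed
  moreover have "P' \<subseteq> ?R" using sub PR by blast
  ultimately have "symmetric n m ?R" using P' by (simp add: always_symmetric_def)
  then obtain \<pi> x where pi: "\<pi> permutes {..<n}" "\<forall>x<n. \<pi> x div m = x div m" "x < n" "\<pi> x \<noteq> x" "\<forall>e\<in>?R. \<pi> ` e \<in> ?R"
    by (auto simp: symmetric_def)
  define \<kappa> where "\<kappa> = inv_into UNIV \<rho> \<circ> \<pi> \<circ> \<rho>"
  have kp: "\<kappa> permutes {..<n}"
    unfolding \<kappa>_def by (intro permutes_compose permutes_inv perm pi(1))
  have rk: "\<rho> (\<kappa> y) = \<pi> (\<rho> y)" for y
    unfolding \<kappa>_def using permutes_inverses(1)[OF perm] by simp
  have "\<kappa> y div m = y div m" if y: "y < n" for y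
  proof -
    have "\<kappa> y < n" "\<rho> y < n" using permutes_in_image[OF kp, of y] permutes_in_image[OF perm, of y] y by auto
    then show ?thesis using blk[of "\<kappa> y" y] rk[of y] pi(2) y by simp
  qed
  moreover have "\<exists>y<n. \<kappa> y \<noteq> y"
  proof -
    have "x \<in> \<rho> ` {..<n}" using permutes_image[OF perm] pi(3) by simp
    then obtain y where y: "y < n" "x = \<rho> y" by auto
    then have "\<rho> (\<kappa> y) \<noteq> \<rho> y" using rk[of y] pi(4) by simp
    then show ?thesis using y(1) by auto
  qed
  moreover have "\<kappa> ` e \<in> R" if e: "e \<in> R" for e
  proof -
    have "\<pi> ` \<rho> ` e \<in> ?R" using pi(5) e by blast
    then obtain f where f: "f \<in> R" "\<pi> ` \<rho> ` e = \<rho> ` f" by blast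
    have "\<rho> ` \<kappa> ` e = \<rho> ` f" using f(2) rk by (simp add: image_image)
    then have "\<kappa> ` e = f" using inj by (simp add: inj_image_eq_iff)
    then show ?thesis using f(1) by simp
  qed
  ultimately show "symmetric n m R" using kp by (auto simp: symmetric_def)
qed

lemma degree_less:
  assumes R: "regular_hypergraph n d U R" and "P \<subseteq> R" "e \<in> R" "e \<notin> P" "y \<in> e"
  shows "y < n \<and> card {f\<in>P. y \<in> f} < d"
proof -
  have y: "y < n" using R assms(3,5) U by (auto simp: regular_hypergraph_def)
  have "card {f\<in>P. y \<in> f} < card {f\<in>R. y \<in> f}"
  proof (rule psubset_card_mono)
    show "finite {f\<in>R. y \<in> f}" using finite_hypergraph[OF R] by simp
    show "{f\<in>P. y \<in> f} \<subset> {f\<in>R. y \<in> f}" using assms by auto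
  qed
  then show ?thesis using R y by (simp add: regular_hypergraph_def)
qed

text \<open>In any completion a vertex of deficient degree lies on a further edge, and all vertices
  of that edge are deficient as well; every candidate is followed up.\<close>

lemma always_symmetric_branch:
  assumes x: "x < n" "card {e\<in>P. x \<in> e} < d"
    and br: "\<And>e. e \<in> U \<Longrightarrow> x \<in> e \<Longrightarrow> e \<notin> P \<Longrightarrow> (\<And>y. y \<in> e \<Longrightarrow> y < n \<and> card {f\<in>P. y \<in> f} < d)
      \<Longrightarrow> always_symmetric n m d U (insert e P)"
  shows "always_symmetric n m d U P"
  unfolding always_symmetric_def
proof (intro allI impI, elim conjE)
  fix R assume R: "regular_hypergraph n d U R" and PR: "P \<subseteq> R"
  have cd: "card {e\<in>R. x \<in> e} = d" using R x(1) by (simp add: regular_hypergraph_def)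
  have "\<exists>e. e \<in> R \<and> x \<in> e \<and> e \<notin> P"
  proof (rule ccontr)
    assume "\<not> ?thesis"
    then have "{e\<in>R. x \<in> e} = {e\<in>P. x \<in> e}" using PR by blast
    then have "card {e\<in>P. x \<in> e} = d" using cd by (simp only:)
    then show False using x(2) by simp
  qed
  then obtain e where e: "e \<in> R" "x \<in> e" "e \<notin> P" by blast
  have "e \<in> U" using R e(1) by (auto simp: regular_hypergraph_def)
  then have "always_symmetric n m d U (insert e P)"
    by (rule br[OF _ e(2,3)]) (rule degree_less[OF R PR e(1,3)])
  then show "symmetric n m R" using R PR e(1) by (simp add: always_symmetric_def)
qed

lemma always_symmetric_leaf:
  assumes pi: "\<pi> permutes {..<n}" "\<And>x. x < n \<Longrightarrow> \<pi> x div m = x div m" "x < n" "\<pi> x \<noteq> x"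
    and P: "\<And>e. e \<in> P \<Longrightarrow> \<pi> ` e \<in> P"
    and fx: "\<And>y. y < n \<Longrightarrow> card {f\<in>P. y \<in> f} < d \<Longrightarrow> \<pi> y = y"
  shows "always_symmetric n m d U P"
  unfolding always_symmetric_def
proof (intro allI impI, elim conjE)
  fix R assume R: "regular_hypergraph n d U R" and PR: "P \<subseteq> R"
  have "\<pi> ` e \<in> R" if e: "e \<in> R" for e
  proof (cases "e \<in> P")
    case True then show ?thesis using P PR by blast
  next
    case False
    have "\<pi> y = y" if "y \<in> e" for y
      using fx degree_less[OF R PR e False that] by blast
    then have "\<pi> ` e = e" by simp
    then show ?thesis using e by simp
  qed
  then show "symmetric n m R" unfolding symmetric_def using pi by blast
qed

end

text \<open>A leaf holds an automorphism as the list of its values. A branch holds the deficient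
  vertex and, for each next edge through it, a relabelling and the position of the node
  reached.\<close>

datatype certificate = Leaf "nat list" | Branch nat "(nat list \<times> nat list \<times> nat) list"

definition degree :: "nat list list \<Rightarrow> nat \<Rightarrow> nat" where
  "degree P x = length (filter (\<lambda>e. x \<in> set e) P)"

definition relabel :: "nat list \<Rightarrow> nat list \<Rightarrow> nat list" where
  "relabel p e = sort (map ((!) p) e)"

definition is_perm :: "nat \<Rightarrow> nat list \<Rightarrow> bool" where
  "is_perm n p \<longleftrightarrow> length p = n \<and> distinct p \<and> (\<forall>x\<in>set p. x < n)"

definition is_block_perm :: "nat \<Rightarrow> nat \<Rightarrow> nat list \<Rightarrow> bool" where
  "is_block_perm n m p \<longleftrightarrow> is_perm n p \<and>
    (\<forall>x\<in>set [0..<n]. \<forall>y\<in>set [0..<n]. p ! x div m = p ! y div m \<longleftrightarrow> x div m = y div m)"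

text \<open>The automorphism at a leaf fixes all points of deficient degree, so it extends to every
  completion. A child is identified, after relabelling, with a node checked before, given by its
  position in \<open>prev\<close> (latest first).\<close>

fun check_node :: "nat list list \<Rightarrow> nat \<Rightarrow> nat \<Rightarrow> nat \<Rightarrow> nat list list list \<Rightarrow> nat list list \<Rightarrow> certificate \<Rightarrow> bool" where
  "check_node us n m d prev P (Leaf p) \<longleftrightarrow>
    is_perm n p \<and> p \<noteq> [0..<n] \<and> (\<forall>x\<in>set [0..<n]. p ! x div m = x div m) \<and>
    (\<forall>e\<in>set P. relabel p e \<in> set P) \<and> (\<forall>x\<in>set [0..<n]. degree P x < d \<longrightarrow> p ! x = x)"
| "check_node us n m d prev P (Branch x cs) \<longleftrightarrow>
    x < n \<and> degree P x < d \<and>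
    (\<forall>e\<in>set us. x \<in> set e \<longrightarrow> e \<notin> set P \<longrightarrow> (\<forall>y\<in>set e. degree P y < d) \<longrightarrow>
      (case map_of cs e of None \<Rightarrow> False | Some (p, i) \<Rightarrow>
        i < length prev \<and> is_block_perm n m p \<and> set (prev ! i) \<subseteq> set (map (relabel p) (e # P))))"

text \<open>Nodes come children first, the empty hypergraph last, so references lead only to nodes
  already verified. As the candidate edges are enumerated from \<open>us\<close>, an incomplete
  certificate is rejected; an empty branch is accepted only at a deficient vertex with no admissible
  edge left, where no completion exists.\<close>

fun check_tree :: "nat list list \<Rightarrow> nat \<Rightarrow> nat \<Rightarrow> nat \<Rightarrow> nat list list list \<Rightarrow> (nat list list \<times> certificate) list \<Rightarrow> bool" where
  "check_tree us n m d prev [] \<longleftrightarrow> True"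
| "check_tree us n m d prev ((P, c) # ns) \<longleftrightarrow>
    distinct P \<and> set P \<subseteq> set us \<and> check_node us n m d prev P c \<and> check_tree us n m d (P # prev) ns"

definition perm_of :: "nat \<Rightarrow> nat list \<Rightarrow> nat \<Rightarrow> nat" where
  "perm_of n p x = (if x < n then p ! x else x)"

lemma perm_of_permutes:
  assumes "is_perm n p" shows "perm_of n p permutes {..<n}"
proof (rule bij_imp_permutes)
  have p: "length p = n" "distinct p" "\<And>x. x < n \<Longrightarrow> p ! x < n" using assms by (auto simp: is_perm_def)
  have "inj_on (perm_of n p) {..<n}"
    using p(1,2) by (auto simp: inj_on_def perm_of_def nth_eq_iff_index_eq)
  moreover have "perm_of n p ` {..<n} \<subseteq> {..<n}" using p(3) by (auto simp: perm_of_def)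
  ultimately show "bij_betw (perm_of n p) {..<n} {..<n}" by (simp add: bij_betw_def endo_inj_surj)
qed (simp add: perm_of_def)

lemma set_relabel:
  assumes "set e \<subseteq> {..<n}" shows "set (relabel p e) = perm_of n p ` set e"
proof -
  have "perm_of n p ` set e = (!) p ` set e" using assms by (intro image_cong) (auto simp: perm_of_def)
  then show ?thesis by (simp add: relabel_def)
qed

text \<open>Sorted distinct lists represent edges uniquely, so counting lists counts edges;
  \<open>relabel\<close> sorts in order to stay within this form.\<close>

locale edge_list = edge_universe +
  fixes us :: "nat list list"
  assumes us: "set ` set us = U" and canonical: "\<And>e. e \<in> set us \<Longrightarrow> sorted e \<and> distinct e"
begin

lemma us_less: "e \<in> set us \<Longrightarrow> set e \<subseteq> {..<n}"
  using us U by blast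

lemma us_inj: "inj_on set (set us)"
  using canonical by (auto simp: inj_on_def intro: sorted_distinct_set_unique)

lemma card_degree:
  assumes "distinct P" "set P \<subseteq> set us" shows "card {f \<in> set ` set P. x \<in> f} = degree P x"
proof -
  have "{f \<in> set ` set P. x \<in> f} = set ` set (filter (\<lambda>e. x \<in> set e) P)" by auto
  moreover have "inj_on set (set (filter (\<lambda>e. x \<in> set e) P))"
    by (rule inj_on_subset[OF us_inj]) (use assms(2) in auto)
  ultimately show ?thesis
    using distinct_card[OF distinct_filter[OF assms(1)]] by (simp add: card_image degree_def)
qed

lemma check_node_sound:
  assumes P: "distinct P" "set P \<subseteq> set us" and c: "check_node us n m d prev P c"
    and prev: "\<And>Q. Q \<in> set prev \<Longrightarrow> always_symmetric n m d U (set ` set Q)"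
  shows "always_symmetric n m d U (set ` set P)"
proof (cases c)
  case (Leaf p)
  have p: "is_perm n p" "p \<noteq> [0..<n]" "\<And>x. x < n \<Longrightarrow> p ! x div m = x div m"
    "\<And>e. e \<in> set P \<Longrightarrow> relabel p e \<in> set P" "\<And>x. x < n \<Longrightarrow> degree P x < d \<Longrightarrow> p ! x = x"
    using c Leaf by auto
  have "\<exists>x<n. p ! x \<noteq> x"
  proof (rule ccontr)
    assume "\<not> ?thesis"
    then have "p = [0..<n]" using p(1) by (intro nth_equalityI) (auto simp: is_perm_def)
    then show False using p(2) by simp
  qed
  then obtain x where x: "x < n" "p ! x \<noteq> x" by blast
  show ?thesis
  proof (rule always_symmetric_leaf[OF perm_of_permutes[OF p(1)] _ x(1)])
    show "perm_of n p y div m = y div m" if "y < n" for y using p(3) that by (simp add: perm_of_def)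
    show "perm_of n p x \<noteq> x" using x by (simp add: perm_of_def)
    show "perm_of n p ` e \<in> set ` set P" if e: "e \<in> set ` set P" for e
    proof -
      obtain l where l: "l \<in> set P" "e = set l" using e by auto
      have "set l \<subseteq> {..<n}" using us_less P(2) l(1) by blast
      then have "perm_of n p ` e = set (relabel p l)" using set_relabel l(2) by simp
      then show ?thesis using p(4)[OF l(1)] by simp
    qed
    show "perm_of n p y = y" if "y < n" "card {f \<in> set ` set P. y \<in> f} < d" for y
      using p(5)[of y] that card_degree[OF P] by (simp add: perm_of_def)
  qed
next
  case (Branch x cs)
  have x: "x < n" "degree P x < d" using c Branch by auto
  show ?thesis
  proof (rule always_symmetric_branch[of x])
    show "x < n" by (rule x)
    show "card {e \<in> set ` set P. x \<in> e} < d" using x card_degree[OF P] by simp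
    fix e assume e: "e \<in> U" "x \<in> e" "e \<notin> set ` set P"
      and deg: "\<And>y. y \<in> e \<Longrightarrow> y < n \<and> card {f \<in> set ` set P. y \<in> f} < d"
    obtain l where l: "l \<in> set us" "e = set l" using e(1) us by blast
    have "x \<in> set l" "l \<notin> set P" "\<forall>y\<in>set l. degree P y < d"
      using e(2,3) l(2) deg card_degree[OF P] by auto
    then have "case map_of cs l of None \<Rightarrow> False | Some (p, i) \<Rightarrow>
        i < length prev \<and> is_block_perm n m p \<and> set (prev ! i) \<subseteq> set (map (relabel p) (l # P))"
      using c Branch l(1) by auto
    then obtain p i where pi: "i < length prev" "is_block_perm n m p"
      "set (prev ! i) \<subseteq> set (map (relabel p) (l # P))"
      by (auto split: option.splits)
    have bp: "block_perm n m (perm_of n p)"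
      using pi(2) perm_of_permutes[of n p] by (auto simp: block_perm_def is_block_perm_def perm_of_def)
    show "always_symmetric n m d U (insert e (set ` set P))"
    proof (rule always_symmetric_relabel[OF bp])
      show "always_symmetric n m d U (set ` set (prev ! i))" using prev pi(1) by simp
      show "set ` set (prev ! i) \<subseteq> (`) (perm_of n p) ` insert e (set ` set P)"
      proof
        fix f assume "f \<in> set ` set (prev ! i)"
        then obtain q where "q \<in> set (prev ! i)" "f = set q" by auto
        then obtain r where r: "r \<in> set (l # P)" "f = set (relabel p r)" using pi(3) by auto
        have "set r \<subseteq> {..<n}" using us_less r(1) l(1) P(2) by auto
        then have "f = perm_of n p ` set r" using set_relabel r(2) by simp
        then show "f \<in> (`) (perm_of n p) ` insert e (set ` set P)" using r(1) l(2) by auto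
      qed
    qed
  qed
qed

lemma check_tree_sound:
  assumes "check_tree us n m d prev ns"
    and "\<And>Q. Q \<in> set prev \<Longrightarrow> always_symmetric n m d U (set ` set Q)" and "(P, c) \<in> set ns"
  shows "always_symmetric n m d U (set ` set P)"
  using assms
proof (induction ns arbitrary: prev)
  case (Cons a ns)
  obtain P' c' where a: "a = (P', c')" by fastforce
  have ch: "distinct P'" "set P' \<subseteq> set us" "check_node us n m d prev P' c'" "check_tree us n m d (P' # prev) ns"
    using Cons.prems(1) by (simp_all add: a)
  have P': "always_symmetric n m d U (set ` set P')"
    by (rule check_node_sound[OF ch(1-3)]) (rule Cons.prems(2))
  show ?case
  proof (cases "(P, c) = a")
    case True then show ?thesis using P' a by simp
  next
    case False
    then have "(P, c) \<in> set ns" using Cons.prems(3) by auto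
    then show ?thesis using Cons.IH[OF ch(4)] Cons.prems(2) P' by auto
  qed
qed simp

end

section \<open>Rigid sets as regular hypergraphs\<close>

definition edge_sets :: "nat \<Rightarrow> nat \<Rightarrow> nat \<Rightarrow> bool \<Rightarrow> nat set set" where
  "edge_sets n m k t = {e. e \<subseteq> {..<n} \<and> card e = k \<and> (t \<longrightarrow> inj_on (\<lambda>x. x div m) e)}"

definition edge_lists :: "nat \<Rightarrow> nat \<Rightarrow> nat \<Rightarrow> bool \<Rightarrow> nat list list" where
  "edge_lists n m k t =
    filter (\<lambda>e. length e = k \<and> (t \<longrightarrow> distinct (map (\<lambda>x. x div m) e))) (subseqs [0..<n])"

lemma sorted_subseqs:
  fixes xs :: "'a :: linorder list"
  shows "sorted xs \<Longrightarrow> ys \<in> set (subseqs xs) \<Longrightarrow> sorted ys"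
proof (induction xs arbitrary: ys)
  case (Cons x xs)
  have sub: "set zs \<subseteq> set xs" if "zs \<in> set (subseqs xs)" for zs
    using that subseqs_powset[of xs] by blast
  from Cons.prems(2) consider "ys \<in> set (subseqs xs)" | zs where "zs \<in> set (subseqs xs)" "ys = x # zs"
    by (auto simp: Let_def)
  then show ?case
  proof cases
    case 1 then show ?thesis using Cons by simp
  next
    case 2
    then show ?thesis using Cons.IH[of zs] Cons.prems(1) sub[of zs] by auto
  qed
qed simp

lemma set_edge_lists: "set ` set (edge_lists n m k t) = edge_sets n m k t"
proof (intro equalityI subsetI)
  fix e assume "e \<in> set ` set (edge_lists n m k t)"
  then obtain l where l: "l \<in> set (subseqs [0..<n])" "length l = k" "t \<longrightarrow> distinct (map (\<lambda>x. x div m) l)" "e = set l"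
    by (auto simp: edge_lists_def)
  have "set l \<in> Pow (set [0..<n])" unfolding subseqs_powset[symmetric] using l(1) by (rule imageI)
  then have "set l \<subseteq> {..<n}" by auto
  moreover have "distinct l" using subseqs_distinctD[OF l(1)] by simp
  ultimately show "e \<in> edge_sets n m k t"
    using l(2-4) by (auto simp: edge_sets_def distinct_card distinct_map)
next
  fix e assume e: "e \<in> edge_sets n m k t"
  then have "e \<in> set ` set (subseqs [0..<n])"
    by (intro subset_subseqs) (auto simp: edge_sets_def)
  then obtain l where l: "l \<in> set (subseqs [0..<n])" "e = set l" by blast
  have "distinct l" using subseqs_distinctD[OF l(1)] by simp
  then have "l \<in> set (edge_lists n m k t)"
    using e l by (auto simp: edge_lists_def edge_sets_def distinct_card distinct_map)
  then show "e \<in> set ` set (edge_lists n m k t)" using l(2) by blast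
qed

lemma edge_list_edge_lists: "edge_list n m (edge_sets n m k t) (edge_lists n m k t)"
proof unfold_locales
  show "edge_sets n m k t \<subseteq> Pow {..<n}" by (auto simp: edge_sets_def)
  show "\<rho> ` e \<in> edge_sets n m k t" if rho: "block_perm n m \<rho>" and e: "e \<in> edge_sets n m k t" for \<rho> e
  proof -
    have p: "\<rho> permutes {..<n}" using rho by (simp add: block_perm_def)
    have s: "e \<subseteq> {..<n}" using e by (simp add: edge_sets_def)
    have "\<rho> ` e \<subseteq> {..<n}" using s permutes_image[OF p] by blast
    moreover have "card (\<rho> ` e) = card e" by (rule card_image[OF permutes_inj_on[OF p]])
    moreover have "inj_on (\<lambda>x. x div m) (\<rho> ` e)" if "inj_on (\<lambda>x. x div m) e"
    proof (rule inj_onI)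
      fix x' y' assume "x' \<in> \<rho> ` e" "y' \<in> \<rho> ` e" and d: "x' div m = y' div m"
      then obtain x y where xy: "x \<in> e" "x' = \<rho> x" "y \<in> e" "y' = \<rho> y" by blast
      have "x < n" "y < n" using xy s by auto
      then have "x div m = y div m" using rho d xy by (simp add: block_perm_def)
      then show "x' = y'" using that xy by (auto dest: inj_onD)
    qed
    ultimately show ?thesis using e by (simp add: edge_sets_def)
  qed
  show "set ` set (edge_lists n m k t) = edge_sets n m k t" by (rule set_edge_lists)
  show "sorted e \<and> distinct e" if e: "e \<in> set (edge_lists n m k t)" for e
  proof -
    have "e \<in> set (subseqs [0..<n])" using e by (simp add: edge_lists_def)
    then show ?thesis using sorted_subseqs[of "[0..<n]" e] subseqs_distinctD[of e "[0..<n]"] by simp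
  qed
qed

lemma always_symmetricI:
  assumes "check_tree (edge_lists n m k t) n m d [] ns" "([], c) \<in> set ns"
  shows "always_symmetric n m d (edge_sets n m k t) {}"
proof -
  interpret edge_list n m d "edge_sets n m k t" "edge_lists n m k t" by (rule edge_list_edge_lists)
  show ?thesis using check_tree_sound[OF assms(1) _ assms(2)] by simp
qed

text \<open>Columns are the vertices, in a single block, and rows are the edges. Equal rows could be
  exchanged, so the rows of a rigid matrix are distinct and their set determines the matrix up to
  order; a symmetry of the columns that preserves this set induces the row permutation.\<close>

lemma not_realizable_rows:
  assumes sym: "always_symmetric b b a (edge_sets b b a False) {}"
  shows "\<not> realizable a b 2"
proof
  assume "realizable a b 2"
  then obtain R where rows: "\<forall>i<b. card {j. j < b \<and> R i j} = a" and cols: "\<forall>j<b. card {i. i < b \<and> R i j} = a"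
    and rig: "rigid_matrix b R" unfolding realizable_dim_2_iff by blast
  define N where "N i = {j. j < b \<and> R i j}" for i
  have inj: "inj_on N {..<b}"
  proof (rule inj_onI, rule ccontr)
    fix i i' assume i: "i \<in> {..<b}" "i' \<in> {..<b}" "N i = N i'" "i \<noteq> i'"
    have same: "R i j = R i' j" if "j < b" for j using i(3) that by (auto simp: N_def)
    have "transpose i i' permutes {..<b}" using i by (intro permutes_swap_id) auto
    moreover have "R (transpose i i' l) (id j) = R l j" if "j < b" for l j
      using same[OF that] by (cases "l = i"; cases "l = i'") auto
    ultimately have "transpose i i' i = i"
      using rig[unfolded rigid_matrix_def, rule_format, of "transpose i i'" id i] permutes_id i(1) by auto
    then show False using i(4) by simp
  qed
  let ?R = "N ` {..<b}"
  have "regular_hypergraph b a (edge_sets b b a False) ?R"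
    unfolding regular_hypergraph_def
  proof (intro conjI allI impI)
    show "?R \<subseteq> edge_sets b b a False" using rows by (auto simp: N_def edge_sets_def)
    fix x assume x: "x < b"
    have "{e\<in>?R. x \<in> e} = N ` {i. i < b \<and> R i x}" using x by (auto simp: N_def)
    moreover have "inj_on N {i. i < b \<and> R i x}" by (rule inj_on_subset[OF inj]) auto
    ultimately show "card {e\<in>?R. x \<in> e} = a" using cols x by (simp add: card_image)
  qed
  then have "symmetric b b ?R" using sym by (simp add: always_symmetric_def)
  then obtain \<pi> x where pi: "\<pi> permutes {..<b}" "x < b" "\<pi> x \<noteq> x" "\<forall>e\<in>?R. \<pi> ` e \<in> ?R"
    by (auto simp: symmetric_def)
  have "\<exists>l<b. \<pi> ` N i = N l" if "i < b" for i using pi(4) that by blast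
  then obtain \<rho> where rho: "\<And>i. i < b \<Longrightarrow> \<rho> i < b \<and> \<pi> ` N i = N (\<rho> i)" by metis
  define \<sigma> where "\<sigma> i = (if i < b then \<rho> i else i)" for i
  have sp: "\<sigma> permutes {..<b}"
  proof (rule bij_imp_permutes)
    have "inj_on \<sigma> {..<b}"
    proof (rule inj_onI)
      fix i l assume il: "i \<in> {..<b}" "l \<in> {..<b}" "\<sigma> i = \<sigma> l"
      then have "\<pi> ` N i = \<pi> ` N l" using rho by (simp add: \<sigma>_def)
      then have "N i = N l" using permutes_inj[OF pi(1)] by (simp add: inj_image_eq_iff)
      then show "i = l" using inj il by (auto dest: inj_onD)
    qed
    moreover have "\<sigma> ` {..<b} \<subseteq> {..<b}" using rho by (auto simp: \<sigma>_def)
    ultimately show "bij_betw \<sigma> {..<b} {..<b}" by (simp add: bij_betw_def endo_inj_surj)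
  qed (simp add: \<sigma>_def)
  have "R (\<sigma> i) (\<pi> j) = R i j" if "i < b" "j < b" for i j
  proof -
    have "\<pi> j < b" using permutes_in_image[OF pi(1), of j] that(2) by simp
    then have "R (\<sigma> i) (\<pi> j) \<longleftrightarrow> \<pi> j \<in> \<pi> ` N i" using rho[OF that(1)] that(1) by (simp add: N_def \<sigma>_def)
    also have "\<dots> \<longleftrightarrow> j \<in> N i" by (rule inj_image_mem_iff[OF permutes_inj[OF pi(1)]])
    finally show ?thesis using that by (simp add: N_def)
  qed
  then have "\<pi> x = x"
    using rig[unfolded rigid_matrix_def, rule_format, of \<sigma> \<pi> x] sp pi(1,2) by auto
  then show False using pi(3) by simp
qed

text \<open>Vertex \<open>b * c + j\<close> stands for the slice \<open>v c = j\<close>, and a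
  vector becomes the transversal of the slices containing it. Blocks are coordinates, so the
  automorphisms fixing each block are the tuples of label permutations.\<close>

lemma not_realizable_transversal:
  assumes sym: "always_symmetric (b * k) b a (edge_sets (b * k) b k True) {}" and b: "1 \<le> b"
  shows "\<not> realizable a b k"
proof
  assume "realizable a b k"
  then obtain S where S: "balanced a b k S" "rigid b k S" by (auto simp: realizable_def)
  have Sc: "S \<subseteq> cube b k" using S(1) by (simp add: balanced_def)
  define E where "E v = (\<lambda>c. b * c + v c) ` {..<k}" for v :: "nat \<Rightarrow> nat"
  have dv: "(b * c + j) div b = c" "(b * c + j) mod b = j" if "j < b" for c j
    using that by auto
  have memE: "b * c + j \<in> E v \<longleftrightarrow> v c = j" if v: "v \<in> cube b k" and c: "c < k" and j: "j < b" for v c j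
  proof
    assume "b * c + j \<in> E v"
    then obtain c' where c': "c' < k" "b * c + j = b * c' + v c'" by (auto simp: E_def)
    have "v c' < b" using cube_less[OF v c'(1)] .
    then have "c = c'" "j = v c'" using c'(2) dv j by metis+
    then show "v c = j" by simp
  next
    assume "v c = j"
    then show "b * c + j \<in> E v" using c by (auto simp: E_def)
  qed
  have injE: "inj_on E (cube b k)"
  proof (rule inj_onI)
    fix v w assume vw: "v \<in> cube b k" "w \<in> cube b k" "E v = E w"
    show "v = w"
    proof (rule cube_eqI[OF vw(1,2)])
      fix c assume c: "c < k"
      have "b * c + v c \<in> E w" using memE[OF vw(1) c cube_less[OF vw(1) c]] vw(3) by simp
      then show "v c = w c" using memE[OF vw(2) c cube_less[OF vw(1) c]] by simp
    qed
  qed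
  have lt: "b * c + j < b * k" if "c < k" "j < b" for c j
  proof -
    have "b * c + j < b * c + b" using that(2) by simp
    also have "\<dots> = b * Suc c" by simp
    also have "\<dots> \<le> b * k" using that(1) by (intro mult_le_mono2) simp
    finally show ?thesis .
  qed
  let ?R = "E ` S"
  have "regular_hypergraph (b * k) a (edge_sets (b * k) b k True) ?R"
    unfolding regular_hypergraph_def
  proof (intro conjI allI impI)
    show "?R \<subseteq> edge_sets (b * k) b k True"
    proof
      fix e assume "e \<in> ?R"
      then obtain v where v: "v \<in> cube b k" "e = E v" using Sc by auto
      have d: "(b * c + v c) div b = c" if "c < k" for c using dv(1)[OF cube_less[OF v(1) that]] .
      have "inj_on (\<lambda>c. b * c + v c) {..<k}" using d by (metis (mono_tags, lifting) inj_onI lessThan_iff)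
      then have "card e = k" unfolding v(2) E_def by (simp add: card_image)
      moreover have "e \<subseteq> {..<b * k}" using lt cube_less[OF v(1)] by (auto simp: v(2) E_def)
      moreover have "inj_on (\<lambda>x. x div b) e" unfolding v(2) E_def using d by (auto simp: inj_on_def)
      ultimately show "e \<in> edge_sets (b * k) b k True" by (simp add: edge_sets_def)
    qed
    fix x assume x: "x < b * k"
    define c j where "c = x div b" and "j = x mod b"
    have c: "c < k" unfolding c_def using x b by (simp add: less_mult_imp_div_less mult.commute)
    have j: "j < b" unfolding j_def using b by simp
    have xe: "x = b * c + j" by (simp add: c_def j_def)
    have "{e\<in>?R. x \<in> e} = E ` {v\<in>S. v c = j}" using memE[OF _ c j] Sc unfolding xe by blast
    moreover have "inj_on E {v\<in>S. v c = j}" by (rule inj_on_subset[OF injE]) (use Sc in auto)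
    ultimately show "card {e\<in>?R. x \<in> e} = a" using S(1) c j by (simp add: card_image balanced_def)
  qed
  then have "symmetric (b * k) b ?R" using sym by (simp add: always_symmetric_def)
  then obtain \<kappa> x where ka: "\<kappa> permutes {..<b * k}" "\<forall>x<b*k. \<kappa> x div b = x div b" "x < b * k" "\<kappa> x \<noteq> x"
    "\<forall>e\<in>?R. \<kappa> ` e \<in> ?R" by (auto simp: symmetric_def)
  define \<pi> where "\<pi> c j = (if j < b then \<kappa> (b * c + j) mod b else j)" for c j
  have kp: "\<kappa> (b * c + j) = b * c + \<pi> c j" if "c < k" "j < b" for c j
  proof -
    have "\<kappa> (b * c + j) div b = c" using ka(2) lt[OF that] dv(1)[OF that(2)] by simp
    then show ?thesis using that(2) mult_div_mod_eq[of b "\<kappa> (b * c + j)"] by (simp add: \<pi>_def)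
  qed
  have pi: "\<pi> c permutes {..<b}" if c: "c < k" for c
  proof (rule bij_imp_permutes)
    have "inj_on (\<pi> c) {..<b}"
    proof (rule inj_onI)
      fix i j assume ij: "i \<in> {..<b}" "j \<in> {..<b}" "\<pi> c i = \<pi> c j"
      then have "\<kappa> (b * c + i) = \<kappa> (b * c + j)" using kp[OF c] by simp
      then show "i = j" using permutes_inj[OF ka(1)] by (simp add: inj_eq)
    qed
    moreover have "\<pi> c ` {..<b} \<subseteq> {..<b}" using b by (auto simp: \<pi>_def)
    ultimately show "bij_betw (\<pi> c) {..<b} {..<b}" by (simp add: bij_betw_def endo_inj_surj)
  qed (simp add: \<pi>_def)
  have "act k \<pi> ` S \<subseteq> S"
  proof
    fix w assume "w \<in> act k \<pi> ` S"
    then obtain v where v: "v \<in> S" "w = act k \<pi> v" by blast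
    have vc: "v \<in> cube b k" using v(1) Sc by blast
    have wc: "w \<in> cube b k" unfolding v(2) by (rule act_in_cube[OF pi vc])
    have "\<kappa> ` E v = E w"
      unfolding E_def image_image
      by (rule image_cong[OF refl]) (use kp cube_less[OF vc] v(2) in simp)
    then have "E w \<in> ?R" using ka(5) v(1) by (metis imageI)
    then obtain u where u: "u \<in> S" "E w = E u" by blast
    then have "w = u" using injE wc Sc by (auto dest: inj_onD)
    then show "w \<in> S" using u(1) by simp
  qed
  then have id: "\<pi> c = id" if "c < k" for c using rigidD[OF S(2), of \<pi> c] pi that by blast
  have "x div b < k" "x mod b < b" using ka(3) b by (simp_all add: less_mult_imp_div_less mult.commute)
  then have "\<kappa> x = x" using kp[of "x div b" "x mod b"] id[of "x div b"] by simp
  then show False using ka(4) by simp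
qed

section \<open>Search certificates for the four exceptional parameters\<close>

definition tree_3_6 :: "(nat list list \<times> certificate) list" where
  "tree_3_6 = [
    ([[0,1,2],[0,1,3],[0,2,4],[1,4,5],[2,3,5],[3,4,5]], Leaf [0,2,1,4,3,5]),
    ([[0,1,2],[0,1,3],[0,2,4],[1,3,5],[2,4,5],[3,4,5]], Leaf [0,2,1,4,3,5]),
    ([[0,1,2],[0,1,3],[0,2,4],[1,4,5],[2,3,5]], Branch 3 [([3,4,5],[0,1,2,3,4,5],1)]),
    ([[0,1,2],[0,1,3],[0,2,4],[1,3,5],[2,4,5]], Branch 3 [([3,4,5],[0,1,2,3,4,5],1)]),
    ([[0,1,2],[0,1,3],[0,2,4],[1,3,4],[2,4,5]], Branch 3 []),
    ([[0,1,2],[0,1,3],[0,2,4],[1,3,4],[2,3,5]], Leaf [1,0,3,2,4,5]),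
    ([[0,1,2],[0,1,3],[0,2,4],[1,3,4],[2,3,4]], Leaf [0,2,1,4,3,5]),
    ([[0,1,2],[0,1,3],[0,2,4],[1,2,5],[3,4,5]], Branch 3 []),
    ([[0,1,2],[0,1,3],[0,2,3],[1,4,5],[2,4,5]], Leaf [0,2,1,3,4,5]),
    ([[0,1,2],[0,1,3],[0,2,3],[1,2,4],[3,4,5]], Leaf [0,2,1,3,4,5]),
    ([[0,1,2],[0,1,3],[0,4,5],[1,4,5]], Leaf [1,0,2,3,4,5]),
    ([[0,1,2],[0,1,3],[0,2,4],[1,4,5]], Branch 2 [([2,3,4],[0,2,1,4,3,5],5),([2,3,5],[0,1,2,3,4,5],8),
    ([2,4,5],[2,4,0,5,1,3],6)]),
    ([[0,1,2],[0,1,3],[0,2,4],[1,3,5]], Branch 2 [([2,3,4],[0,2,1,4,3,5],7),([2,3,5],[2,0,4,1,5,3],7),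
    ([2,4,5],[0,1,2,3,4,5],8)]),
    ([[0,1,2],[0,1,3],[0,2,4],[1,3,4]], Branch 2 [([2,3,4],[0,1,2,3,4,5],6),([2,3,5],[0,1,2,3,4,5],7),
    ([2,4,5],[0,1,2,3,4,5],8)]),
    ([[0,1,2],[0,1,3],[0,2,4],[1,2,5]], Branch 3 [([3,4,5],[0,1,2,3,4,5],6)]),
    ([[0,1,2],[0,1,3],[0,2,3],[1,4,5]], Branch 2 [([2,3,4],[0,3,1,2,4,5],5),([2,3,5],[0,3,1,2,5,4],5),
    ([2,4,5],[0,1,2,3,4,5],6)]),
    ([[0,1,2],[0,1,3],[0,2,3],[1,2,4]], Leaf [0,2,1,3,4,5]),
    ([[0,1,2],[0,1,3],[0,2,3],[1,2,3]], Leaf [0,1,3,2,4,5]),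
    ([[0,1,2],[0,1,3],[0,4,5]], Branch 1 [([1,2,3],[1,0,2,3,4,5],2),([1,2,4],[1,0,2,3,4,5],6),
    ([1,2,5],[1,0,2,3,5,4],6),([1,3,4],[1,0,3,2,4,5],6),([1,3,5],[1,0,3,2,5,4],6),([1,4,5],[0,1,2,3,4,5],7)]),
    ([[0,1,2],[0,1,3],[0,2,4]], Branch 1 [([1,2,3],[1,0,2,3,4,5],2),([1,2,4],[1,2,0,4,3,5],2),
    ([1,2,5],[0,1,2,3,4,5],4),([1,3,4],[0,1,2,3,4,5],5),([1,3,5],[0,1,2,3,4,5],6),([1,4,5],[0,1,2,3,4,5],7)]),
    ([[0,1,2],[0,1,3],[0,2,3]], Branch 1 [([1,2,3],[0,1,2,3,4,5],2),([1,2,4],[0,1,2,3,4,5],3),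
    ([1,2,5],[0,1,2,3,5,4],3),([1,3,4],[0,1,3,2,4,5],3),([1,3,5],[0,1,3,2,5,4],3),([1,4,5],[0,1,2,3,4,5],4)]),
    ([[0,1,2],[0,1,3],[0,1,4]], Leaf [1,0,2,3,4,5]),
    ([[0,1,2],[0,3,4]], Branch 0 [([0,1,3],[0,1,3,2,4,5],2),([0,1,4],[0,1,3,4,2,5],2),([0,1,5],[0,1,2,4,5,3],3),
    ([0,2,3],[0,3,1,2,4,5],2),([0,2,4],[0,3,1,4,2,5],2),([0,2,5],[0,2,1,4,5,3],3),([0,3,5],[0,4,5,1,2,3],3),
    ([0,4,5],[0,4,5,2,1,3],3)]),
    ([[0,1,2],[0,1,3]], Branch 0 [([0,1,4],[0,1,2,3,4,5],1),([0,1,5],[0,1,2,3,5,4],1),([0,2,3],[0,1,2,3,4,5],2),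
    ([0,2,4],[0,1,2,3,4,5],3),([0,2,5],[0,1,2,3,5,4],3),([0,3,4],[0,1,3,2,4,5],3),([0,3,5],[0,1,3,2,5,4],3),
    ([0,4,5],[0,1,2,3,4,5],4)]),
    ([[0,1,2]], Branch 0 [([0,1,3],[0,1,2,3,4,5],0),([0,1,4],[0,1,2,4,3,5],0),([0,1,5],[0,1,2,4,5,3],0),
    ([0,2,3],[0,2,1,3,4,5],0),([0,2,4],[0,2,1,4,3,5],0),([0,2,5],[0,2,1,4,5,3],0),([0,3,4],[0,1,2,3,4,5],1),
    ([0,3,5],[0,1,2,3,5,4],1),([0,4,5],[0,1,2,5,3,4],1)]),
    ([], Branch 0 [([0,1,2],[0,1,2,3,4,5],0),([0,1,3],[0,1,3,2,4,5],0),([0,1,4],[0,1,3,4,2,5],0),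
    ([0,1,5],[0,1,3,4,5,2],0),([0,2,3],[0,3,1,2,4,5],0),([0,2,4],[0,3,1,4,2,5],0),([0,2,5],[0,3,1,4,5,2],0),
    ([0,3,4],[0,3,4,1,2,5],0),([0,3,5],[0,3,4,1,5,2],0),([0,4,5],[0,3,4,5,1,2],0)])]"

definition tree_3_7 :: "(nat list list \<times> certificate) list" where
  "tree_3_7 = [
    ([[0,1,2],[0,1,3],[0,1,4],[2,3,5],[2,4,6],[3,5,6],[4,5,6]], Leaf [0,1,2,4,3,6,5]),
    ([[0,1,2],[0,1,3],[0,4,5],[1,4,6],[2,3,5],[2,4,6],[3,5,6]], Leaf [4,6,2,1,5,0,3]),
    ([[0,1,2],[0,1,3],[0,4,5],[1,4,6],[2,3,4],[2,5,6],[3,5,6]], Leaf [0,1,3,2,4,5,6]),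
    ([[0,1,2],[0,1,3],[0,2,4],[1,5,6],[2,5,6],[3,4,5],[3,4,6]], Leaf [0,1,2,3,4,6,5]),
    ([[0,1,2],[0,1,3],[0,2,4],[1,4,5],[2,5,6],[3,4,6],[3,5,6]], Leaf [6,5,3,2,4,1,0]),
    ([[0,1,2],[0,1,3],[0,2,4],[1,3,5],[2,5,6],[3,4,6],[4,5,6]], Leaf [1,0,3,2,5,4,6]),
    ([[0,1,2],[0,1,3],[0,2,4],[1,3,5],[2,4,6],[3,5,6],[4,5,6]], Leaf [0,2,1,4,3,6,5]),
    ([[0,1,2],[0,1,3],[0,2,3],[1,4,5],[2,4,6],[3,5,6],[4,5,6]], Leaf [0,1,3,2,5,4,6]),
    ([[0,1,2],[0,3,4],[0,5,6],[1,3,5],[1,4,6],[2,3,6]], Leaf [1,0,2,6,4,5,3]),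
    ([[0,1,2],[0,1,3],[0,1,4],[2,3,4],[2,3,5],[4,5,6]], Leaf [0,1,3,2,4,5,6]),
    ([[0,1,2],[0,1,3],[0,2,4],[1,3,4],[2,5,6],[4,5,6]], Branch 3 [([3,5,6],[5,6,3,4,2,0,1],9)]),
    ([[0,1,2],[0,1,3],[0,2,4],[1,3,4],[2,3,5],[4,5,6]], Leaf [1,0,3,2,4,5,6]),
    ([[0,1,2],[0,1,3],[0,2,4],[1,5,6],[3,4,5],[3,4,6]], Branch 2 [([2,5,6],[0,1,2,3,4,5,6],8)]),
    ([[0,1,2],[0,1,3],[0,4,5],[1,4,6],[2,3,5],[2,4,6]], Branch 3 [([3,5,6],[0,1,2,3,4,5,6],11)]),
    ([[0,1,2],[0,1,3],[0,4,5],[1,4,6],[2,3,4],[2,5,6]], Branch 3 [([3,5,6],[0,1,2,3,4,5,6],11)]),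
    ([[0,1,2],[0,1,3],[0,4,5],[1,4,5],[2,3,4],[2,5,6]], Leaf [1,0,2,3,4,5,6]),
    ([[0,1,2],[0,1,3],[0,1,4],[2,3,5],[2,4,5],[3,5,6]], Leaf [1,0,2,3,4,5,6]),
    ([[0,1,2],[0,1,3],[0,2,4],[1,5,6],[2,5,6],[3,4,5]], Branch 3 [([3,4,6],[0,1,2,3,4,5,6],13)]),
    ([[0,1,2],[0,1,3],[0,2,4],[1,4,5],[2,5,6],[4,5,6]], Branch 6 []),
    ([[0,1,2],[0,1,3],[0,2,4],[1,4,5],[2,5,6],[3,4,6]], Branch 3 [([3,5,6],[0,1,2,3,4,5,6],14)]),
    ([[0,1,2],[0,1,3],[0,2,4],[1,4,5],[2,5,6],[3,4,5]], Branch 3 []),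
    ([[0,1,2],[0,1,3],[0,2,4],[1,4,5],[2,3,6],[3,5,6]], Branch 4 [([4,5,6],[6,4,5,3,2,0,1],15)]),
    ([[0,1,2],[0,1,3],[0,2,4],[1,4,5],[2,3,6],[3,4,5]], Branch 5 []),
    ([[0,1,2],[0,1,3],[0,2,4],[1,4,5],[2,3,5],[3,5,6]], Branch 4 []),
    ([[0,1,2],[0,1,3],[0,2,4],[1,4,5],[2,3,5],[3,4,6]], Leaf [0,2,1,4,3,5,6]),
    ([[0,1,2],[0,1,3],[0,2,4],[1,4,5],[2,3,5],[3,4,5]], Leaf [0,2,1,4,3,5,6]),
    ([[0,1,2],[0,1,3],[0,2,4],[1,3,5],[2,5,6],[3,4,6]], Branch 4 [([4,5,6],[0,1,2,3,4,5,6],20)]),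
    ([[0,1,2],[0,1,3],[0,2,4],[1,3,5],[2,4,6],[3,5,6]], Branch 4 [([4,5,6],[0,1,2,3,4,5,6],20)]),
    ([[0,1,2],[0,1,3],[0,2,4],[1,3,5],[2,4,5],[3,5,6]], Branch 4 []),
    ([[0,1,2],[0,1,3],[0,2,4],[1,3,5],[2,4,5],[3,4,6]], Leaf [0,2,1,4,3,5,6]),
    ([[0,1,2],[0,1,3],[0,2,4],[1,3,5],[2,4,5],[3,4,5]], Leaf [0,2,1,4,3,5,6]),
    ([[0,1,2],[0,1,3],[0,2,4],[1,3,5],[2,3,6],[4,5,6]], Branch 4 []),
    ([[0,1,2],[0,1,3],[0,2,4],[1,3,4],[2,5,6],[3,5,6]], Leaf [1,0,3,2,4,5,6]),
    ([[0,1,2],[0,1,3],[0,2,4],[1,3,4],[2,4,5],[3,5,6]], Branch 5 []),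
    ([[0,1,2],[0,1,3],[0,2,4],[1,2,5],[3,4,6],[3,5,6]], Branch 4 [([4,5,6],[4,5,6,1,2,3,0],26)]),
    ([[0,1,2],[0,1,3],[0,2,4],[1,2,5],[3,4,5],[3,4,6]], Leaf [0,2,1,4,3,5,6]),
    ([[0,1,2],[0,1,3],[0,2,3],[1,4,5],[2,4,6],[3,5,6]], Branch 4 [([4,5,6],[0,1,2,3,4,5,6],28)]),
    ([[0,1,2],[0,1,3],[0,2,3],[1,4,5],[2,4,5],[3,4,6]], Leaf [0,2,1,3,4,5,6]),
    ([[0,1,2],[0,3,4],[0,5,6],[1,3,5],[1,4,6]], Branch 3 [([2,3,4],[2,4,3,0,1,5,6],23),
    ([2,3,5],[4,2,3,0,5,1,6],23),([2,3,6],[0,1,2,3,4,5,6],29),([3,4,5],[3,4,6,0,1,2,5],13),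
    ([3,4,6],[3,4,6,1,0,5,2],13),([3,5,6],[3,4,6,2,5,0,1],13)]),
    ([[0,1,2],[0,1,3],[0,4,5],[2,3,6],[2,4,5]], Branch 1 [([1,3,4],[1,0,3,2,4,5,6],16),
    ([1,3,5],[1,0,3,2,5,4,6],16),([1,3,6],[2,0,4,1,5,6,3],28),([1,4,5],[2,3,4,5,0,1,6],29),
    ([1,4,6],[1,0,2,3,4,6,5],25),([1,5,6],[1,0,2,3,6,4,5],25)]),
    ([[0,1,2],[0,1,3],[0,4,5],[2,3,4],[2,5,6]], Branch 1 [([1,3,4],[2,0,4,1,3,5,6],28),
    ([1,3,5],[1,0,3,2,5,4,6],15),([1,3,6],[2,0,4,1,5,6,3],20),([1,4,5],[0,1,2,3,4,5,6],24),
    ([1,4,6],[0,1,2,3,4,5,6],25),([1,5,6],[0,1,2,3,5,4,6],26)]),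
    ([[0,1,2],[0,1,3],[0,2,4],[1,4,5],[3,4,6]], Branch 2 [([2,3,5],[0,1,2,3,4,5,6],16),
    ([2,3,6],[0,2,1,4,3,6,5],18),([2,5,6],[0,1,2,3,4,5,6],21)]),
    ([[0,1,2],[0,1,3],[0,2,4],[1,3,4],[4,5,6]], Branch 2 [([2,3,5],[0,1,2,3,4,5,6],30),
    ([2,3,6],[0,1,2,3,4,6,5],30),([2,5,6],[0,1,2,3,4,5,6],31)]),
    ([[0,1,2],[0,1,3],[0,1,4],[2,3,5],[2,4,6]], Leaf [1,0,2,3,4,5,6]),
    ([[0,1,2],[0,1,3],[0,1,4],[2,3,4],[2,5,6]], Leaf [1,0,2,3,4,5,6]),
    ([[0,1,2],[0,1,3],[0,2,4],[3,4,5],[3,4,6]], Branch 1 [([1,2,5],[0,1,2,3,4,5,6],9),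
    ([1,2,6],[0,1,2,3,4,6,5],9),([1,5,6],[0,1,2,3,4,5,6],32)]),
    ([[0,1,2],[0,1,3],[0,4,5],[1,4,6],[2,4,5]], Branch 2 [([2,3,5],[4,5,1,3,2,0,6],25),
    ([2,3,6],[1,0,2,3,4,6,5],32),([2,5,6],[3,5,2,6,1,0,4],22)]),
    ([[0,1,2],[0,1,3],[0,4,5],[1,4,6],[2,3,4]], Branch 2 [([2,3,5],[4,5,0,1,2,3,6],31),
    ([2,3,6],[5,4,0,1,2,6,3],31),([2,5,6],[0,1,2,3,4,5,6],32)]),
    ([[0,1,2],[0,1,3],[0,2,4],[1,5,6],[2,5,6]], Branch 5 [([3,4,5],[0,1,2,3,4,5,6],30),
    ([3,5,6],[5,2,3,4,6,0,1],31),([4,5,6],[5,3,2,6,4,0,1],31)]),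
    ([[0,1,2],[0,1,3],[0,2,4],[1,4,5],[2,5,6]], Branch 4 [([3,4,5],[0,1,2,3,4,5,6],28),
    ([3,4,6],[0,1,2,3,4,5,6],29),([4,5,6],[0,1,2,3,4,5,6],30)]),
    ([[0,1,2],[0,1,3],[0,2,4],[1,4,5],[2,3,6]], Branch 3 [([3,4,5],[0,1,2,3,4,5,6],27),
    ([3,4,6],[0,2,1,4,3,6,5],27),([3,5,6],[0,1,2,3,4,5,6],28)]),
    ([[0,1,2],[0,1,3],[0,2,4],[1,4,5],[2,3,5]], Branch 3 [([3,4,5],[0,1,2,3,4,5,6],25),
    ([3,4,6],[0,1,2,3,4,5,6],26),([3,5,6],[0,1,2,3,4,5,6],27)]),
    ([[0,1,2],[0,1,3],[0,2,4],[1,3,5],[2,5,6]], Branch 3 [([3,4,5],[1,0,3,2,5,4,6],22),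
    ([3,4,6],[0,1,2,3,4,5,6],25),([3,5,6],[3,1,5,0,6,2,4],23)]),
    ([[0,1,2],[0,1,3],[0,2,4],[1,3,5],[2,4,6]], Branch 3 [([3,4,5],[1,0,3,2,5,4,6],24),
    ([3,4,6],[1,3,0,5,2,6,4],24),([3,5,6],[0,1,2,3,4,5,6],25)]),
    ([[0,1,2],[0,1,3],[0,2,4],[1,3,5],[2,4,5]], Branch 3 [([3,4,5],[0,1,2,3,4,5,6],23),
    ([3,4,6],[0,1,2,3,4,5,6],24),([3,5,6],[0,1,2,3,4,5,6],25)]),
    ([[0,1,2],[0,1,3],[0,2,4],[1,3,5],[2,3,6]], Branch 4 [([4,5,6],[0,1,2,3,4,5,6],23)]),
    ([[0,1,2],[0,1,3],[0,2,4],[1,3,4],[2,5,6]], Branch 3 [([3,4,5],[1,0,3,2,4,5,6],22),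
    ([3,4,6],[1,0,3,2,4,6,5],22),([3,5,6],[0,1,2,3,4,5,6],23)]),
    ([[0,1,2],[0,1,3],[0,2,4],[1,3,4],[2,4,5]], Branch 3 [([3,5,6],[0,1,2,3,4,5,6],23)]),
    ([[0,1,2],[0,1,3],[0,2,4],[1,3,4],[2,3,5]], Leaf [1,0,3,2,4,5,6]),
    ([[0,1,2],[0,1,3],[0,2,4],[1,3,4],[2,3,4]], Leaf [0,2,1,4,3,5,6]),
    ([[0,1,2],[0,1,3],[0,2,4],[1,2,5],[3,4,6]], Branch 3 [([3,4,5],[0,1,2,3,4,5,6],24),
    ([3,5,6],[0,1,2,3,4,5,6],25)]),
    ([[0,1,2],[0,1,3],[0,2,4],[1,2,5],[3,4,5]], Branch 3 [([3,4,6],[0,1,2,3,4,5,6],25),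
    ([3,5,6],[1,0,2,3,5,4,6],25)]),
    ([[0,1,2],[0,1,3],[0,2,3],[1,4,5],[2,4,6]], Branch 3 [([3,4,5],[0,1,3,2,4,5,6],24),
    ([3,4,6],[0,3,1,2,4,6,5],24),([3,5,6],[0,1,2,3,4,5,6],25)]),
    ([[0,1,2],[0,1,3],[0,2,3],[1,4,5],[2,4,5]], Leaf [0,2,1,3,4,5,6]),
    ([[0,1,2],[0,1,3],[0,2,3],[1,2,4],[3,5,6]], Leaf [0,2,1,3,4,5,6]),
    ([[0,1,2],[0,1,3],[0,2,3],[1,2,4],[3,4,5]], Leaf [0,2,1,3,4,5,6]),
    ([[0,1,2],[0,3,4],[0,5,6],[1,3,5]], Branch 1 [([1,2,3],[4,0,2,1,5,3,6],24),([1,2,4],[2,0,1,4,3,5,6],25),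
    ([1,2,5],[4,0,2,3,6,1,5],24),([1,2,6],[2,0,1,5,6,4,3],25),([1,3,4],[4,1,5,0,2,3,6],24),
    ([1,3,6],[4,0,5,1,6,2,3],18),([1,4,5],[4,0,5,2,3,1,6],18),([1,4,6],[0,1,2,3,4,5,6],27),
    ([1,5,6],[4,1,5,3,6,0,2],24)]),
    ([[0,1,2],[0,1,3],[2,3,4],[2,5,6]], Branch 0 [([0,1,4],[0,1,2,3,4,5,6],22),([0,1,5],[0,1,2,3,5,4,6],23),
    ([0,1,6],[0,1,2,3,5,6,4],23),([0,3,4],[0,2,4,1,3,5,6],24),([0,3,5],[0,2,4,1,5,3,6],25),
    ([0,3,6],[0,2,4,1,5,6,3],25),([0,4,5],[0,1,2,3,4,5,6],26),([0,4,6],[0,1,2,3,4,6,5],26),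
    ([0,5,6],[0,1,2,3,6,4,5],27)]),
    ([[0,1,2],[0,1,3],[0,4,5],[1,4,6]], Branch 4 [([2,3,4],[0,1,2,3,4,5,6],20),([2,4,5],[0,1,2,3,4,5,6],21),
    ([2,4,6],[1,0,2,3,4,6,5],21),([3,4,5],[0,1,3,2,4,5,6],21),([3,4,6],[1,0,3,2,4,6,5],21),
    ([4,5,6],[3,4,5,6,0,1,2],22)]),
    ([[0,1,2],[0,1,3],[0,4,5],[1,4,5]], Leaf [1,0,2,3,4,5,6]),
    ([[0,1,2],[0,1,3],[0,2,4],[1,5,6]], Branch 2 [([2,3,4],[0,2,1,4,3,5,6],13),([2,3,5],[0,2,1,4,3,5,6],20),
    ([2,3,6],[0,2,1,4,3,6,5],20),([2,4,5],[0,2,1,4,3,5,6],17),([2,4,6],[0,2,1,4,3,6,5],17),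
    ([2,5,6],[0,1,2,3,4,5,6],21)]),
    ([[0,1,2],[0,1,3],[0,2,4],[1,4,5]], Branch 2 [([2,3,4],[0,2,1,4,3,5,6],12),([2,3,5],[0,1,2,3,4,5,6],19),
    ([2,3,6],[0,1,2,3,4,5,6],20),([2,4,5],[2,4,0,5,1,3,6],13),([2,4,6],[0,2,1,4,3,6,5],15),
    ([2,5,6],[0,1,2,3,4,5,6],21)]),
    ([[0,1,2],[0,1,3],[0,2,4],[1,3,5]], Branch 2 [([2,3,4],[0,2,1,4,3,5,6],14),([2,3,5],[2,0,4,1,5,3,6],14),
    ([2,3,6],[0,1,2,3,4,5,6],16),([2,4,5],[0,1,2,3,4,5,6],17),([2,4,6],[0,1,2,3,4,5,6],18),
    ([2,5,6],[0,1,2,3,4,5,6],19)]),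
    ([[0,1,2],[0,1,3],[0,2,4],[1,3,4]], Branch 2 [([2,3,4],[0,1,2,3,4,5,6],13),([2,3,5],[0,1,2,3,4,5,6],14),
    ([2,3,6],[0,1,2,3,4,6,5],14),([2,4,5],[0,1,2,3,4,5,6],15),([2,4,6],[0,1,2,3,4,6,5],15),
    ([2,5,6],[0,1,2,3,4,5,6],16)]),
    ([[0,1,2],[0,1,3],[0,2,4],[1,2,5]], Branch 3 [([3,4,5],[0,1,2,3,4,5,6],12),([3,4,6],[0,1,2,3,4,5,6],13),
    ([3,5,6],[1,0,2,3,5,4,6],13)]),
    ([[0,1,2],[0,1,3],[0,2,3],[1,4,5]], Branch 2 [([2,3,4],[0,3,1,2,4,5,6],9),([2,3,5],[0,3,1,2,5,4,6],9),
    ([2,3,6],[0,3,1,2,5,6,4],10),([2,4,5],[0,1,2,3,4,5,6],11),([2,4,6],[0,1,2,3,4,5,6],12),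
    ([2,5,6],[0,1,2,3,5,4,6],12)]),
    ([[0,1,2],[0,1,3],[0,2,3],[1,2,4]], Leaf [0,2,1,3,4,5,6]),
    ([[0,1,2],[0,1,3],[0,2,3],[1,2,3]], Leaf [0,1,3,2,4,5,6]),
    ([[0,1,2],[0,3,4],[0,5,6]], Branch 1 [([1,2,3],[2,0,1,3,4,5,6],10),([1,2,4],[2,0,1,4,3,5,6],10),
    ([1,2,5],[2,0,1,5,6,3,4],10),([1,2,6],[2,0,1,5,6,4,3],10),([1,3,4],[2,3,4,0,1,5,6],10),
    ([1,3,5],[0,1,2,3,4,5,6],11),([1,3,6],[0,1,2,3,4,6,5],11),([1,4,5],[0,1,2,4,3,5,6],11),
    ([1,4,6],[0,1,2,4,3,6,5],11),([1,5,6],[2,3,4,5,6,0,1],10)]),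
    ([[0,1,2],[0,1,3],[0,4,5]], Branch 1 [([1,2,3],[1,0,2,3,4,5,6],3),([1,2,4],[1,0,2,3,4,5,6],7),
    ([1,2,5],[1,0,2,3,5,4,6],7),([1,2,6],[1,0,2,3,5,6,4],8),([1,3,4],[1,0,3,2,4,5,6],7),
    ([1,3,5],[1,0,3,2,5,4,6],7),([1,3,6],[1,0,3,2,5,6,4],8),([1,4,5],[0,1,2,3,4,5,6],9),
    ([1,4,6],[0,1,2,3,4,5,6],10),([1,5,6],[0,1,2,3,5,4,6],10)]),
    ([[0,1,2],[0,1,3],[0,2,4]], Branch 1 [([1,2,3],[1,0,2,3,4,5,6],3),([1,2,4],[1,2,0,4,3,5,6],3),
    ([1,2,5],[0,1,2,3,4,5,6],5),([1,2,6],[0,1,2,3,4,6,5],5),([1,3,4],[0,1,2,3,4,5,6],6),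
    ([1,3,5],[0,1,2,3,4,5,6],7),([1,3,6],[0,1,2,3,4,6,5],7),([1,4,5],[0,1,2,3,4,5,6],8),
    ([1,4,6],[0,1,2,3,4,6,5],8),([1,5,6],[0,1,2,3,4,5,6],9)]),
    ([[0,1,2],[0,1,3],[0,2,3]], Branch 1 [([1,2,3],[0,1,2,3,4,5,6],3),([1,2,4],[0,1,2,3,4,5,6],4),
    ([1,2,5],[0,1,2,3,5,4,6],4),([1,2,6],[0,1,2,3,5,6,4],4),([1,3,4],[0,1,3,2,4,5,6],4),
    ([1,3,5],[0,1,3,2,5,4,6],4),([1,3,6],[0,1,3,2,5,6,4],4),([1,4,5],[0,1,2,3,4,5,6],5),
    ([1,4,6],[0,1,2,3,4,6,5],5),([1,5,6],[0,1,2,3,6,4,5],5)]),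
    ([[0,1,2],[0,1,3],[0,1,4]], Leaf [1,0,2,3,4,5,6]),
    ([[0,1,2],[0,3,4]], Branch 0 [([0,1,3],[0,1,3,2,4,5,6],2),([0,1,4],[0,1,3,4,2,5,6],2),
    ([0,1,5],[0,1,2,4,5,3,6],3),([0,1,6],[0,1,2,4,5,6,3],3),([0,2,3],[0,3,1,2,4,5,6],2),
    ([0,2,4],[0,3,1,4,2,5,6],2),([0,2,5],[0,2,1,4,5,3,6],3),([0,2,6],[0,2,1,4,5,6,3],3),
    ([0,3,5],[0,4,5,1,2,3,6],3),([0,3,6],[0,4,5,1,2,6,3],3),([0,4,5],[0,4,5,2,1,3,6],3),
    ([0,4,6],[0,4,5,2,1,6,3],3),([0,5,6],[0,1,2,3,4,5,6],4)]),
    ([[0,1,2],[0,1,3]], Branch 0 [([0,1,4],[0,1,2,3,4,5,6],1),([0,1,5],[0,1,2,3,5,4,6],1),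
    ([0,1,6],[0,1,2,3,5,6,4],1),([0,2,3],[0,1,2,3,4,5,6],2),([0,2,4],[0,1,2,3,4,5,6],3),
    ([0,2,5],[0,1,2,3,5,4,6],3),([0,2,6],[0,1,2,3,5,6,4],3),([0,3,4],[0,1,3,2,4,5,6],3),
    ([0,3,5],[0,1,3,2,5,4,6],3),([0,3,6],[0,1,3,2,5,6,4],3),([0,4,5],[0,1,2,3,4,5,6],4),
    ([0,4,6],[0,1,2,3,4,6,5],4),([0,5,6],[0,1,2,3,6,4,5],4)]),
    ([[0,1,2]], Branch 0 [([0,1,3],[0,1,2,3,4,5,6],0),([0,1,4],[0,1,2,4,3,5,6],0),([0,1,5],[0,1,2,4,5,3,6],0),
    ([0,1,6],[0,1,2,4,5,6,3],0),([0,2,3],[0,2,1,3,4,5,6],0),([0,2,4],[0,2,1,4,3,5,6],0),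
    ([0,2,5],[0,2,1,4,5,3,6],0),([0,2,6],[0,2,1,4,5,6,3],0),([0,3,4],[0,1,2,3,4,5,6],1),
    ([0,3,5],[0,1,2,3,5,4,6],1),([0,3,6],[0,1,2,3,5,6,4],1),([0,4,5],[0,1,2,5,3,4,6],1),
    ([0,4,6],[0,1,2,5,3,6,4],1),([0,5,6],[0,1,2,5,6,3,4],1)]),
    ([], Branch 0 [([0,1,2],[0,1,2,3,4,5,6],0),([0,1,3],[0,1,3,2,4,5,6],0),([0,1,4],[0,1,3,4,2,5,6],0),
    ([0,1,5],[0,1,3,4,5,2,6],0),([0,1,6],[0,1,3,4,5,6,2],0),([0,2,3],[0,3,1,2,4,5,6],0),
    ([0,2,4],[0,3,1,4,2,5,6],0),([0,2,5],[0,3,1,4,5,2,6],0),([0,2,6],[0,3,1,4,5,6,2],0),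
    ([0,3,4],[0,3,4,1,2,5,6],0),([0,3,5],[0,3,4,1,5,2,6],0),([0,3,6],[0,3,4,1,5,6,2],0),
    ([0,4,5],[0,3,4,5,1,2,6],0),([0,4,6],[0,3,4,5,1,6,2],0),([0,5,6],[0,3,4,5,6,1,2],0)])]"

definition tree_2_3 :: "(nat list list \<times> certificate) list" where
  "tree_2_3 = [
    ([[0,3,6],[0,4,7],[1,3,8],[1,5,7],[2,4,8],[2,5,6]], Leaf [0,2,1,4,3,5,7,6,8]),
    ([[0,3,6],[0,4,7],[1,3,7],[1,5,8],[2,4,8],[2,5,6]], Leaf [2,1,0,5,4,3,6,8,7]),
    ([[0,3,6],[0,3,7],[1,4,6],[1,5,8],[2,4,8],[2,5,7]], Leaf [0,2,1,3,5,4,7,6,8]),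
    ([[0,3,6],[0,3,7],[1,4,6],[1,5,7],[2,4,8],[2,5,8]], Leaf [0,1,2,3,5,4,7,6,8]),
    ([[0,3,6],[0,3,7],[1,4,6],[1,4,8],[2,5,7],[2,5,8]], Leaf [0,2,1,3,5,4,7,6,8]),
    ([[0,3,6],[0,4,7],[1,3,8],[1,5,7],[2,4,8]], Branch 2 [([2,5,6],[0,1,2,3,4,5,6,7,8],4)]),
    ([[0,3,6],[0,4,7],[1,3,7],[1,5,8],[2,4,8]], Branch 2 [([2,5,6],[0,1,2,3,4,5,6,7,8],4)]),
    ([[0,3,6],[0,4,7],[1,3,7],[1,4,8],[2,5,6]], Branch 2 [([2,5,8],[1,2,0,4,5,3,6,8,7],4)]),
    ([[0,3,6],[0,3,7],[1,4,6],[1,5,8],[2,4,8]], Branch 2 [([2,5,7],[0,1,2,3,4,5,6,7,8],5)]),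
    ([[0,3,6],[0,3,7],[1,4,6],[1,5,7],[2,4,8]], Branch 2 [([2,5,8],[0,1,2,3,4,5,6,7,8],5)]),
    ([[0,3,6],[0,3,7],[1,4,6],[1,4,8],[2,5,7]], Branch 2 [([2,5,8],[0,1,2,3,4,5,6,7,8],5)]),
    ([[0,3,6],[0,4,7],[1,3,8],[2,5,6]], Branch 1 [([1,4,7],[6,7,8,1,0,2,4,3,5],1),
    ([1,4,8],[1,0,2,6,7,8,4,5,3],1),([1,5,7],[1,0,2,3,5,4,8,7,6],5),([1,5,8],[4,3,5,6,8,7,1,2,0],1)]),
    ([[0,3,6],[0,4,7],[1,3,7],[1,5,8]], Branch 4 [([2,4,6],[7,6,8,0,1,2,4,3,5],4),
    ([2,4,8],[0,1,2,3,4,5,6,7,8],5)]),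
    ([[0,3,6],[0,4,7],[1,3,7],[1,4,8]], Branch 6 [([2,5,6],[0,1,2,3,4,5,6,7,8],5)]),
    ([[0,3,6],[0,4,7],[1,3,7],[1,4,6]], Leaf [0,1,2,4,3,5,7,6,8]),
    ([[0,3,6],[0,3,7],[1,4,6],[1,5,8]], Branch 4 [([2,4,7],[3,4,5,0,1,2,6,7,8],5),
    ([2,4,8],[0,1,2,3,4,5,6,7,8],6)]),
    ([[0,3,6],[0,3,7],[1,4,6],[1,5,7]], Branch 4 [([2,4,8],[0,1,2,3,4,5,6,7,8],6)]),
    ([[0,3,6],[0,3,7],[1,4,6],[1,4,8]], Branch 7 [([2,5,7],[0,1,2,3,4,5,6,7,8],6)]),
    ([[0,3,6],[0,3,7],[1,4,6],[1,4,7]], Leaf [0,1,2,3,4,5,7,6,8]),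
    ([[0,3,6],[0,4,7],[1,3,8]], Branch 6 [([1,4,6],[0,1,2,4,3,5,7,6,8],5),([1,5,6],[1,0,2,3,5,4,7,8,6],6),
    ([2,4,6],[3,5,4,1,0,2,7,6,8],6),([2,5,6],[0,1,2,3,4,5,6,7,8],7)]),
    ([[0,3,6],[0,4,7],[1,3,7]], Branch 1 [([1,4,6],[0,1,2,3,4,5,6,7,8],5),([1,4,8],[0,1,2,3,4,5,6,7,8],6),
    ([1,5,6],[0,1,2,7,6,8,4,3,5],6),([1,5,8],[0,1,2,3,4,5,6,7,8],7)]),
    ([[0,3,6],[0,3,7],[1,4,6]], Branch 1 [([1,4,7],[0,1,2,3,4,5,6,7,8],2),([1,4,8],[0,1,2,3,4,5,6,7,8],3),
    ([1,5,7],[0,1,2,3,4,5,6,7,8],4),([1,5,8],[0,1,2,3,4,5,6,7,8],5)]),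
    ([[0,3,6],[0,4,7]], Branch 3 [([1,3,6],[6,7,8,0,1,2,3,4,5],0),([1,3,7],[0,1,2,3,4,5,6,7,8],1),
    ([1,3,8],[0,1,2,3,4,5,6,7,8],2),([2,3,6],[6,8,7,0,1,2,3,4,5],0),([2,3,7],[0,2,1,3,4,5,6,7,8],1),
    ([2,3,8],[0,2,1,3,4,5,6,7,8],2)]),
    ([[0,3,6],[0,3,7]], Branch 6 [([1,4,6],[0,1,2,3,4,5,6,7,8],1),([1,5,6],[0,1,2,3,5,4,6,7,8],1),
    ([2,4,6],[0,2,1,3,4,5,6,7,8],1),([2,5,6],[0,2,1,3,5,4,6,7,8],1)]),
    ([[0,3,6]], Branch 0 [([0,3,7],[0,1,2,3,4,5,6,7,8],0),([0,3,8],[0,1,2,3,4,5,6,8,7],0),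
    ([0,4,6],[0,1,2,6,7,8,3,4,5],0),([0,4,7],[0,1,2,3,4,5,6,7,8],1),([0,4,8],[0,1,2,3,4,5,6,8,7],1),
    ([0,5,6],[0,1,2,6,8,7,3,4,5],0),([0,5,7],[0,1,2,3,5,4,6,7,8],1),([0,5,8],[0,1,2,3,5,4,6,8,7],1)]),
    ([], Branch 0 [([0,3,6],[0,1,2,3,4,5,6,7,8],0),([0,3,7],[0,1,2,3,4,5,7,6,8],0),
    ([0,3,8],[0,1,2,3,4,5,7,8,6],0),([0,4,6],[0,1,2,4,3,5,6,7,8],0),([0,4,7],[0,1,2,4,3,5,7,6,8],0),
    ([0,4,8],[0,1,2,4,3,5,7,8,6],0),([0,5,6],[0,1,2,4,5,3,6,7,8],0),([0,5,7],[0,1,2,4,5,3,7,6,8],0),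
    ([0,5,8],[0,1,2,4,5,3,7,8,6],0)])]"

definition tree_4_2 :: "(nat list list \<times> certificate) list" where
  "tree_4_2 = [
    ([[0,2,4,6],[0,2,5,7],[0,3,4,7],[0,3,5,6],[1,2,4,7],[1,2,5,6],[1,3,4,6],[1,3,5,7]], Leaf [0,1,2,3,5,4,7,6]),
    ([[0,2,4,6],[0,2,4,7],[0,3,5,6],[0,3,5,7],[1,2,5,6],[1,2,5,7],[1,3,4,6],[1,3,4,7]], Leaf [0,1,2,3,4,5,7,6]),
    ([[0,2,4,6],[0,2,4,7],[0,2,5,6],[0,3,5,7],[1,2,5,7],[1,3,4,6],[1,3,4,7],[1,3,5,6]], Leaf [1,0,3,2,4,5,6,7]),
    ([[0,2,4,6],[0,2,4,7],[0,2,5,6],[0,3,4,7],[1,2,5,7],[1,3,4,6],[1,3,5,6],[1,3,5,7]], Leaf [1,0,3,2,5,4,6,7]),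
    ([[0,2,4,6],[0,2,4,7],[0,2,5,6],[0,3,4,7],[1,2,5,6],[1,3,4,7],[1,3,5,6],[1,3,5,7]], Leaf [1,0,3,2,5,4,7,6]),
    ([[0,2,4,6],[0,2,4,7],[0,2,5,6],[0,3,4,6],[1,2,5,7],[1,3,4,7],[1,3,5,6],[1,3,5,7]], Leaf [1,0,3,2,5,4,7,6]),
    ([[0,2,4,6],[0,2,4,7],[0,2,5,6],[0,2,5,7],[1,3,4,6],[1,3,4,7],[1,3,5,6],[1,3,5,7]], Leaf [0,1,2,3,4,5,7,6]),
    ([[0,2,4,6],[0,2,4,7],[0,2,5,6],[0,3,5,7],[1,2,5,7],[1,3,4,7],[1,3,5,6]], Branch 1 [([1,3,4,6],[0,1,2,3,4,5,6,
    7],4)]),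
    ([[0,2,4,6],[0,2,5,7],[0,3,4,7],[0,3,5,6],[1,2,4,7],[1,2,5,6],[1,3,4,6]], Branch 1 [([1,3,5,7],[0,1,2,3,4,5,6,
    7],7)]),
    ([[0,2,4,6],[0,2,4,7],[0,3,5,6],[0,3,5,7],[1,2,5,6],[1,2,5,7],[1,3,4,6]], Branch 1 [([1,3,4,7],[0,1,2,3,4,5,6,
    7],7)]),
    ([[0,2,4,6],[0,2,4,7],[0,2,5,6],[0,3,5,7],[1,2,5,7],[1,3,4,6],[1,3,5,7]], Branch 1 []),
    ([[0,2,4,6],[0,2,4,7],[0,2,5,6],[0,3,5,7],[1,2,5,7],[1,3,4,6],[1,3,4,7]], Branch 1 [([1,3,5,6],[0,1,2,3,4,5,6,
    7],8)]),
    ([[0,2,4,6],[0,2,4,7],[0,2,5,6],[0,3,4,7],[1,2,5,7],[1,3,4,6],[1,3,5,6]], Branch 1 [([1,3,5,7],[0,1,2,3,4,5,6,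
    7],8)]),
    ([[0,2,4,6],[0,2,4,7],[0,2,5,6],[0,3,4,7],[1,2,5,6],[1,3,4,7],[1,3,5,6]], Branch 1 [([1,3,5,7],[0,1,2,3,4,5,6,
    7],8)]),
    ([[0,2,4,6],[0,2,4,7],[0,2,5,6],[0,3,4,7],[1,2,5,6],[1,3,4,6],[1,3,5,7]], Branch 1 []),
    ([[0,2,4,6],[0,2,4,7],[0,2,5,6],[0,3,4,6],[1,2,5,7],[1,3,4,7],[1,3,5,6]], Branch 1 [([1,3,5,7],[0,1,2,3,4,5,6,
    7],9)]),
    ([[0,2,4,6],[0,2,4,7],[0,2,5,6],[0,3,4,6],[1,2,4,7],[1,3,5,6],[1,3,5,7]], Branch 1 []),
    ([[0,2,4,6],[0,2,4,7],[0,2,5,6],[0,2,5,7],[1,3,4,6],[1,3,4,7],[1,3,5,6]], Branch 1 [([1,3,5,7],[0,1,2,3,4,5,6,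
    7],10)]),
    ([[0,2,4,6],[0,2,5,7],[0,3,4,7],[0,3,5,6],[1,2,4,7],[1,2,5,6]], Branch 4 [([1,3,4,6],[0,1,2,3,4,5,6,7],9),
    ([1,3,4,7],[5,4,7,6,0,1,3,2],10)]),
    ([[0,2,4,6],[0,2,4,7],[0,3,5,6],[0,3,5,7],[1,2,5,6],[1,3,4,6]], Branch 2 [([1,2,4,7],[4,5,0,1,2,3,7,6],7),
    ([1,2,5,7],[0,1,2,3,4,5,6,7],9)]),
    ([[0,2,4,6],[0,2,4,7],[0,3,5,6],[0,3,5,7],[1,2,5,6],[1,2,5,7]], Branch 6 [([1,3,4,6],[0,1,2,3,4,5,6,7],10)]),
    ([[0,2,4,6],[0,2,4,7],[0,2,5,6],[0,3,5,7],[1,3,4,6],[1,3,4,7]], Branch 2 [([1,2,5,6],[2,3,0,1,6,7,4,5],8),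
    ([1,2,5,7],[0,1,2,3,4,5,6,7],9)]),
    ([[0,2,4,6],[0,2,4,7],[0,2,5,6],[0,3,4,7],[1,2,5,7],[1,3,5,7]], Branch 4 [([1,3,4,6],[0,1,4,5,2,3,7,6],9)]),
    ([[0,2,4,6],[0,2,4,7],[0,2,5,6],[0,3,5,7],[1,2,5,7],[1,3,5,7]], Branch 1 [([1,3,4,6],[0,1,2,3,4,5,6,7],12)]),
    ([[0,2,4,6],[0,2,4,7],[0,2,5,6],[0,3,5,7],[1,2,5,7],[1,3,4,7]], Branch 4 [([1,3,4,6],[0,1,2,3,4,5,6,7],12)]),
    ([[0,2,4,6],[0,2,4,7],[0,2,5,6],[0,3,4,7],[1,2,5,7],[1,3,4,6]], Branch 6 [([1,3,5,6],[0,1,2,3,4,5,6,7],12)]),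
    ([[0,2,4,6],[0,2,4,7],[0,2,5,6],[0,3,4,7],[1,2,5,6],[1,3,4,7]], Branch 6 [([1,3,5,6],[0,1,2,3,4,5,6,7],12)]),
    ([[0,2,4,6],[0,2,4,7],[0,2,5,6],[0,3,4,7],[1,2,5,6],[1,3,4,6]], Branch 1 [([1,3,5,7],[0,1,2,3,4,5,6,7],12)]),
    ([[0,2,4,6],[0,2,4,7],[0,2,5,6],[0,3,4,6],[1,2,5,7],[1,3,4,7]], Branch 6 [([1,3,5,6],[0,1,2,3,4,5,6,7],12)]),
    ([[0,2,4,6],[0,2,4,7],[0,2,5,6],[0,3,4,6],[1,2,4,7],[1,3,5,6]], Branch 1 [([1,3,5,7],[0,1,2,3,4,5,6,7],12)]),
    ([[0,2,4,6],[0,2,4,7],[0,2,5,6],[0,3,4,6],[1,2,4,6],[1,3,5,7]], Branch 1 []),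
    ([[0,2,4,6],[0,2,4,7],[0,2,5,6],[0,2,5,7],[1,3,4,6],[1,3,4,7]], Branch 6 [([1,3,5,6],[0,1,2,3,4,5,6,7],13)]),
    ([[0,2,4,6],[0,2,5,7],[0,3,4,7],[0,3,5,6],[1,2,4,7]], Branch 2 [([1,2,4,6],[7,6,0,1,2,3,4,5],7),
    ([1,2,5,6],[0,1,2,3,4,5,6,7],13),([1,2,5,7],[7,6,0,1,5,4,3,2],7)]),
    ([[0,2,4,6],[0,2,4,7],[0,3,5,6],[1,2,5,6],[1,3,4,6]], Branch 0 [([0,2,5,7],[0,1,2,3,4,5,7,6],8),
    ([0,3,4,7],[0,1,4,5,2,3,7,6],8),([0,3,5,7],[0,1,2,3,4,5,6,7],13)]),
    ([[0,2,4,6],[0,2,4,7],[0,3,5,6],[0,3,5,7],[1,2,5,6]], Branch 2 [([1,2,4,6],[7,6,0,1,4,5,2,3],11),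
    ([1,2,4,7],[4,5,0,1,2,3,7,6],12),([1,2,5,7],[0,1,2,3,4,5,6,7],13)]),
    ([[0,2,4,6],[0,2,4,7],[0,2,5,6],[1,3,4,6],[1,3,4,7]], Branch 0 [([0,2,5,7],[0,1,2,3,4,5,6,7],3),
    ([0,3,5,6],[0,1,4,5,7,6,2,3],12),([0,3,5,7],[0,1,2,3,4,5,6,7],13)]),
    ([[0,2,4,6],[0,2,4,7],[0,2,5,6],[0,3,5,7],[1,2,5,7]], Branch 5 [([1,3,5,6],[0,1,2,3,6,7,4,5],11),
    ([1,3,5,7],[0,1,2,3,4,5,6,7],12)]),
    ([[0,2,4,6],[0,2,4,7],[0,2,5,6],[0,3,4,7],[1,2,5,7]], Branch 4 [([1,3,4,6],[0,1,2,3,4,5,6,7],11),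
    ([1,3,4,7],[0,1,4,5,2,3,7,6],9)]),
    ([[0,2,4,6],[0,2,4,7],[0,2,5,6],[0,3,4,7],[1,2,5,6]], Branch 4 [([1,3,4,6],[0,1,2,3,4,5,6,7],10),
    ([1,3,4,7],[0,1,2,3,4,5,6,7],11)]),
    ([[0,2,4,6],[0,2,4,7],[0,2,5,6],[0,3,4,6],[1,2,5,7]], Branch 4 [([1,3,4,6],[0,1,6,7,2,3,4,5],9),
    ([1,3,4,7],[0,1,2,3,4,5,6,7],10)]),
    ([[0,2,4,6],[0,2,4,7],[0,2,5,6],[0,3,4,6],[1,2,4,7]], Branch 6 [([1,3,5,6],[0,1,2,3,4,5,6,7],10)]),
    ([[0,2,4,6],[0,2,4,7],[0,2,5,6],[0,3,4,6],[1,2,4,6]], Branch 1 [([1,3,5,7],[0,1,2,3,4,5,6,7],10)]),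
    ([[0,2,4,6],[0,2,4,7],[0,2,5,6],[0,2,5,7],[1,3,4,6]], Branch 4 [([1,3,4,7],[0,1,2,3,4,5,6,7],10)]),
    ([[0,2,4,6],[0,2,5,7],[0,3,4,7],[0,3,5,6]], Branch 2 [([1,2,4,6],[6,7,0,1,2,3,4,5],9),
    ([1,2,4,7],[0,1,2,3,4,5,6,7],10),([1,2,5,6],[0,1,2,3,5,4,7,6],10),([1,2,5,7],[6,7,0,1,3,2,5,4],9)]),
    ([[0,2,4,6],[0,2,4,7],[0,3,5,6],[0,3,5,7]], Branch 2 [([1,2,4,6],[4,5,0,1,2,3,6,7],8),
    ([1,2,4,7],[4,5,0,1,2,3,7,6],8),([1,2,5,6],[0,1,2,3,4,5,6,7],9),([1,2,5,7],[0,1,2,3,4,5,7,6],9)]),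
    ([[0,2,4,6],[0,2,4,7],[0,2,5,6],[0,3,5,7]], Branch 2 [([1,2,4,6],[2,3,0,1,4,5,6,7],5),
    ([1,2,4,7],[2,3,0,1,4,5,6,7],7),([1,2,5,6],[2,3,0,1,6,7,4,5],7),([1,2,5,7],[0,1,2,3,4,5,6,7],8)]),
    ([[0,2,4,6],[0,2,4,7],[0,2,5,6],[0,3,4,7]], Branch 2 [([1,2,4,6],[2,3,0,1,4,5,6,7],5),
    ([1,2,4,7],[2,3,4,5,0,1,7,6],5),([1,2,5,6],[0,1,2,3,4,5,6,7],7),([1,2,5,7],[0,1,2,3,4,5,6,7],8)]),
    ([[0,2,4,6],[0,2,4,7],[0,2,5,6],[0,3,4,6]], Branch 2 [([1,2,4,6],[0,1,2,3,4,5,6,7],5),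
    ([1,2,4,7],[0,1,2,3,4,5,6,7],6),([1,2,5,6],[0,1,2,3,6,7,4,5],6),([1,2,5,7],[0,1,2,3,4,5,6,7],7)]),
    ([[0,2,4,6],[0,2,4,7],[0,2,5,6],[0,2,5,7]], Branch 4 [([1,3,4,6],[0,1,2,3,4,5,6,7],5),
    ([1,3,4,7],[0,1,2,3,4,5,7,6],5)]),
    ([[0,2,4,6],[0,2,5,7],[0,3,4,7]], Branch 0 [([0,2,4,7],[0,1,2,3,4,5,7,6],1),([0,2,5,6],[0,1,2,3,5,4,6,7],3),
    ([0,3,4,6],[0,1,5,4,2,3,6,7],3),([0,3,5,6],[0,1,2,3,4,5,6,7],5),([0,3,5,7],[0,1,5,4,7,6,3,2],3)]),
    ([[0,2,4,6],[0,2,4,7],[0,3,5,6]], Branch 0 [([0,2,5,6],[0,1,2,3,6,7,4,5],3),([0,2,5,7],[0,1,2,3,4,5,7,6],4),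
    ([0,3,4,6],[0,1,6,7,2,3,4,5],3),([0,3,4,7],[0,1,4,5,2,3,7,6],4),([0,3,5,7],[0,1,2,3,4,5,6,7],5)]),
    ([[0,2,4,6],[0,2,4,7],[0,2,5,6]], Branch 0 [([0,2,5,7],[0,1,2,3,4,5,6,7],2),([0,3,4,6],[0,1,2,3,4,5,6,7],3),
    ([0,3,4,7],[0,1,2,3,4,5,6,7],4),([0,3,5,6],[0,1,2,3,6,7,4,5],4),([0,3,5,7],[0,1,2,3,4,5,6,7],5)]),
    ([[0,2,4,6],[0,3,5,7]], Branch 0 [([0,2,4,7],[0,1,2,3,4,5,7,6],1),([0,2,5,6],[0,1,2,3,7,6,4,5],1),
    ([0,2,5,7],[0,1,6,7,3,2,5,4],1),([0,3,4,6],[0,1,7,6,2,3,4,5],1),([0,3,4,7],[0,1,3,2,6,7,5,4],1),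
    ([0,3,5,6],[0,1,3,2,5,4,6,7],1)]),
    ([[0,2,4,6],[0,2,5,7]], Branch 0 [([0,2,4,7],[0,1,2,3,4,5,7,6],1),([0,2,5,6],[0,1,2,3,5,4,6,7],1),
    ([0,3,4,6],[0,1,6,7,2,3,4,5],2),([0,3,4,7],[0,1,2,3,4,5,6,7],3),([0,3,5,6],[0,1,2,3,5,4,7,6],3),
    ([0,3,5,7],[0,1,6,7,3,2,5,4],2)]),
    ([[0,2,4,6],[0,2,4,7]], Branch 0 [([0,2,5,6],[0,1,2,3,4,5,6,7],2),([0,2,5,7],[0,1,2,3,4,5,7,6],2),
    ([0,3,4,6],[0,1,4,5,2,3,6,7],2),([0,3,4,7],[0,1,4,5,2,3,7,6],2),([0,3,5,6],[0,1,2,3,4,5,6,7],3),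
    ([0,3,5,7],[0,1,2,3,4,5,7,6],3)]),
    ([[0,2,4,6]], Branch 0 [([0,2,4,7],[0,1,2,3,4,5,6,7],0),([0,2,5,6],[0,1,2,3,6,7,4,5],0),
    ([0,2,5,7],[0,1,2,3,4,5,6,7],1),([0,3,4,6],[0,1,6,7,2,3,4,5],0),([0,3,4,7],[0,1,4,5,2,3,6,7],1),
    ([0,3,5,6],[0,1,4,5,6,7,2,3],1),([0,3,5,7],[0,1,2,3,4,5,6,7],2)]),
    ([], Branch 0 [([0,2,4,6],[0,1,2,3,4,5,6,7],0),([0,2,4,7],[0,1,2,3,4,5,7,6],0),
    ([0,2,5,6],[0,1,2,3,5,4,6,7],0),([0,2,5,7],[0,1,2,3,5,4,7,6],0),([0,3,4,6],[0,1,3,2,4,5,6,7],0),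
    ([0,3,4,7],[0,1,3,2,4,5,7,6],0),([0,3,5,6],[0,1,3,2,5,4,6,7],0),([0,3,5,7],[0,1,3,2,5,4,7,6],0)])]"

lemma not_realizable_3_6_2: "\<not> realizable 3 6 2"
proof (rule not_realizable_rows, rule always_symmetricI)
  show "check_tree (edge_lists 6 6 3 False) 6 6 3 [] tree_3_6" by code_simp
  show "([], last (map snd tree_3_6)) \<in> set tree_3_6" by (simp add: tree_3_6_def)
qed

lemma not_realizable_3_7_2: "\<not> realizable 3 7 2"
proof (rule not_realizable_rows, rule always_symmetricI)
  show "check_tree (edge_lists 7 7 3 False) 7 7 3 [] tree_3_7" by code_simp
  show "([], last (map snd tree_3_7)) \<in> set tree_3_7" by (simp add: tree_3_7_def)
qed

lemma not_realizable_2_3_3: "\<not> realizable 2 3 3"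
proof (rule not_realizable_transversal)
  have "check_tree (edge_lists 9 3 3 True) 9 3 2 [] tree_2_3" by code_simp
  moreover have "([], last (map snd tree_2_3)) \<in> set tree_2_3" by (simp add: tree_2_3_def)
  ultimately have "always_symmetric 9 3 2 (edge_sets 9 3 3 True) {}" by (rule always_symmetricI)
  then show "always_symmetric (3 * 3) 3 2 (edge_sets (3 * 3) 3 3 True) {}" by simp
qed simp

lemma not_realizable_4_2_4: "\<not> realizable 4 2 4"
proof (rule not_realizable_transversal)
  have "check_tree (edge_lists 8 2 4 True) 8 2 4 [] tree_4_2" by code_simp
  moreover have "([], last (map snd tree_4_2)) \<in> set tree_4_2" by (simp add: tree_4_2_def)
  ultimately have "always_symmetric 8 2 4 (edge_sets 8 2 4 True) {}" by (rule always_symmetricI)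
  then show "always_symmetric (2 * 4) 2 4 (edge_sets (2 * 4) 2 4 True) {}" by simp
qed simp

section \<open>Two-regular bipartite graphs\<close>

text \<open>A bijection of \<open>S\<close> compatible with agreement in each coordinate induces
  permutations of the labels; rigidity can thus be contradicted by a map of points.\<close>

lemma rigid_point_map:
  assumes S: "balanced a b k S" "rigid b k S" and a: "1 \<le> a"
    and g: "\<And>v. v \<in> S \<Longrightarrow> g v \<in> S" "inj_on g S"
    and pres: "\<And>c v w. c < k \<Longrightarrow> v \<in> S \<Longrightarrow> w \<in> S \<Longrightarrow> v c = w c \<Longrightarrow> g v c = g w c"
    and v: "v \<in> S"
  shows "g v = v"
proof -
  have Sc: "S \<subseteq> cube b k" using S(1) by (simp add: balanced_def)
  \<comment> \<open>By \<open>pres\<close> the value does not depend on the representative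
    chosen.\<close>
  define \<pi> where "\<pi> c j = (if j < b then g (SOME v. v \<in> S \<and> v c = j) c else j)" for c j
  have pi_eq: "\<pi> c (w c) = g w c" if c: "c < k" and w: "w \<in> S" for c w
  proof -
    define u where "u = (SOME u. u \<in> S \<and> u c = w c)"
    have "u \<in> S \<and> u c = w c" unfolding u_def by (rule someI[of _ w]) (use w in simp)
    then have "g u c = g w c" using pres[OF c _ w] by blast
    then show ?thesis using balanced_less[OF S(1) w c] by (simp add: \<pi>_def u_def)
  qed
  have surj: "g ` S = S" using g balanced_finite[OF S(1)] by (intro endo_inj_surj) auto
  have pi: "\<pi> c permutes {..<b}" if c: "c < k" for c
  proof (rule bij_imp_permutes)
    have "{..<b} \<subseteq> \<pi> c ` {..<b}"
    proof
      fix j assume "j \<in> {..<b}"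
      then obtain w where w: "w \<in> S" "w c = j" using balanced_slice_nonempty[OF S(1) a c, of j] by auto
      then obtain u where u: "u \<in> S" "w = g u" using surj by blast
      have "j = \<pi> c (u c)" using pi_eq[OF c u(1)] u(2) w(2) by simp
      then show "j \<in> \<pi> c ` {..<b}" using balanced_less[OF S(1) u(1) c] by blast
    qed
    then have "card {..<b} \<le> card (\<pi> c ` {..<b})" by (intro card_mono) auto
    then have inj: "inj_on (\<pi> c) {..<b}"
      by (metis card_image_le finite_lessThan le_antisym eq_card_imp_inj_on)
    have "\<pi> c ` {..<b} = {..<b}"
      using card_subset_eq[OF _ \<open>{..<b} \<subseteq> \<pi> c ` {..<b}\<close>] card_image[OF inj] by simp
    then show "bij_betw (\<pi> c) {..<b} {..<b}" using inj by (simp add: bij_betw_def)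
  qed (simp add: \<pi>_def)
  have act: "act k \<pi> w = g w" if w: "w \<in> S" for w
  proof (rule cube_eqI[of _ b k])
    have wc: "w \<in> cube b k" using Sc w by blast
    show "act k \<pi> w \<in> cube b k" by (rule act_in_cube[OF pi wc])
    show "g w \<in> cube b k" using g(1)[OF w] Sc by blast
    show "act k \<pi> w c = g w c" if "c < k" for c using pi_eq[OF that w] that by simp
  qed
  have "act k \<pi> ` S \<subseteq> S" using act g(1) by auto
  then have id: "\<pi> c = id" if "c < k" for c using rigidD[OF S(2), of \<pi> c] pi that by blast
  show ?thesis
  proof (rule cube_eqI[of _ b k])
    show "g v \<in> cube b k" "v \<in> cube b k" using g(1)[OF v] v Sc by blast+
    show "g v c = v c" if "c < k" for c using pi_eq[OF that v] id[OF that] by simp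
  qed
qed

text \<open>The union of two perfect matchings is a disjoint union of even cycles, hence bipartite.\<close>

lemma two_involutions_transversal:
  assumes fin: "finite S"
    and p: "\<And>z. z \<in> S \<Longrightarrow> p z \<in> S \<and> p (p z) = z \<and> p z \<noteq> z"
    and q: "\<And>z. z \<in> S \<Longrightarrow> q z \<in> S \<and> q (q z) = z \<and> q z \<noteq> z"
  shows "\<exists>C\<subseteq>S. (\<lambda>z. q (p z)) ` C = C \<and> C \<inter> p ` C = {} \<and> S \<subseteq> C \<union> p ` C"
proof -
  define f where "f z = q (p z)" for z
  \<comment> \<open>\<open>f\<close> moves two steps along a cycle. One class of each cycle is
    collected in a maximal \<open>f\<close>-invariant set disjoint from its \<open>p\<close>-image;
    if a point were still uncovered, its \<open>f\<close>-orbit could be added.\<close>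
  let ?F = "{C. C \<subseteq> S \<and> f ` C = C \<and> C \<inter> p ` C = {}}"
  have F: "finite ?F" by (rule finite_subset[of _ "Pow S"]) (use fin in auto)
  have "{} \<in> ?F" by simp
  then have "?F \<noteq> {}" by blast
  from finite_has_maximal[OF F this] obtain C where C: "C \<in> ?F" and max: "\<forall>D\<in>?F. C \<subseteq> D \<longrightarrow> C = D"
    by (rule bexE)
  have CS: "C \<subseteq> S" and Cf: "f ` C = C" and Cp: "C \<inter> p ` C = {}" using C by auto
  have fS: "f z \<in> S" if "z \<in> S" for z using p[OF that] q[of "p z"] by (simp add: f_def)
  have finj: "inj_on f S"
  proof (rule inj_onI)
    fix y z assume "y \<in> S" "z \<in> S" "f y = f z"
    then show "y = z" unfolding f_def using p q by metis
  qed
  have "S \<subseteq> C \<union> p ` C"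
  proof (rule ccontr)
    assume "\<not> ?thesis"
    then obtain x where x: "x \<in> S" "x \<notin> C" "x \<notin> p ` C" by blast
    let ?O = "range (\<lambda>n. (f ^^ n) x)"
    have OS: "(f ^^ n) x \<in> S" for n by (induction n) (use x fS in auto)
    have fO: "f ` ?O = ?O"
    proof (rule endo_inj_surj)
      show "finite ?O" by (rule finite_subset[OF _ fin]) (use OS in auto)
      show "f ` ?O \<subseteq> ?O"
      proof
        fix z assume "z \<in> f ` ?O"
        then obtain n where "z = f ((f ^^ n) x)" by blast
        then have "z = (f ^^ Suc n) x" by simp
        then show "z \<in> ?O" by blast
      qed
      show "inj_on f ?O" by (rule inj_on_subset[OF finj]) (use OS in auto)
    qed
    have OpC: "(f ^^ n) x \<notin> p ` C" for n
    proof (induction n)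
      case (Suc n)
      show ?case
      proof
        let ?z = "(f ^^ n) x"
        assume "(f ^^ Suc n) x \<in> p ` C"
        then have "f ?z \<in> p ` C" by simp
        then obtain c where c: "c \<in> C" "f ?z = p c" by blast
        have pz: "p ?z \<in> S" using p[OF OS] by simp
        have "f c = q (f ?z)" using c(2) by (simp add: f_def)
        also have "\<dots> = p ?z" using q[OF pz] by (simp add: f_def)
        finally have fc: "f c = p ?z" .
        have "f c \<in> f ` C" using c(1) by (rule imageI)
        then have "p ?z \<in> C" unfolding Cf fc .
        then have "p (p ?z) \<in> p ` C" by (rule imageI)
        then have "?z \<in> p ` C" using p[OF OS[of n]] by simp
        then show False using Suc.IH by simp
      qed
    qed (use x in simp)
    \<comment> \<open>The dihedral relation: conjugation by \<open>p\<close> inverts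
      \<open>f\<close>.\<close>
    have fpf: "f (p (f z)) = p z" if "z \<in> S" for z
      unfolding f_def using p[OF that] q[of "p z"] p[of "q (p z)"] by simp
    have conj: "(f ^^ j) (p ((f ^^ j) z)) = p z" if z: "z \<in> S" for j z
    proof (induction j)
      case (Suc j)
      have zj: "(f ^^ j) z \<in> S" by (induction j) (use z fS in auto)
      have "(f ^^ Suc j) (p ((f ^^ Suc j) z)) = (f ^^ j) (f (p (f ((f ^^ j) z))))"
        by (simp add: funpow_swap1)
      then show ?case using fpf[OF zj] Suc.IH by simp
    qed simp
    have pinj: "(f ^^ j) y = (f ^^ j) z \<Longrightarrow> y = z" if "y \<in> S" "z \<in> S" for j y z
    proof (induction j)
      case (Suc j)
      have "(f ^^ j) w \<in> S" if "w \<in> S" for w by (induction j) (use that fS in auto)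
      then show ?case using Suc that finj by (auto dest: inj_onD)
    qed simp
    \<comment> \<open>By conjugation the claim reduces to \<open>p x\<close> not lying in the
      \<open>f\<close>-orbit of \<open>x\<close>. If it did, after \<open>n\<close> applications of
      \<open>f\<close>, then \<open>p\<close> (for even \<open>n\<close>) or \<open>q\<close> (for
      odd \<open>n\<close>) would have a fixed point halfway along.\<close>
    have OpO: "(f ^^ i) x \<noteq> p ((f ^^ j) x)" for i j
    proof
      assume "(f ^^ i) x = p ((f ^^ j) x)"
      then have "(f ^^ (j + i)) x = p x" using conj[OF x(1), of j] by (simp add: funpow_add)
      then obtain n where n: "(f ^^ n) x = p x" by blast
      define t where "t = n div 2"
      have zt: "(f ^^ t) x \<in> S" by (rule OS)
      have "n = t + t \<or> n = t + Suc t" unfolding t_def by linarith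
      then show False
      proof
        assume "n = t + t"
        then have "(f ^^ t) ((f ^^ t) x) = (f ^^ t) (p ((f ^^ t) x))"
          using n conj[OF x(1), of t] by (simp add: funpow_add)
        then have "(f ^^ t) x = p ((f ^^ t) x)" using pinj[OF zt, of "p ((f ^^ t) x)" t] p[OF zt] by simp
        then show False using p[OF zt] by simp
      next
        assume "n = t + Suc t"
        then have "(f ^^ t) (f ((f ^^ t) x)) = (f ^^ t) (p ((f ^^ t) x))"
          using n conj[OF x(1), of t] by (simp add: funpow_add funpow_swap1)
        then have "f ((f ^^ t) x) = p ((f ^^ t) x)"
          using pinj[OF fS[OF zt], of "p ((f ^^ t) x)" t] p[OF zt] by simp
        then show False using q[of "p ((f ^^ t) x)"] p[OF zt] by (simp add: f_def)
      qed
    qed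
    have "C \<union> ?O \<in> ?F"
    proof (intro CollectI conjI)
      show "C \<union> ?O \<subseteq> S" using CS OS by auto
      show "f ` (C \<union> ?O) = C \<union> ?O" using Cf fO by (simp add: image_Un)
      show "(C \<union> ?O) \<inter> p ` (C \<union> ?O) = {}"
      proof (rule ccontr)
        assume "\<not> ?thesis"
        then obtain z where z: "z \<in> C \<union> ?O" "z \<in> p ` (C \<union> ?O)" by blast
        then obtain y where y: "y \<in> C \<union> ?O" "z = p y" by blast
        consider "z \<in> C" "y \<in> C" | n where "z \<in> C" "y = (f ^^ n) x" | n where "y \<in> C" "z = (f ^^ n) x"
          | i j where "z = (f ^^ i) x" "y = (f ^^ j) x"
          using z(1) y(1) by blast
        then show False
        proof cases
          case 1
          then have "z \<in> C \<inter> p ` C" using y(2) by simp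
          then show False unfolding Cp by simp
        next
          case 2
          then have "y = p z" using p[OF OS[of n]] y(2) by simp
          then have "y \<in> p ` C" using 2(1) by simp
          then show False using OpC[of n] 2(2) by simp
        next
          case 3
          then have "z \<in> p ` C" unfolding y(2) by (intro imageI)
          then show False using OpC[of n] 3(2) by simp
        next
          case 4 then show False using OpO[of i j] y(2) by simp
        qed
      qed
    qed
    from bspec[OF max this] have "C = C \<union> ?O" by blast
    moreover have "x \<in> ?O" by (rule range_eqI[of _ _ 0]) simp
    ultimately show False using x(2) by blast
  qed
  then show ?thesis using CS Cf Cp unfolding f_def by blast
qed

text \<open>\<open>p\<close> and \<open>q\<close> exchange the two points of a row and of a column.
  The map \<open>g\<close> turns every cycle two steps in one direction: it is
  \<open>q \<circ> p\<close> on \<open>C\<close> and \<open>p \<circ> q\<close> on the other class.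
  Unlike \<open>q \<circ> p\<close> alone, it therefore commutes with both \<open>p\<close> and
  \<open>q\<close>.\<close>

lemma not_realizable_2_dim_2:
  assumes b: "2 \<le> b" shows "\<not> realizable 2 b 2"
proof
  assume "realizable 2 b 2"
  then obtain S where S: "balanced 2 b 2 S" "rigid b 2 S" by (auto simp: realizable_def)
  have Sc: "S \<subseteq> cube b 2" using S(1) by (simp add: balanced_def)
  have ex: "\<exists>w. w \<in> S \<and> w \<noteq> v \<and> w c = v c \<and> (\<forall>u\<in>S. u c = v c \<longrightarrow> u = v \<or> u = w)"
    if v: "v \<in> S" and c: "c < 2" for v c
  proof -
    have "card {u\<in>S. u c = v c} = 2" using S(1) balanced_less[OF S(1) v c] c by (simp add: balanced_def)
    then obtain x y where xy: "{u\<in>S. u c = v c} = {x, y}" "x \<noteq> y" by (auto simp: card_2_iff)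
    have "v \<in> {x, y}" using xy(1) v by blast
    then show ?thesis
    proof
      assume "v = x"
      then show ?thesis using xy by (intro exI[of _ y]) blast
    next
      assume "v \<in> {y}"
      then show ?thesis using xy by (intro exI[of _ x]) blast
    qed
  qed
  define h where "h c v = (SOME w. w \<in> S \<and> w \<noteq> v \<and> w c = v c \<and> (\<forall>u\<in>S. u c = v c \<longrightarrow> u = v \<or> u = w))" for c v
  have h: "h c v \<in> S \<and> h c v \<noteq> v \<and> h c v c = v c \<and> (\<forall>u\<in>S. u c = v c \<longrightarrow> u = v \<or> u = h c v)"
    if "v \<in> S" "c < 2" for c v
    unfolding h_def by (rule someI_ex[OF ex[OF that]])
  have invol: "h c v \<in> S \<and> h c (h c v) = v \<and> h c v \<noteq> v" if v: "v \<in> S" and c: "c < 2" for c v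
  proof -
    have 1: "h c v \<in> S" "h c v \<noteq> v" "h c v c = v c" using h[OF v c] by auto
    have "v = h c v \<or> v = h c (h c v)" using h[OF 1(1) c] v 1(3) by auto
    then show ?thesis using 1 by auto
  qed
  define p q where "p = h 0" and "q = h 1"
  have p: "p z \<in> S \<and> p (p z) = z \<and> p z \<noteq> z" if "z \<in> S" for z unfolding p_def by (rule invol[OF that]) simp
  have q: "q z \<in> S \<and> q (q z) = z \<and> q z \<noteq> z" if "z \<in> S" for z unfolding q_def by (rule invol[OF that]) simp
  have p0: "w = v \<or> w = p v" if "v \<in> S" "w \<in> S" "w 0 = v 0" for v w
    using h[OF that(1), of 0] that(2,3) by (auto simp: p_def)
  have q1: "w = v \<or> w = q v" if "v \<in> S" "w \<in> S" "w 1 = v 1" for v w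
    using h[OF that(1), of 1] that(2,3) by (auto simp: q_def)
  have pc: "p v 0 = v 0" and qc: "q v 1 = v 1" if "v \<in> S" for v
    using h[OF that, of 0] h[OF that, of 1] by (auto simp: p_def q_def)
  define f where "f z = q (p z)" for z
  obtain C where C: "C \<subseteq> S" "f ` C = C" "C \<inter> p ` C = {}" "S \<subseteq> C \<union> p ` C"
    using two_involutions_transversal[OF balanced_finite[OF S(1)], of p q] p q unfolding f_def by blast
  define g where "g z = (if z \<in> C then f z else p (f (p z)))" for z
  have fC: "f z \<in> C" if "z \<in> C" for z using C(2) that by blast
  have pC: "p z \<in> C" if z: "z \<in> S" "z \<notin> C" for z
  proof -
    obtain c where c: "c \<in> C" "z = p c" using C(4) z by blast
    then show ?thesis using p[of c] C(1) by auto
  qed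
  have gS: "g z \<in> S" if z: "z \<in> S" for z
  proof (cases "z \<in> C")
    case True then show ?thesis using fC[OF True] C(1) by (auto simp: g_def)
  next
    case False
    have "f (p z) \<in> S" using fC[OF pC[OF z False]] C(1) by blast
    then show ?thesis using False p by (simp add: g_def)
  qed
  have gp: "g (p z) = p (g z)" if z: "z \<in> S" for z
  proof (cases "z \<in> C")
    case True
    then have "p z \<notin> C" using C(3) by blast
    then show ?thesis using True p[OF z] by (simp add: g_def)
  next
    case False
    have c: "f (p z) \<in> S" using fC[OF pC[OF z False]] C(1) by blast
    show ?thesis using False pC[OF z False] p[OF c] by (simp add: g_def)
  qed
  have gq: "g (q z) = q (g z)" if z: "z \<in> S" for z
  proof (cases "z \<in> C")
    case True
    then obtain c where c: "c \<in> C" "z = f c" using C(2) by blast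
    have cS: "c \<in> S" "p c \<in> S" using c(1) C(1) p by auto
    have "q z = p c" using c(2) q[OF cS(2)] by (simp add: f_def)
    moreover have "p c \<notin> C" using c(1) C(3) by blast
    ultimately have "g (q z) = p (f c)" using p[OF cS(1)] by (simp add: g_def)
    moreover have "q (g z) = p z" using True q[of "p z"] p[OF z] by (simp add: g_def f_def)
    ultimately show ?thesis using c(2) by simp
  next
    case False
    have c: "p z \<in> C" "p z \<in> S" using pC[OF z False] p[OF z] by auto
    have "q z = f (p z)" using p[OF z] by (simp add: f_def)
    then have "q z \<in> C" using fC[OF c(1)] by simp
    then have "g (q z) = q (p (f (p z)))" using \<open>q z = f (p z)\<close> by (simp add: g_def f_def)
    then show ?thesis using False by (simp add: g_def)
  qed
  have fS: "f z \<in> S" if "z \<in> S" for z using p[OF that] q[of "p z"] by (simp add: f_def)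
  have finj: "y = z" if "y \<in> S" "z \<in> S" "f y = f z" for y z
    using that p q unfolding f_def by metis
  have gC: "g z \<in> C \<longleftrightarrow> z \<in> C" if z: "z \<in> S" for z
  proof (cases "z \<in> C")
    case True then show ?thesis using fC by (simp add: g_def)
  next
    case False
    have "f (p z) \<in> C" using fC[OF pC[OF z False]] .
    then show ?thesis using False C(3) by (auto simp: g_def)
  qed
  have ginj: "inj_on g S"
  proof (rule inj_onI)
    fix y z assume y: "y \<in> S" and z: "z \<in> S" and e: "g y = g z"
    have "y \<in> C \<longleftrightarrow> z \<in> C" using gC[OF y] gC[OF z] e by simp
    then show "y = z"
    proof (cases "y \<in> C")
      case True
      then show ?thesis using \<open>y \<in> C \<longleftrightarrow> z \<in> C\<close> e finj[OF y z] by (simp add: g_def)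
    next
      case False
      then have n: "p (f (p y)) = p (f (p z))" using \<open>y \<in> C \<longleftrightarrow> z \<in> C\<close> e by (simp add: g_def)
      have S': "p y \<in> S" "p z \<in> S" using p y z by auto
      then have "f (p y) = f (p z)" using n p[OF fS[OF S'(1)]] p[OF fS[OF S'(2)]] by metis
      then have "p y = p z" using finj[OF S'] by simp
      then show ?thesis using p[OF y] p[OF z] by metis
    qed
  qed
  have gpres: "g v c = g w c" if c: "c < 2" and vw: "v \<in> S" "w \<in> S" "v c = w c" for c v w
  proof -
    consider "c = 0" | "c = 1" using c by linarith
    then show ?thesis
    proof cases
      case 1
      then have "w = v \<or> w = p v" using p0[OF vw(1,2)] vw(3) by simp
      then show ?thesis using gp[OF vw(1)] pc[OF gS[OF vw(1)]] 1 by auto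
    next
      case 2
      then have "w = v \<or> w = q v" using q1[OF vw(1,2)] vw(3) by simp
      then show ?thesis using gq[OF vw(1)] qc[OF gS[OF vw(1)]] 2 by auto
    qed
  qed
  have fixed: "g v = v" if "v \<in> S" for v
    by (rule rigid_point_map[OF S _ gS ginj gpres that]) simp
  have "card S = 2 * b" using card_balanced[OF S(1)] by simp
  then have "S \<noteq> {}" using b by (cases "S = {}") simp_all
  then have "C \<noteq> {}" using C(4) by blast
  then obtain z where z: "z \<in> C" by blast
  then have zS: "z \<in> S" using C(1) by blast
  \<comment> \<open>Turning by two steps is trivial only on a cycle of length two, where
    \<open>p z = q z\<close> would share both coordinates with \<open>z\<close>.\<close>
  have "q (p z) = z" using fixed[OF zS] z by (simp add: g_def f_def)
  then have "p z = q z" using q[of "p z"] p[OF zS] by metis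
  then have "p z 0 = z 0" "p z 1 = z 1" using pc[OF zS] qc[OF zS] by auto
  then have "p z = z"
    by (intro cube_eqI[of _ b 2]) (use p[OF zS] zS Sc in \<open>auto simp: less_2_cases_iff\<close>)
  then show False using p[OF zS] by simp
qed


section \<open>The base size\<close>

lemma log_interval:
  assumes "2 \<le> b" "2 \<le> x"
  obtains e where "1 \<le> e" "b ^ (e - 1) < x" "x \<le> b ^ e" "nat \<lceil>log (real b) (real x)\<rceil> = e"
proof -
  obtain n where n: "b ^ n < x" "x \<le> b ^ (n + 1)" using ex_power_ivl2[OF assms] by blast
  have "\<lceil>log (real b) (real x)\<rceil> = int n + 1" by (rule ceiling_log_nat_eq_if[OF n assms(1)])
  then show thesis using that[of "n + 1"] n by simp
qed

lemma b_size_base_2: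
  assumes "3 \<le> a" "a \<noteq> 4" shows "b_size a 2 = Some (nat \<lceil>log 2 (real a + 3)\<rceil> + 1)"
proof -
  obtain e where e: "1 \<le> e" "2 ^ (e - 1) < a + 3" "a + 3 \<le> 2 ^ e" "nat \<lceil>log (real 2) (real (a + 3))\<rceil> = e"
    by (rule log_interval[of 2 "a + 3"]) auto
  have "3 \<le> e"
  proof (rule ccontr)
    assume "\<not> 3 \<le> e"
    then have "(2::nat) ^ e \<le> 2 ^ 2" by (intro power_increasing) auto
    then show False using e(3) assms(1) by simp
  qed
  have r: "realizable a 2 (e + 1)"
  proof (cases "e = 3")
    \<comment> \<open>\<open>a + 3 \<le> 8\<close> leaves 3, 4 and 5, of which 4 is the exception
      and 5 the complement of 3.\<close>
    case True
    then have "a = 3 \<or> a = 5" using e(3) assms by auto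
    moreover have "realizable 5 2 4" using realizable_of_complement[of 2 4 5] realizable_3_2_4 by simp
    ultimately show ?thesis using True realizable_3_2_4 by auto
  next
    case False
    then show ?thesis using realizable_base_2[of "e + 1" a] e(3) \<open>3 \<le> e\<close> assms(1) by simp
  qed
  have nr: "\<not> realizable a 2 e"
  proof (cases "2 ^ (e - 1) \<le> a + 1")
    case True then show ?thesis using not_realizable_large[of 2 e a] e(1) by simp
  next
    \<comment> \<open>Now \<open>2 ^ (e - 1) = a + 2\<close>, and the complementary slice size 2
      fails for two symbols; hence \<open>a + 3\<close> in the formula.\<close>
    case False
    then have "2 ^ (e - 1) - a = 2" using e(2) by linarith
    then show ?thesis using realizable_complement[of a 2 e] not_realizable_2_2[OF e(1)] by auto
  qed
  have "b_size a 2 = Some (e + 1)" by (rule b_size_eqI[OF r]) (use nr e(1) assms(1) in auto)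
  moreover have "nat \<lceil>log 2 (real a + 3)\<rceil> = e" using e(4) by (simp add: add.commute)
  ultimately show ?thesis by simp
qed

lemma b_size_generic:
  assumes a: "3 \<le> a" and b: "3 \<le> b"
    and ex: "\<not> ((a, b) \<in> {(3, 6), (3, 7), (4, 7), (7, 3)} \<or> b = a + 2)"
  shows "b_size a b = Some (nat \<lceil>log (real b) (real a + 2)\<rceil> + 1)"
proof -
  obtain e where e: "1 \<le> e" "b ^ (e - 1) < a + 2" "a + 2 \<le> b ^ e" "nat \<lceil>log (real b) (real (a + 2))\<rceil> = e"
    by (rule log_interval[of b "a + 2"]) (use b in auto)
  have r: "realizable a b (e + 1)"
  proof (cases "e = 1")
    \<comment> \<open>Here \<open>a + 2 \<le> b\<close>, and \<open>b = a + 2\<close> is excluded.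
      The pairs with \<open>a \<ge> 3\<close> and \<open>a + 3 \<le> b < 8\<close> are exactly the
      exceptions (3, 6), (3, 7) and (4, 7).\<close>
    case True
    then have le: "a + 3 \<le> b" using e(3) ex by simp
    have "8 \<le> b"
    proof (rule ccontr)
      assume "\<not> 8 \<le> b"
      then have "b = 6 \<and> a = 3 \<or> b = 7 \<and> (a = 3 \<or> a = 4)" using le a by linarith
      then show False using ex by auto
    qed
    then have "realizable a b 2" using realizable_dim_2 a le by simp
    then show ?thesis using True by (simp add: numeral_2_eq_2)
  next
    case False
    then have e2: "2 \<le> e" using e(1) by simp
    show ?thesis
    proof (cases "b = 3")
      case b3: True
      show ?thesis
      proof (cases "e = 2")
        \<comment> \<open>Here \<open>a + 2 \<le> 9\<close>, and \<open>a = 7\<close> is an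
          exception.\<close>
        case True
        then have "a \<le> 6" using e(3) b3 ex by auto
        then have "realizable a 3 3" using realizable_base_3_dim_3 a by simp
        then show ?thesis using True b3 by (simp add: numeral_3_eq_3)
      next
        case False
        then show ?thesis using realizable_base_3[of "e + 1" a] e(3) b3 e2 a by simp
      qed
    next
      case False
      then show ?thesis using realizable_ge_4[of b "e + 1" a] b e(3) e2 a by simp
    qed
  qed
  have "\<not> realizable a b e" by (rule not_realizable_large) (use b e in auto)
  moreover have "3 * 3 \<le> a * b" using a b by (intro mult_le_mono)
  ultimately have "b_size a b = Some (e + 1)" by (intro b_size_eqI[OF r]) (use e(1) a in auto)
  moreover have "nat \<lceil>log (real b) (real a + 2)\<rceil> = e" using e(4) by (simp add: add.commute)
  ultimately show ?thesis by simp
qed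

lemma b_size_3I:
  assumes "4 \<le> b" "2 \<le> a" "a + 2 \<le> b\<^sup>2" "\<not> realizable a b 2" shows "b_size a b = Some 3"
proof (rule b_size_eqI)
  show "realizable a b 3" by (rule realizable_ge_4) (use assms in auto)
  have "2 * 4 \<le> a * b" using assms(1,2) by (intro mult_le_mono) auto
  then show "2 \<le> a * b" by simp
qed (use assms in auto)

theorem theorem1p1:
  shows
    "(b_size 2 2 = None \<and> b_size 2 3 = Some 4 \<and> (\<forall>b::nat. b \<ge> 4 \<longrightarrow> b_size 2 b = Some 3)) \<and>
     (b_size 4 2 = Some 5 \<and>
        (\<forall>a::nat. a \<ge> 2 \<and> a \<notin> {2, 4} \<longrightarrow>
           b_size a 2 = Some (nat \<lceil>log 2 (real a + 3)\<rceil> + 1))) \<and>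
     (\<forall>a b::nat. a \<ge> 3 \<and> b \<ge> 3 \<and>
        \<not> ((a, b) \<in> {(3, 6), (3, 7), (4, 7), (7, 3)} \<or> b = a + 2) \<longrightarrow>
           b_size a b = Some (nat \<lceil>log (real b) (real a + 2)\<rceil> + 1)) \<and>
     (b_size 3 6 = Some 3 \<and> b_size 3 7 = Some 3 \<and> b_size 4 7 = Some 3 \<and> b_size 7 3 = Some 4 \<and>
        (\<forall>a::nat. a \<ge> 3 \<longrightarrow> b_size a (a + 2) = Some 3))"
proof (intro conjI allI impI)
  show "b_size 2 2 = None" by (rule b_size_eq_None[OF not_realizable_2_2]) auto
  show "b_size 2 3 = Some 4"
    by (rule b_size_eqI[OF realizable_2_3_4]) (use not_realizable_2_3_3 in auto)
  show "b_size 2 b = Some 3" if b: "4 \<le> b" for b :: nat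
  proof (rule b_size_3I[OF b])
    have "4 * 4 \<le> b * b" using b by (intro mult_le_mono)
    then show "2 + 2 \<le> b\<^sup>2" by (simp add: power2_eq_square)
    show "\<not> realizable 2 b 2" by (rule not_realizable_2_dim_2) (use b in simp)
  qed simp
  have "realizable 4 2 5" by (rule realizable_base_2) auto
  then show "b_size 4 2 = Some 5"
    by (rule b_size_eqI) (use not_realizable_4_2_4 in auto)
  show "b_size a 2 = Some (nat \<lceil>log 2 (real a + 3)\<rceil> + 1)" if "a \<ge> 2 \<and> a \<notin> {2, 4}" for a :: nat
    by (rule b_size_base_2) (use that in auto)
  show "b_size a b = Some (nat \<lceil>log (real b) (real a + 2)\<rceil> + 1)"
    if "a \<ge> 3 \<and> b \<ge> 3 \<and> \<not> ((a, b) \<in> {(3, 6), (3, 7), (4, 7), (7, 3)} \<or> b = a + 2)" for a b :: nat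
    using b_size_generic that by blast
  show "b_size 3 6 = Some 3" by (rule b_size_3I) (use not_realizable_3_6_2 in auto)
  show "b_size 3 7 = Some 3" by (rule b_size_3I) (use not_realizable_3_7_2 in auto)
  have "\<not> realizable 4 7 2" using realizable_complement[of 4 7 2] not_realizable_3_7_2 by auto
  then show "b_size 4 7 = Some 3" by (intro b_size_3I) auto
  have "\<not> realizable 7 3 3" using realizable_complement[of 7 3 3] not_realizable_2_3_3 by auto
  moreover have "realizable 7 3 4" by (rule realizable_base_3) auto
  ultimately show "b_size 7 3 = Some 4" by (intro b_size_eqI) auto
  show "b_size a (a + 2) = Some 3" if a: "a \<ge> 3" for a :: nat
  proof (rule b_size_3I)
    have "5 * (a + 2) \<le> (a + 2) * (a + 2)" using a by (intro mult_le_mono1) simp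
    then show "a + 2 \<le> (a + 2)\<^sup>2" by (simp add: power2_eq_square)
    show "\<not> realizable a (a + 2) 2"
      using realizable_complement[of a "a + 2" 2] not_realizable_2_dim_2[of "a + 2"] by auto
  qed (use a in auto)
qed

end
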